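(* Let $k,\ell$ be positive integers with $\ell<k\leq 2\ell+1$. Then \[ \widehat{\mathscr{M}}_{(k,\ell)}(N)=\Big(\frac{1}{k+\ell}+o(1)\Big)N\qquad (N\to\infty). \]
   Context: For positive integers $k>\ell$, a set $S$ of positive integers is restricted $(k,\ell)$-sum-free if for any $k$ pairwise distinct elements $a_1,\dots,a_k\in S$ and any $\ell$ pairwise distinct elements $b_1,\dots,b_\ell\in S$ one has $a_1+\dots+a_k\neq b_1+\dots+b_\ell$. Let $\widehat{\mathscr{M}}_{(k,\ell)}(N)=\inf_{A}\max\{|S|: S\subseteq A,\ S \text{ restricted } (k,\ell)\text{-sum-free}\}$, the infimum over all sets $A$ of $N$ positive integers. *)

theory Defs
  imports Complex_Main "HOL-Library.Landau_Symbols"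
begin

text \<open>
  The families \<open>a\<close> and \<open>b\<close> are each injective, but a value of \<open>a\<close> may also be a value of \<open>b\<close>.
\<close>

definition restricted_sum_free :: "nat \<Rightarrow> nat \<Rightarrow> nat set \<Rightarrow> bool" where
  "restricted_sum_free k l S \<longleftrightarrow>
     (\<forall>a b :: nat \<Rightarrow> nat.
        inj_on a {1..k} \<and> a ` {1..k} \<subseteq> S \<and> inj_on b {1..l} \<and> b ` {1..l} \<subseteq> S \<longrightarrow>
        (\<Sum>i=1..k. a i) \<noteq> (\<Sum>j=1..l. b j))"

definition max_restricted_sum_free :: "nat \<Rightarrow> nat \<Rightarrow> nat set \<Rightarrow> nat" where
  "max_restricted_sum_free k l A = Max {card S | S. S \<subseteq> A \<and> restricted_sum_free k l S}"

text \<open>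
  The \<open>Max\<close> above is taken over a finite set when \<open>A\<close> is finite, and that set contains \<open>card {}\<close>
  when \<open>k\<close> or \<open>l\<close> is positive. The infimum below is over a nonempty set of natural numbers,
  so it is attained.
\<close>

definition M_hat :: "nat \<Rightarrow> nat \<Rightarrow> nat \<Rightarrow> nat" where
  "M_hat k l N =
     (INF A \<in> {A. finite A \<and> card A = N \<and> (\<forall>x\<in>A. 0 < x)}. max_restricted_sum_free k l A)"

end

(*
  Lower bound: the residues y modulo m with l m < (k^2 - l^2) y < k m form a set that has no solution
  even modulo m, and some dilation maps a proportion 1/(k+l) of any given set into it.

  Upper bound: let r = k - l and fix c > 1/(k+l). Consider boxes g{1..y} along a chain in which g grows
  by divisibility while the length g y decreases rapidly. A restricted (k,l)-sum-free set X cannot have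
  density at least c on more than a bounded number of boxes of the chain. Suppose it does and let f be
  the indicator of X on the longest box. By random sampling (Croot and Sisask) together with an energy
  increment over the chain, some difference g n of two chain lengths is an almost period of the
  autocorrelation p of f on a box of step g, and the congruence conditions on the chain make n free of
  small prime factors. Modulo such an n, Pollard's theorem holds without interference from subgroups. It
  makes the popular differences of X, added l times, so numerous that they meet an r-fold sum of
  distinct elements of X on the box of step g. This is a solution with r + l summands on one side and l
  on the other, all distinct as required.

  Hence the average density over a long chain is at most c + o(1). A multiplicative Foelner set
  transfers this average over dilates to a single finite set, and disjoint dilates of that set serve
  for all large N.
*)
theory Submission
  imports Defs "HOL-Library.FuncSet"
begin

section \<open>Pollard's theorem for residues modulo an integer without small prime factors\<close>

text \<open>The threshold comes from a count modulo n. If X has density c on both boxes, sums of r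
  elements from the box of step g fill about min(1, r*c) of the residues, popular differences about
  min(1, 2*c), and sums of l of these about min(1, 2*l*c). Since r + 2*l = k + l, the two sets of
  sums meet once c > 1/(k+l). The obstacle is the return from residues to integers and to distinct
  summands. Differences are therefore counted on the longest box, where each popular one has a
  positive proportion of representations, far more than the values to be avoided. And since g*n is
  an almost period of p, outside few exceptional classes every integer m of a popular class within a
  window of a few n has p(g*m) large. So one difference may be exchanged for another representative
  of its class, which turns the congruence into an equation. Almost periods are found through a
  function of two variables because the second moments of p over box differences are then squared
  norms of box averages, and these grow, up to small errors, when the boxes get shorter.\<close>

definition rep :: "int \<Rightarrow> int set \<Rightarrow> int set \<Rightarrow> int \<Rightarrow> nat" where
  "rep n A B x = card {b \<in> B. (x - b) mod n \<in> A}"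

definition shift :: "int \<Rightarrow> int \<Rightarrow> int set \<Rightarrow> int set" where
  "shift n e B = (\<lambda>b. (b + e) mod n) ` B"

lemma bij_betw_shift:
  fixes n :: int assumes "n > 0"
  shows "bij_betw (\<lambda>x. (x + e) mod n) {0..<n} {0..<n}"
proof (rule bij_betw_byWitness[where f' = "\<lambda>x. (x - e) mod n"])
  show "\<forall>a\<in>{0..<n}. ((a + e) mod n - e) mod n = a"
    by (auto simp: mod_diff_left_eq)
  show "\<forall>a\<in>{0..<n}. ((a - e) mod n + e) mod n = a"
    by (auto simp: mod_add_left_eq)
qed (use assms in auto)

lemma sum_shift_mod:
  fixes n :: int assumes "n > 0"
  shows "(\<Sum>x\<in>{0..<n}. F ((x + e) mod n)) = (\<Sum>x\<in>{0..<n}. F x)"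
  using sum.reindex_bij_betw[OF bij_betw_shift[OF assms, of e], of F] .

lemma inj_on_shift:
  fixes n :: int assumes "n > 0" "B \<subseteq> {0..<n}"
  shows "inj_on (\<lambda>x. (x + e) mod n) B"
  using bij_betw_shift[OF assms(1)] assms(2) by (meson bij_betw_def inj_on_subset)

lemma shift_subset: "n > 0 \<Longrightarrow> shift n e B \<subseteq> {0..<n}"
  by (auto simp: shift_def)

lemma card_shift: "n > 0 \<Longrightarrow> B \<subseteq> {0..<n} \<Longrightarrow> card (shift n e B) = card B"
  unfolding shift_def by (rule card_image) (rule inj_on_shift)

lemma finite_residues: "B \<subseteq> {0..<n::int} \<Longrightarrow> finite B"
  by (rule finite_subset) auto

lemma rep_eq_sum: "finite B \<Longrightarrow> rep n A B x = (\<Sum>b\<in>B. of_bool ((x - b) mod n \<in> A))"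
  by (simp add: rep_def Int_def)

lemma rep_shift:
  assumes "n > 0" "B \<subseteq> {0..<n}"
  shows "rep n A (shift n e B) x = rep n A B ((x - e) mod n)"
proof -
  have fin: "finite B" using assms finite_residues by blast
  have eq: "(x - (b + e) mod n) mod n = ((x - e) mod n - b) mod n" for b
    by (simp add: mod_diff_right_eq mod_diff_left_eq algebra_simps)
  show ?thesis
    using fin unfolding rep_eq_sum[OF fin] shift_def
    by (subst rep_eq_sum) (auto simp: sum.reindex[OF inj_on_shift[OF assms]] eq)
qed

lemma rep_commute:
  assumes "n > 0" "A \<subseteq> {0..<n}" "B \<subseteq> {0..<n}"
  shows "rep n A B x = rep n B A x"
proof -
  have inv: "(x - (x - b) mod n) mod n = b" if "b \<in> {0..<n}" for b
    using that by (simp add: mod_diff_right_eq)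
  have "bij_betw (\<lambda>b. (x - b) mod n) {b \<in> B. (x - b) mod n \<in> A} {a \<in> A. (x - a) mod n \<in> B}"
    by (rule bij_betw_byWitness[where f' = "\<lambda>b. (x - b) mod n"]) (use assms inv in auto)
  then show ?thesis unfolding rep_def by (rule bij_betw_same_card)
qed

lemma sum_rep:
  assumes "n > 0" "A \<subseteq> {0..<n}" "B \<subseteq> {0..<n}"
  shows "(\<Sum>x\<in>{0..<n}. rep n A B x) = card A * card B"
proof -
  have fin: "finite B" using assms finite_residues by blast
  have "(\<Sum>x\<in>{0..<n}. rep n A B x) = (\<Sum>b\<in>B. \<Sum>x\<in>{0..<n}. of_bool ((x + (- b)) mod n \<in> A))"
    unfolding rep_eq_sum[OF fin] by (subst sum.swap) simp
  also have "\<dots> = (\<Sum>b\<in>B. \<Sum>x\<in>{0..<n}. of_bool (x \<in> A))"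
    by (subst sum_shift_mod[OF assms(1)]) simp
  also have "(\<Sum>x\<in>{0..<n}. of_bool (x \<in> A)) = card A"
    using assms(2) by (simp add: Int_absorb1)
  finally show ?thesis by simp
qed

lemma rep_le: "finite B \<Longrightarrow> rep n A B x \<le> card B"
  unfolding rep_def by (rule card_mono) auto

lemma rep_mono: "finite B \<Longrightarrow> B' \<subseteq> B \<Longrightarrow> rep n A B' x \<le> rep n A B x"
  unfolding rep_def by (rule card_mono) auto

lemma rep_Un_right:
  "finite B \<Longrightarrow> finite C \<Longrightarrow> B \<inter> C = {} \<Longrightarrow> rep n A (B \<union> C) x = rep n A B x + rep n A C x"
  by (simp add: rep_eq_sum sum.union_disjoint del: sum_of_bool_eq)

lemma rep_Un_left:
  assumes "finite B" "A \<inter> C = {}" shows "rep n (A \<union> C) B x = rep n A B x + rep n C B x"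
proof -
  have "(of_bool (y \<in> A \<union> C) :: nat) = of_bool (y \<in> A) + of_bool (y \<in> C)" for y
    using assms(2) by auto
  then show ?thesis using assms(1) by (simp add: rep_eq_sum sum.distrib del: sum_of_bool_eq)
qed

text \<open>This is the Dyson transform at the level of counts: cut \<open>A\<close> and
  \<open>B\<close> along their intersection. By commutativity the pairs in (A \<inter> B) x (B - A)
  count as pairs in (B - A) x (A \<inter> B), where they complete those in A x (A \<inter>
  B).\<close>

lemma rep_split:
  assumes "n > 0" "A \<subseteq> {0..<n}" "B \<subseteq> {0..<n}"
  shows "rep n A B x = rep n (A \<union> B) (A \<inter> B) x + rep n (A - B) (B - A) x"
proof -
  have fin: "finite A" "finite B" using assms finite_residues by blast+
  have B_eq: "(A \<inter> B) \<union> (B - A) = B" and A_eq: "(A - B) \<union> (A \<inter> B) = A" by auto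
  have "rep n A ((A \<inter> B) \<union> (B - A)) x = rep n A (A \<inter> B) x + rep n A (B - A) x"
    by (rule rep_Un_right) (use fin in auto)
  then have "rep n A B x = rep n A (A \<inter> B) x + rep n A (B - A) x" unfolding B_eq .
  moreover have "rep n ((A - B) \<union> (A \<inter> B)) (B - A) x = rep n (A - B) (B - A) x + rep n (A \<inter> B) (B - A) x"
    by (rule rep_Un_left) (use fin in auto)
  then have "rep n A (B - A) x = rep n (A - B) (B - A) x + rep n (A \<inter> B) (B - A) x" unfolding A_eq .
  moreover have "rep n (A \<inter> B) (B - A) x = rep n (B - A) (A \<inter> B) x"
    by (rule rep_commute) (use assms in auto)
  moreover have "A \<union> (B - A) = A \<union> B" by auto
  then have "rep n (A \<union> B) (A \<inter> B) x = rep n A (A \<inter> B) x + rep n (B - A) (A \<inter> B) x"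
    using rep_Un_left[of "A \<inter> B" A "B - A" n x] fin by auto
  ultimately show ?thesis by simp
qed

section \<open>Truncated representation counts and Pollard's inequality\<close>

definition trunc_rep :: "int \<Rightarrow> nat \<Rightarrow> int set \<Rightarrow> int set \<Rightarrow> nat" where
  "trunc_rep n t A B = (\<Sum>x\<in>{0..<n}. min t (rep n A B x))"

lemma trunc_rep_shift:
  assumes "n > 0" "B \<subseteq> {0..<n}"
  shows "trunc_rep n t A (shift n e B) = trunc_rep n t A B"
  using sum_shift_mod[OF assms(1), of "\<lambda>x. min t (rep n A B x)" "-e"]
  by (simp add: trunc_rep_def rep_shift[OF assms])

lemma trunc_rep_full:
  assumes "n > 0" "A \<subseteq> {0..<n}" "B \<subseteq> {0..<n}" "card B \<le> t"
  shows "trunc_rep n t A B = card A * card B"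
proof -
  have "min t (rep n A B x) = rep n A B x" for x
    using rep_le[OF finite_residues[OF assms(3)], of n A x] assms(4) by simp
  then show ?thesis using sum_rep[OF assms(1-3)] by (simp add: trunc_rep_def)
qed

lemma residue_class_card:
  fixes n h c :: int assumes "n > 0" "h > 0" "h dvd n" "B \<subseteq> {0..<n}" "\<And>b. b \<in> B \<Longrightarrow> b mod h = c"
  shows "int (card B) * h \<le> n"
proof -
  have "inj_on (\<lambda>b. b div h) B"
    by (rule inj_onI) (metis assms(5) div_mult_mod_eq)
  moreover have "(\<lambda>b. b div h) ` B \<subseteq> {0..<n div h}"
  proof
    fix y assume "y \<in> (\<lambda>b. b div h) ` B"
    then obtain b where b: "b \<in> B" "y = b div h" by auto
    then have bb: "0 \<le> b" "b < n" using assms(4) by auto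
    obtain m where m: "n = h * m" using assms(3) by (rule dvdE)
    have "h * (b div h) + b mod h = b" "b mod h \<ge> 0" using assms(2) by simp_all
    then have "h * (b div h) \<le> b" by linarith
    then have "h * (b div h) < h * m" using bb(2) m by linarith
    then have "b div h < m" using assms(2) by (simp only: mult_less_cancel_left_pos)
    moreover have "n div h = m" using m assms(2) by simp
    ultimately show "y \<in> {0..<n div h}" using bb assms(2) b
      by (simp add: pos_imp_zdiv_nonneg_iff)
  qed
  ultimately have "card B \<le> card {0..<n div h}" by (meson card_inj_on_le finite_atLeastLessThan_int)
  moreover have "n div h \<ge> 0" using assms(1,2) by (simp add: pos_imp_zdiv_nonneg_iff)
  ultimately have "int (card B) \<le> n div h" by simp
  then have "int (card B) * h \<le> n div h * h" using assms(2) by (intro mult_right_mono) auto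
  then show ?thesis using assms(3) by simp
qed


text \<open>By \<open>all\<close>, a translate of \<open>B\<close> that meets \<open>A\<close> stays
  inside, so all differences of elements of \<open>B\<close> are periods of \<open>A\<close>. Every
  period is a multiple of the least positive one, h, which divides \<open>n\<close>. If h = 1 then
  \<open>A\<close> is everything; otherwise h is at least \<open>w\<close> and \<open>B\<close> lies
  in one class modulo h.\<close>

lemma shift_invariant_cases:
  fixes n w :: int
  assumes n: "n > 0" and A: "A \<subseteq> {0..<n}" "A \<noteq> {}" and B: "B \<subseteq> {0..<n}"
    and rough: "\<And>h. h dvd n \<Longrightarrow> 1 < h \<Longrightarrow> w \<le> h"
    and all: "\<And>e. shift n e B \<inter> A = {} \<or> shift n e B \<subseteq> A"
  shows "A = {0..<n} \<or> int (card B) * w \<le> n"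
proof (cases "B = {}")
  case True then show ?thesis using n by simp
next
  case False
  then obtain b0 where b0: "b0 \<in> B" by auto
  define per where "per d \<longleftrightarrow> (\<forall>a\<in>A. (a + d) mod n \<in> A)" for d
  have per_diff: "per (b - b0)" if b: "b \<in> B" for b
    unfolding per_def
  proof
    fix a assume a: "a \<in> A"
    have "(b0 + (a - b0)) mod n \<in> shift n (a - b0) B" using b0 unfolding shift_def by (rule imageI)
    moreover have "(b0 + (a - b0)) mod n = a" using a A by auto
    ultimately have "shift n (a - b0) B \<subseteq> A" using all[of "a - b0"] a by auto
    moreover have "(b + (a - b0)) mod n \<in> shift n (a - b0) B" using b unfolding shift_def by (rule imageI)
    ultimately have "(b + (a - b0)) mod n \<in> A" by blast
    moreover have "b + (a - b0) = a + (b - b0)" by simp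
    ultimately show "(a + (b - b0)) mod n \<in> A" by simp
  qed
  have per_add: "per (d + e)" if "per d" "per e" for d e
    unfolding per_def
  proof
    fix a assume "a \<in> A"
    then have "((a + d) mod n + e) mod n \<in> A" using that unfolding per_def by blast
    then show "(a + (d + e)) mod n \<in> A" by (simp add: mod_add_left_eq add.assoc)
  qed
  have per_n: "per n" using A by (auto simp: per_def subset_iff)
  have per_0: "per 0" using A by (auto simp: per_def subset_iff)
  have per_nat: "per (int m * d)" if "per d" for m d
  proof (induction m)
    case (Suc m)
    have "int (Suc m) * d = int m * d + d" by (simp add: algebra_simps)
    then show ?case using per_add[OF Suc that] by simp
  qed (simp add: per_0)
  have per_cong: "per d" if "per e" "e mod n = d mod n" for d e
  proof -
    have "(a + d) mod n = (a + e) mod n" for a using that(2) mod_add_cong[of a n a d e] by simp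
    then show ?thesis using that(1) by (simp add: per_def)
  qed
  have per_mult: "per (m * d)" if "per d" for m d
  proof (rule per_cong[OF per_nat[OF that, of "nat (m mod n)"]])
    show "int (nat (m mod n)) * d mod n = m * d mod n"
      using n by (simp add: mod_mult_left_eq)
  qed
  define h where "h = (LEAST m::nat. 0 < m \<and> per (int m))"
  have hP: "0 < h \<and> per (int h)" unfolding h_def
    by (rule LeastI[of _ "nat n"]) (use n per_n in auto)
  have h_dvd: "int h dvd d" if "per d" for d
  proof (rule ccontr)
    assume nd: "\<not> int h dvd d"
    have "d + (- (d div int h)) * int h = d mod int h" 
      using minus_div_mult_eq_mod[of d "int h"] by simp
    then have p: "per (d mod int h)" using per_add[OF that per_mult[of "int h" "- (d div int h)"]] hP by simp
    have pos: "0 < d mod int h" "d mod int h < int h" 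
    proof -
      have "d mod int h \<noteq> 0" using nd by (simp only: mod_eq_0_iff_dvd not_False_eq_True)
      moreover have "0 \<le> d mod int h" using hP by simp
      ultimately show "0 < d mod int h" by linarith
      show "d mod int h < int h" using hP by simp
    qed
    have "0 < nat (d mod int h) \<and> per (int (nat (d mod int h)))" using p pos by simp
    then have "h \<le> nat (d mod int h)" by (subst (1) h_def) (rule Least_le)
    then show False using pos by linarith
  qed
  have hn: "int h dvd n" using h_dvd[OF per_n] .
  show ?thesis
  proof (cases "h = 1")
    case True
    then have p1: "per d" for d using per_mult[of 1 d] hP by simp
    obtain a where a: "a \<in> A" using A by auto
    have "x \<in> A" if "x \<in> {0..<n}" for x
    proof -
      have "(a + (x - a)) mod n \<in> A" using p1[of "x - a"] a unfolding per_def by blast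
      then show ?thesis using that by simp
    qed
    then show ?thesis using A by auto
  next
    case False
    then have h1: "1 < int h" using hP by linarith
    have "int (card B) * int h \<le> n"
    proof (rule residue_class_card[OF n _ hn B])
      fix b assume "b \<in> B"
      then show "b mod int h = b0 mod int h" using h_dvd[OF per_diff] by (simp add: mod_eq_dvd_iff)
    qed (use hP in auto)
    moreover have "int (card B) * w \<le> int (card B) * int h"
      using rough[OF hn h1] by (intro mult_left_mono) auto
    ultimately show ?thesis by linarith
  qed
qed

text \<open>
  The induction replaces \<open>(A, B)\<close> by the union and intersection of \<open>A\<close> with a translate of \<open>B\<close>. It stops
  when every translate of \<open>B\<close> lies in \<open>A\<close> or misses it; then \<open>A\<close> is periodic, and since \<open>n\<close> has no
  small divisor, \<open>B\<close> has at most \<open>n / w\<close> elements.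
\<close>

lemma pollard:
  fixes n w :: int
  assumes n: "n > 0" and w: "w > 0" and rough: "\<And>h. h dvd n \<Longrightarrow> 1 < h \<Longrightarrow> w \<le> h"
  shows "A \<subseteq> {0..<n} \<Longrightarrow> B \<subseteq> {0..<n} \<Longrightarrow> t \<le> card A \<Longrightarrow> t \<le> card B \<Longrightarrow>
    real t * min (real_of_int n) (real (card A) + real (card B) - real t - real_of_int n / real_of_int w)
      \<le> real (trunc_rep n t A B)"
proof (induction "card B" arbitrary: A B t rule: less_induct)
  case less
  let ?D = "real_of_int n / real_of_int w"
  have D: "?D \<ge> 0" using n w by simp
  note A = less.prems(1) and B = less.prems(2) and tA = less.prems(3) and tB = less.prems(4)
  have finA: "finite A" and finB: "finite B" using A B finite_residues by blast+
  show ?case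
  proof (cases "\<exists>e. shift n e B \<inter> A \<noteq> {} \<and> \<not> shift n e B \<subseteq> A")
    case True
    then obtain e where e: "shift n e B \<inter> A \<noteq> {}" "\<not> shift n e B \<subseteq> A" by auto
    define C where "C = shift n e B"
    have C: "C \<subseteq> {0..<n}" unfolding C_def by (rule shift_subset[OF n])
    have cC: "card C = card B" unfolding C_def by (rule card_shift[OF n B])
    have finC: "finite C" using C finite_residues by blast
    define I U A' B' where "I = A \<inter> C" and "U = A \<union> C" and "A' = A - C" and "B' = C - A"
    have fins: "finite I" "finite U" "finite A'" "finite B'" using finA finC by (auto simp: I_def U_def A'_def B'_def)
    have subs: "I \<subseteq> {0..<n}" "U \<subseteq> {0..<n}" "A' \<subseteq> {0..<n}" "B' \<subseteq> {0..<n}"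
      using A C by (auto simp: I_def U_def A'_def B'_def)
    have cA: "card A = card A' + card I"
      unfolding A'_def I_def by (subst card_Un_disjoint[symmetric]) (use finA finC in \<open>auto intro: arg_cong[where f = card]\<close>)
    have cCI: "card C = card B' + card I"
      unfolding B'_def I_def by (subst card_Un_disjoint[symmetric]) (use finA finC in \<open>auto intro: arg_cong[where f = card]\<close>)
    have cU: "card U + card I = card A + card C"
      unfolding U_def I_def using card_Un_Int[OF finA finC] by simp
    have I0: "card I > 0" using e(1) fins(1) by (auto simp: C_def I_def card_gt_0_iff)
    have B'0: "card B' > 0" using e(2) fins(4) by (auto simp: C_def B'_def card_gt_0_iff)
    have tr: "trunc_rep n t A B = trunc_rep n t A C" unfolding C_def by (rule trunc_rep_shift[OF n B, symmetric])
    have split: "rep n A C x = rep n U I x + rep n A' B' x" for x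
      unfolding U_def I_def A'_def B'_def by (rule rep_split[OF n A C])
    have IU: "card I \<le> card U" by (rule card_mono) (use fins in \<open>auto simp: I_def U_def\<close>)
    show ?thesis
    \<comment> \<open>The pair (U, I) keeps the total size and its counts are no larger. If
      \<open>I\<close> is too small for the threshold t, it is counted in full with b = |I|, and the
      remaining t - b is spent on (A', B'). Both \<open>I\<close> and \<open>B'\<close> are smaller
      than \<open>B\<close>.\<close>
    proof (cases "t \<le> card I")
      case True
      have "real t * min (real_of_int n) (real (card U) + real (card I) - real t - ?D) \<le> real (trunc_rep n t U I)"
        by (rule less.hyps) (use cC cCI B'0 subs True IU in auto)
      moreover have "trunc_rep n t U I \<le> trunc_rep n t A C"
        unfolding trunc_rep_def by (rule sum_mono) (simp add: split)
      moreover have "real (card U) + real (card I) = real (card A) + real (card B)"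
        using cU cC by linarith
      ultimately show ?thesis using tr by simp
    next
      case False
      define b where "b = card I"
      have bt: "b < t" using False b_def by simp
      have 1: "real (t - b) * min (real_of_int n) (real (card A') + real (card B') - real (t - b) - ?D)
          \<le> real (trunc_rep n (t - b) A' B')"
        by (rule less.hyps) (use cC cCI I0 subs tA tB cA b_def in auto)
      have 2: "trunc_rep n b U I = card U * b"
        using trunc_rep_full[OF n subs(2,1), of b] b_def by simp
      have 3: "trunc_rep n b U I + trunc_rep n (t - b) A' B' \<le> trunc_rep n t A C"
        unfolding trunc_rep_def sum.distrib[symmetric]
        by (rule sum_mono) (use bt in \<open>auto simp: split min_def\<close>)
      define a c :: real where "a = real (card A)" and "c = real (card B)"
      have U: "real (card U) = a + c - real b" using cU cC b_def unfolding a_def c_def by linarith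
      have A'B': "real (card A') + real (card B') = a + c - 2 * real b"
        using cA cCI cC b_def unfolding a_def c_def by linarith
      have tb: "real (t - b) = real t - real b" using bt by simp
      let ?m = "min (real_of_int n) (a + c - real t - ?D)"
      have *: "real b * (a + c - real b) + (real t - real b) * min (real_of_int n) (a + c - 2 * real b - (real t - real b) - ?D)
         \<le> real (trunc_rep n t A C)"
      proof -
        have "real (trunc_rep n b U I) + real (trunc_rep n (t - b) A' B') \<le> real (trunc_rep n t A C)"
          using 3 by linarith
        then show ?thesis using 1 2 unfolding U[symmetric] A'B'[symmetric] tb by (simp add: mult.commute)
      qed
      have "real t * ?m \<le> real b * (a + c - real b) + (real t - real b) * min (real_of_int n) (a + c - 2 * real b - (real t - real b) - ?D)"
      proof (cases "real_of_int n \<le> a + c - 2 * real b - (real t - real b) - ?D")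
        case True
        have "real b * ?m \<le> real b * (a + c - real b)"
          using bt D by (intro mult_left_mono) auto
        moreover have "(real t - real b) * ?m \<le> (real t - real b) * real_of_int n"
          using bt by (intro mult_left_mono) auto
        ultimately show ?thesis using True by (simp add: min_absorb1) (simp add: algebra_simps)
      next
        case False
        have "real t * ?m \<le> real t * (a + c - real t - ?D)"
          by (intro mult_left_mono) auto
        \<comment> \<open>The two sides differ by exactly b * ?D.\<close>
        also have "\<dots> \<le> real b * (a + c - real b) + (real t - real b) * (a + c - 2 * real b - (real t - real b) - ?D)"
        proof -
          have "real b * ?D \<ge> 0" using D by (intro mult_nonneg_nonneg) auto
          then show ?thesis by (simp add: algebra_simps diff_divide_distrib)
        qed
        finally show ?thesis using False by (simp add: min_absorb2)
      qed
      then show ?thesis using * tr unfolding a_def c_def by simp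
    qed
  next
    case False
    show ?thesis
    proof (cases "t = 0")
      case True then show ?thesis by simp
    next
      case t0: False
      have A0: "A \<noteq> {}" using tA t0 by auto
      obtain B0 where B0: "B0 \<subseteq> B" "card B0 = t" using obtain_subset_with_card_n[OF tB] by metis
      have B0n: "B0 \<subseteq> {0..<n}" using B0 B by auto
      \<comment> \<open>Keeping only t elements of \<open>B\<close> makes the truncation harmless
        and yields t * |A|. That suffices: either |A| = n, or the loss \<open>?D\<close> pays for
        all of \<open>B\<close>.\<close>
      have tri: "card A * t \<le> trunc_rep n t A B"
      proof -
        have "trunc_rep n t A B0 = card A * t" using trunc_rep_full[OF n A B0n, of t] B0 by simp
        moreover have "trunc_rep n t A B0 \<le> trunc_rep n t A B"
          unfolding trunc_rep_def
          by (intro sum_mono min.mono order_refl rep_mono[OF finB B0(1)])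
        ultimately show ?thesis by simp
      qed
      have "A = {0..<n} \<or> int (card B) * w \<le> n"
        by (rule shift_invariant_cases[OF n A A0 B rough]) (use False in auto)
      then have "min (real_of_int n) (real (card A) + real (card B) - real t - ?D) \<le> real (card A)"
      proof
        assume "A = {0..<n}" then show ?thesis using n by simp
      next
        assume "int (card B) * w \<le> n"
        then have "real_of_int (int (card B) * w) \<le> real_of_int n" by (rule of_int_le_iff[THEN iffD2])
        then have "real (card B) \<le> ?D" using w by (simp add: field_simps)
        then show ?thesis by simp
      qed
      then have "real t * min (real_of_int n) (real (card A) + real (card B) - real t - ?D) \<le> real t * real (card A)"
        by (intro mult_left_mono) auto
      also have "\<dots> \<le> real (trunc_rep n t A B)" using tri by (metis mult.commute of_nat_le_iff of_nat_mult)
      finally show ?thesis .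
    qed
  qed
qed

text \<open>Apply Pollard with a threshold T of about \<xi> * n. A popular residue contributes at
  most T, and all unpopular ones together at most \<xi>^2 * n^2 / 2, which is at most T * \<xi> * n;
  then divide by T. The three losses of \<xi> * n are the threshold, the term n / w and the
  unpopular residues.\<close>

lemma popular_sums:
  fixes n :: int and \<xi> :: real
  assumes n: "n > 0" and \<xi>: "0 < \<xi>" "\<xi> \<le> 1" "1 \<le> \<xi> * n"
    and rough: "\<And>h. h dvd n \<Longrightarrow> 1 < h \<Longrightarrow> 1 / \<xi> \<le> real_of_int h"
    and A: "A \<subseteq> {0..<n}" "\<xi> * n \<le> card A" and B: "B \<subseteq> {0..<n}" "\<xi> * n \<le> card B"
  shows "min (real_of_int n) (real (card A) + card B) - 3 * \<xi> * n
    \<le> card {x\<in>{0..<n}. \<xi>\<^sup>2 * n / 2 \<le> rep n A B x}"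
proof -
  define w where "w = \<lceil>1 / \<xi>\<rceil>"
  have w: "w > 0" "1 / \<xi> \<le> w" using \<xi> by (auto simp: w_def)
  have r: "w \<le> h" if "h dvd n" "1 < h" for h
    using rough[OF that] unfolding w_def by (simp add: ceiling_le_iff)
  define T where "T = nat \<lfloor>\<xi> * n\<rfloor>"
  have T: "real T \<le> \<xi> * n" "\<xi> * n \<le> 2 * real T" "T \<ge> 1"
  proof -
    have "1 \<le> \<lfloor>\<xi> * n\<rfloor>" using \<xi>(3) by (simp add: le_floor_iff)
    then have "real T = of_int \<lfloor>\<xi> * n\<rfloor>" "T \<ge> 1" unfolding T_def by (simp, linarith)
    then show "real T \<le> \<xi> * n" "\<xi> * n \<le> 2 * real T" "T \<ge> 1" by linarith+
  qed
  define P where "P = {x\<in>{0..<n}. \<xi>\<^sup>2 * n / 2 \<le> rep n A B x}"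
  have "T \<le> card A" "T \<le> card B" using T(1) A(2) B(2) by linarith+
  from pollard[OF n w(1) r A(1) B(1) this]
  have 1: "real T * min (real_of_int n) (real (card A) + real (card B) - real T - real_of_int n / real_of_int w)
      \<le> real (trunc_rep n T A B)" .
  have "real (trunc_rep n T A B) = (\<Sum>x\<in>{0..<n}. real (min T (rep n A B x)))"
    by (simp add: trunc_rep_def)
  also have "\<dots> \<le> (\<Sum>x\<in>{0..<n}. real T * of_bool (x \<in> P) + \<xi>\<^sup>2 * n / 2)"
  proof (rule sum_mono)
    fix x assume x: "x \<in> {0..<n}"
    have nn: "\<xi>\<^sup>2 * n / 2 \<ge> 0" using n by simp
    have m: "real (min T (rep n A B x)) \<le> real T" "real (min T (rep n A B x)) \<le> real (rep n A B x)"
      by simp_all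
    show "real (min T (rep n A B x)) \<le> real T * of_bool (x \<in> P) + \<xi>\<^sup>2 * n / 2"
    proof (cases "x \<in> P")
      case True then show ?thesis using m(1) nn by simp
    next
      case False
      then have "real (rep n A B x) \<le> \<xi>\<^sup>2 * n / 2" using x by (simp add: P_def)
      then have "real (min T (rep n A B x)) \<le> \<xi>\<^sup>2 * n / 2" using m(2) by linarith
      then show ?thesis using False by simp
    qed
  qed
  also have "\<dots> = real T * (\<Sum>x\<in>{0..<n}. of_bool (x \<in> P)) + n * (\<xi>\<^sup>2 * n / 2)"
    using n by (simp add: sum.distrib flip: sum_distrib_left)
  also have "(\<Sum>x\<in>{0..<n}. of_bool (x \<in> P)) = real (card P)"
    by (subst sum_of_bool_eq) (auto simp: P_def intro!: arg_cong[where f = card])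
  finally have 2: "real (trunc_rep n T A B) \<le> real T * card P + n * (\<xi>\<^sup>2 * n / 2)" .
  have "n * (\<xi>\<^sup>2 * n / 2) = (\<xi> * n) * (\<xi> * n) / 2" by (simp add: power2_eq_square)
  also have "\<dots> \<le> (2 * real T) * (\<xi> * n) / 2"
    using T \<xi> n by (intro divide_right_mono mult_right_mono) auto
  finally have 3: "n * (\<xi>\<^sup>2 * n / 2) \<le> real T * (\<xi> * n)" by simp
  have "real T * min (real_of_int n) (real (card A) + real (card B) - real T - real_of_int n / real_of_int w)
     \<le> real T * (card P + \<xi> * n)"
    using 1 2 3 unfolding distrib_left by linarith
  then have 4: "min (real_of_int n) (real (card A) + real (card B) - real T - real_of_int n / real_of_int w) \<le> card P + \<xi> * n"
    using T(3) by (simp only: mult_le_cancel_left_pos of_nat_0_less_iff)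
  have "1 / real_of_int w \<le> 1 / (1 / \<xi>)"
    using w \<xi> by (intro divide_left_mono) auto
  then have "real_of_int n * (1 / real_of_int w) \<le> real_of_int n * \<xi>"
    using n by (intro mult_left_mono) auto
  then have "real_of_int n / real_of_int w \<le> \<xi> * n" by (simp add: mult.commute)
  moreover have "\<xi> * n \<ge> 0" using \<xi> n by simp
  moreover have "min (real_of_int n) (real (card A) + card B) \<le> real_of_int n"
    "min (real_of_int n) (real (card A) + card B) \<le> real (card A) + card B" by simp_all
  moreover have "real_of_int n \<le> card P + \<xi> * n \<or>
      real (card A) + real (card B) - real T - real_of_int n / real_of_int w \<le> card P + \<xi> * n"
    using 4 by (simp only: min_le_iff_disj)
  ultimately show ?thesis using T(1) unfolding P_def[symmetric] by linarith
qed

section \<open>Almost periods of autocorrelations\<close>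

lemma sum_lists_Suc:
  fixes F :: "'a list \<Rightarrow> real"
  assumes "finite \<Omega>"
  shows "(\<Sum>xs | set xs \<subseteq> \<Omega> \<and> length xs = Suc s. F xs)
    = (\<Sum>x\<in>\<Omega>. \<Sum>xs | set xs \<subseteq> \<Omega> \<and> length xs = s. F (x # xs))"
proof -
  have "{xs. set xs \<subseteq> \<Omega> \<and> length xs = Suc s} = (\<lambda>(x, xs). x # xs) ` (\<Omega> \<times> {xs. set xs \<subseteq> \<Omega> \<and> length xs = s})"
    by (auto simp: length_Suc_conv image_iff)
  moreover have "inj_on (\<lambda>(x, xs). x # xs) (\<Omega> \<times> {xs. set xs \<subseteq> \<Omega> \<and> length xs = s})"
    by (auto simp: inj_on_def)
  ultimately show ?thesis
    using assms by (simp add: sum.reindex sum.cartesian_product case_prod_unfold)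
qed

text \<open>Lists of length \<open>s\<close> are independent samples, and the sums are unnormalised
  expectations. When a sample is added, the cross term vanishes because the earlier total has mean
  zero, so variances add.\<close>

lemma sample_variance_sum:
  fixes b :: "'a \<Rightarrow> real"
  assumes fin: "finite \<Omega>" and b0: "(\<Sum>x\<in>\<Omega>. b x) = 0" and b1: "\<And>x. x \<in> \<Omega> \<Longrightarrow> (b x)\<^sup>2 \<le> 1"
  shows "(\<Sum>xs | set xs \<subseteq> \<Omega> \<and> length xs = s. sum_list (map b xs)) = 0 \<and>
    (\<Sum>xs | set xs \<subseteq> \<Omega> \<and> length xs = s. (sum_list (map b xs))\<^sup>2) \<le> real s * card \<Omega> ^ s"
proof (induction s)
  case 0
  have "{xs. set xs \<subseteq> \<Omega> \<and> length xs = 0} = {[]}" by auto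
  then show ?case by simp
next
  case (Suc s)
  let ?T = "{xs. set xs \<subseteq> \<Omega> \<and> length xs = s}"
  have cT: "card ?T = card \<Omega> ^ s" using card_lists_length_eq[OF fin] .
  have "(\<Sum>xs | set xs \<subseteq> \<Omega> \<and> length xs = Suc s. sum_list (map b xs))
      = (\<Sum>x\<in>\<Omega>. \<Sum>xs\<in>?T. b x + sum_list (map b xs))"
    unfolding sum_lists_Suc[OF fin] by simp
  also have "\<dots> = real (card ?T) * (\<Sum>x\<in>\<Omega>. b x) + card \<Omega> * (\<Sum>xs\<in>?T. sum_list (map b xs))"
    by (simp add: sum.distrib sum_distrib_left)
  also have "\<dots> = 0" using b0 Suc by simp
  finally have 1: "(\<Sum>xs | set xs \<subseteq> \<Omega> \<and> length xs = Suc s. sum_list (map b xs)) = 0" .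
  have "(\<Sum>xs | set xs \<subseteq> \<Omega> \<and> length xs = Suc s. (sum_list (map b xs))\<^sup>2)
      = (\<Sum>x\<in>\<Omega>. \<Sum>xs\<in>?T. (b x + sum_list (map b xs))\<^sup>2)"
    unfolding sum_lists_Suc[OF fin] by simp
  also have "\<dots> = (\<Sum>x\<in>\<Omega>. \<Sum>xs\<in>?T. (b x)\<^sup>2 + 2 * b x * sum_list (map b xs) + (sum_list (map b xs))\<^sup>2)"
    by (simp add: power2_sum algebra_simps)
  also have "\<dots> = (\<Sum>x\<in>\<Omega>. card ?T * (b x)\<^sup>2 + 2 * b x * (\<Sum>xs\<in>?T. sum_list (map b xs)) + (\<Sum>xs\<in>?T. (sum_list (map b xs))\<^sup>2))"
    by (simp add: sum.distrib sum_distrib_left)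
  also have "\<dots> = (\<Sum>x\<in>\<Omega>. card ?T * (b x)\<^sup>2) + card \<Omega> * (\<Sum>xs\<in>?T. (sum_list (map b xs))\<^sup>2)"
    using Suc by (simp add: sum.distrib)
  also have "\<dots> \<le> (\<Sum>x\<in>\<Omega>. real (card ?T) * 1) + card \<Omega> * (real s * card \<Omega> ^ s)"
  proof (intro add_mono sum_mono)
    show "real (card ?T) * (b x)\<^sup>2 \<le> real (card ?T) * 1" if "x \<in> \<Omega>" for x
      using b1[OF that] by (intro mult_left_mono) auto
    show "card \<Omega> * (\<Sum>xs\<in>?T. (sum_list (map b xs))\<^sup>2) \<le> card \<Omega> * (real s * card \<Omega> ^ s)"
      using Suc by (intro mult_left_mono) auto
  qed
  also have "\<dots> = real (Suc s) * card \<Omega> ^ Suc s"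
    unfolding cT by (simp add: algebra_simps)
  finally show ?case using 1 by simp
qed

lemma sample_mean:
  fixes a :: "'a \<Rightarrow> real"
  assumes fin: "finite \<Omega>" and ne: "\<Omega> \<noteq> {}" and a: "\<And>x. x \<in> \<Omega> \<Longrightarrow> 0 \<le> a x \<and> a x \<le> 1" and s: "s > 0"
  shows "(\<Sum>xs | set xs \<subseteq> \<Omega> \<and> length xs = s. (sum_list (map a xs) / s - (\<Sum>x\<in>\<Omega>. a x) / card \<Omega>)\<^sup>2)
    \<le> card \<Omega> ^ s / s"
proof -
  define m where "m = (\<Sum>x\<in>\<Omega>. a x) / card \<Omega>"
  have c0: "real (card \<Omega>) > 0" using fin ne by (simp add: card_gt_0_iff)
  have m01: "0 \<le> m" "m \<le> 1"
  proof -
    show "0 \<le> m" unfolding m_def using a c0 by (intro divide_nonneg_pos sum_nonneg) auto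
    have "(\<Sum>x\<in>\<Omega>. a x) \<le> (\<Sum>x\<in>\<Omega>. 1)" using a by (intro sum_mono) auto
    then show "m \<le> 1" unfolding m_def using c0 by simp
  qed
  define b where "b x = a x - m" for x
  have b0: "(\<Sum>x\<in>\<Omega>. b x) = 0" unfolding b_def sum_subtractf using c0 by (simp add: m_def)
  have b1: "(b x)\<^sup>2 \<le> 1" if "x \<in> \<Omega>" for x
    using a[OF that] m01 by (simp add: abs_square_le_1 b_def abs_le_iff)
  have sl: "sum_list (map b xs) = sum_list (map a xs) - length xs * m" for xs
    by (induction xs) (auto simp: b_def algebra_simps)
  have "(\<Sum>xs | set xs \<subseteq> \<Omega> \<and> length xs = s. (sum_list (map a xs) / s - m)\<^sup>2)
      = (\<Sum>xs | set xs \<subseteq> \<Omega> \<and> length xs = s. (sum_list (map b xs))\<^sup>2 / (real s)\<^sup>2)"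
  proof (rule sum.cong[OF refl])
    fix xs assume "xs \<in> {xs. set xs \<subseteq> \<Omega> \<and> length xs = s}"
    then have "sum_list (map a xs) / s - m = sum_list (map b xs) / s"
      using s by (simp add: sl field_simps)
    then show "(sum_list (map a xs) / s - m)\<^sup>2 = (sum_list (map b xs))\<^sup>2 / (real s)\<^sup>2"
      by (simp add: power_divide)
  qed
  also have "\<dots> = (\<Sum>xs | set xs \<subseteq> \<Omega> \<and> length xs = s. (sum_list (map b xs))\<^sup>2) / (real s)\<^sup>2"
    by (simp add: sum_divide_distrib)
  also have "\<dots> \<le> real s * card \<Omega> ^ s / (real s)\<^sup>2"
    using sample_variance_sum[OF fin b0 b1, of s] by (intro divide_right_mono) auto
  also have "\<dots> = card \<Omega> ^ s / s" using s by (simp add: power2_eq_square)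
  finally show ?thesis unfolding m_def .
qed

text \<open>
  One random sample of \<open>s\<close> points approximates at least half of the functions \<open>P i\<close> well, and on a
  fixed sample there are only \<open>2 ^ s\<close> coefficient patterns.
\<close>

lemma two_close_among_many:
  fixes c :: "'i \<Rightarrow> 'a \<Rightarrow> real" and h :: "'m \<Rightarrow> 'a \<Rightarrow> real" and \<Omega> :: "'a set"
  defines "P \<equiv> \<lambda>i m. (\<Sum>x\<in>\<Omega>. c i x * h m x) / card \<Omega>"
  assumes fin: "finite I" "finite \<Omega>" "finite M" and ne: "\<Omega> \<noteq> {}" "M \<noteq> {}"
    and c: "\<And>i x. c i x = 0 \<or> c i x = 1" and h: "\<And>m x. 0 \<le> h m x \<and> h m x \<le> 1"
    and s: "s > 0" and I: "card I > 2 * 2 ^ s"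
  shows "\<exists>i\<in>I. \<exists>j\<in>I. i \<noteq> j \<and> (\<Sum>m\<in>M. (P i m - P j m)\<^sup>2) / card M \<le> 8 / s"
proof -
  define T where "T = {xs. set xs \<subseteq> \<Omega> \<and> length xs = s}"
  have finT: "finite T" unfolding T_def using finite_lists_length_eq[OF fin(2)] .
  have cT: "card T = card \<Omega> ^ s" unfolding T_def using card_lists_length_eq[OF fin(2)] .
  have T0: "real (card T) > 0" using fin ne by (simp add: cT card_gt_0_iff)
  have M0: "real (card M) > 0" using fin ne by (simp add: card_gt_0_iff)
  define S where "S i xs m = sum_list (map (\<lambda>x. c i x * h m x) xs) / s" for i xs m
  define err where "err i xs = (\<Sum>m\<in>M. (S i xs m - P i m)\<^sup>2) / card M" for i xs
  have err0: "err i xs \<ge> 0" for i xs unfolding err_def by (intro divide_nonneg_nonneg sum_nonneg) auto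
  have tot: "(\<Sum>xs\<in>T. err i xs) \<le> card T / s" for i
  proof -
    have "(\<Sum>xs\<in>T. err i xs) = (\<Sum>m\<in>M. \<Sum>xs\<in>T. (S i xs m - P i m)\<^sup>2) / card M"
      unfolding err_def sum_divide_distrib[symmetric] by (subst sum.swap) simp
    also have "\<dots> \<le> (\<Sum>m\<in>M. card T / s) / card M"
    proof (intro divide_right_mono sum_mono)
      fix m assume "m \<in> M"
      have "0 \<le> c i x * h m x \<and> c i x * h m x \<le> 1" for x using c[of i x] h[of m x] by auto
      then show "(\<Sum>xs\<in>T. (S i xs m - P i m)\<^sup>2) \<le> card T / s"
        using sample_mean[OF fin(2) ne(1) _ s, of "\<lambda>x. c i x * h m x"]
        unfolding S_def P_def cT unfolding T_def by simp
    qed simp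
    also have "\<dots> = card T / s" using M0 by simp
    finally show ?thesis .
  qed
  have "(\<Sum>xs\<in>T. \<Sum>i\<in>I. err i xs) \<le> (\<Sum>xs\<in>T. card I / s)"
  proof -
    have "(\<Sum>xs\<in>T. \<Sum>i\<in>I. err i xs) = (\<Sum>i\<in>I. \<Sum>xs\<in>T. err i xs)" by (rule sum.swap)
    also have "\<dots> \<le> (\<Sum>i\<in>I. card T / s)" by (intro sum_mono tot)
    finally show ?thesis by (simp add: mult.commute)
  qed
  moreover have "T \<noteq> {}" using T0 by auto
  ultimately obtain xs where xs: "xs \<in> T" "(\<Sum>i\<in>I. err i xs) \<le> card I / s"
    using sum_strict_mono[OF finT, of "\<lambda>_. card I / s" "\<lambda>xs. \<Sum>i\<in>I. err i xs"] by (meson not_le)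
  \<comment> \<open>Markov: the mean error over \<open>I\<close> is at most 1 / s, so at most half
    of the indices exceed 2 / s. Two good indices with the same pattern then differ by at most 2 *
    (2 / s) + 2 * (2 / s).\<close>
  define Gd where "Gd = {i\<in>I. err i xs \<le> 2 / s}"
  have "real (card (I - Gd)) * (2 / s) \<le> (\<Sum>i\<in>I - Gd. err i xs)"
  proof -
    have "(\<Sum>i\<in>I - Gd. 2 / real s) \<le> (\<Sum>i\<in>I - Gd. err i xs)"
      by (rule sum_mono) (auto simp: Gd_def)
    then show ?thesis by simp
  qed
  also have "\<dots> \<le> (\<Sum>i\<in>I. err i xs)" by (rule sum_mono2) (use fin err0 in auto)
  finally have "real (card (I - Gd)) * 2 \<le> card I"
    using xs(2) s by (simp add: field_simps)
  moreover have "card I = card Gd + card (I - Gd)"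
    using fin by (subst card_Un_disjoint[symmetric]) (auto simp: Gd_def intro: arg_cong[where f = card])
  ultimately have cG: "card Gd > 2 ^ s" using I by linarith
  have "\<not> inj_on (\<lambda>i. map (c i) xs) Gd"
  proof
    assume inj: "inj_on (\<lambda>i. map (c i) xs) Gd"
    have "(\<lambda>i. map (c i) xs) ` Gd \<subseteq> {ys. set ys \<subseteq> {0, 1} \<and> length ys = s}"
      using xs(1) by (auto simp: T_def) (metis c)
    moreover have "finite {ys. set ys \<subseteq> {0::real, 1} \<and> length ys = s}"
      by (rule finite_lists_length_eq) simp
    ultimately have "card Gd \<le> card {ys. set ys \<subseteq> {0::real, 1} \<and> length ys = s}"
      by (rule card_inj_on_le[OF inj])
    also have "\<dots> = 2 ^ s" by (subst card_lists_length_eq) (auto simp: numeral_2_eq_2)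
    finally show False using cG by simp
  qed
  then obtain i j where ij: "i \<in> Gd" "j \<in> Gd" "i \<noteq> j" "map (c i) xs = map (c j) xs"
    by (auto simp: inj_on_def)
  have "S i xs m = S j xs m" for m
  proof -
    have "map (\<lambda>x. c i x * h m x) xs = map (\<lambda>x. c j x * h m x) xs" using ij(4) by auto
    then show ?thesis unfolding S_def by presburger
  qed
  then have "(P i m - P j m)\<^sup>2 \<le> 2 * (S i xs m - P i m)\<^sup>2 + 2 * (S j xs m - P j m)\<^sup>2" for m
    using zero_le_power2[of "(S i xs m - P i m) + (S j xs m - P j m)"]
    by (simp add: power2_eq_square algebra_simps)
  then have "(\<Sum>m\<in>M. (P i m - P j m)\<^sup>2) / card M \<le> (\<Sum>m\<in>M. 2 * (S i xs m - P i m)\<^sup>2 + 2 * (S j xs m - P j m)\<^sup>2) / card M"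
    by (intro divide_right_mono sum_mono) auto
  also have "\<dots> = 2 * err i xs + 2 * err j xs"
    by (simp add: err_def sum.distrib sum_distrib_left[symmetric] add_divide_distrib)
  also have "\<dots> \<le> 8 / s" using ij(1,2) by (simp add: Gd_def)
  finally show ?thesis using ij Gd_def by blast
qed

section \<open>Averages over residues and over differences in a box\<close>

definition av :: "int \<Rightarrow> (int \<Rightarrow> real) \<Rightarrow> real" where
  "av N F = (\<Sum>x\<in>{0..<N}. F x) / N"

text \<open>An average with triangular (Fejer) weight on the integers between -L and L. Exactly this
  weight arises when the square of a box average is expanded.\<close>

definition mv :: "nat \<Rightarrow> (int \<Rightarrow> real) \<Rightarrow> real" where
  "mv L \<phi> = (\<Sum>a<L. \<Sum>b<L. \<phi> (int a - int b)) / (real L)\<^sup>2"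

lemma av_mono: "N > 0 \<Longrightarrow> (\<And>x. F x \<le> F' x) \<Longrightarrow> av N F \<le> av N F'"
  unfolding av_def by (intro divide_right_mono sum_mono) auto

lemma av_add: "av N (\<lambda>x. F x + F' x) = av N F + av N F'"
  by (simp add: av_def sum.distrib add_divide_distrib)

lemma av_diff: "av N (\<lambda>x. F x - F' x) = av N F - av N F'"
  by (simp add: av_def sum_subtractf diff_divide_distrib)

lemma av_cmult: "av N (\<lambda>x. c * F x) = c * av N F"
  by (simp add: av_def sum_distrib_left)

lemma av_multc: "av N (\<lambda>x. F x * c) = av N F * c"
  by (simp add: av_def sum_distrib_right)

lemma av_divide: "av N (\<lambda>x. F x / c) = av N F / c"
  by (simp add: av_def sum_divide_distrib[symmetric])

lemma av_sum: "av N (\<lambda>x. \<Sum>i\<in>I. F i x) = (\<Sum>i\<in>I. av N (F i))"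
  unfolding av_def by (subst sum.swap) (simp add: sum_divide_distrib)

lemma av_const: "N > 0 \<Longrightarrow> av N (\<lambda>_. c) = c"
  by (simp add: av_def)

lemma periodic_mod:
  assumes "N > 0" "\<And>x::int. F (x + N) = F x" shows "F (x mod N) = F x"
proof -
  have nat: "F (y + int k * N) = F y" for y k
  proof (induction k)
    case (Suc k)
    have "y + int (Suc k) * N = (y + int k * N) + N" by (simp add: algebra_simps)
    then show ?case using Suc assms(2) by metis
  qed simp
  have "F (x mod N) = F x"
  proof (cases "x div N \<ge> 0")
    case True
    have "x = x mod N + int (nat (x div N)) * N" using True by simp
    then show ?thesis using nat by metis
  next
    case False
    have "x mod N = x + int (nat (- (x div N))) * N" using False by (simp add: minus_div_mult_eq_mod)
    then show ?thesis using nat by metis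
  qed
  then show ?thesis .
qed

lemma av_shift:
  assumes "N > 0" "\<And>x. F (x + N) = F x" shows "av N (\<lambda>x. F (x + a)) = av N F"
  using sum_shift_mod[OF assms(1), of F a] periodic_mod[of N F, OF assms] by (simp add: av_def)

lemma sum_shift_le:
  fixes h :: "int \<Rightarrow> real"
  assumes "\<And>i. 0 \<le> h i \<and> h i \<le> 1"
  shows "\<bar>(\<Sum>a<L. h (int a + int j)) - (\<Sum>a<L. h (int a))\<bar> \<le> real j"
proof (induction j)
  case (Suc j)
  have "(\<Sum>a<L. h (int a + int (Suc j))) = (\<Sum>a<Suc L. h (int a + int j)) - h (int j)"
    by (subst sum.lessThan_Suc_shift) (simp add: algebra_simps)
  then have "(\<Sum>a<L. h (int a + int (Suc j))) - (\<Sum>a<L. h (int a + int j)) = h (int L + int j) - h (int j)" by simp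
  moreover have "\<bar>h (int L + int j) - h (int j)\<bar> \<le> 1" using assms[of "int L + int j"] assms[of "int j"] by linarith
  ultimately show ?case using Suc by linarith
qed simp

lemma mv_add: "mv L (\<lambda>m. F m + F' m) = mv L F + mv L F'"
  by (simp add: mv_def sum.distrib add_divide_distrib)

lemma mv_diff: "mv L (\<lambda>m. F m - F' m) = mv L F - mv L F'"
  by (simp add: mv_def sum_subtractf diff_divide_distrib)

lemma mv_cmult: "mv L (\<lambda>m. c * F m) = c * mv L F"
  by (simp add: mv_def sum_distrib_left)

lemma mv_shift:
  assumes "\<And>i. 0 \<le> \<phi> i \<and> \<phi> i \<le> 1" "L > 0"
  shows "\<bar>mv L (\<lambda>m. \<phi> (m + int j)) - mv L \<phi>\<bar> \<le> real j / L"
proof -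
  have "\<bar>(\<Sum>b<L. \<Sum>a<L. \<phi> (int a - int b + int j)) - (\<Sum>b<L. \<Sum>a<L. \<phi> (int a - int b))\<bar>
    \<le> (\<Sum>b<L. \<bar>(\<Sum>a<L. \<phi> (int a - int b + int j)) - (\<Sum>a<L. \<phi> (int a - int b))\<bar>)"
    unfolding sum_subtractf[symmetric] by (rule sum_abs)
  also have "\<dots> \<le> (\<Sum>b<L. real j)"
  proof (rule sum_mono)
    fix b show "\<bar>(\<Sum>a<L. \<phi> (int a - int b + int j)) - (\<Sum>a<L. \<phi> (int a - int b))\<bar> \<le> real j"
    proof -
      have eq: "int a - int b + int j = int a + int j - int b" for a by simp
      show ?thesis unfolding eq using sum_shift_le[of "\<lambda>i. \<phi> (i - int b)" j L] assms(1) by simp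
    qed
  qed
  finally have *: "\<bar>(\<Sum>b<L. \<Sum>a<L. \<phi> (int a - int b + int j)) - (\<Sum>b<L. \<Sum>a<L. \<phi> (int a - int b))\<bar> \<le> L * real j" by simp
  have "mv L \<psi> = (\<Sum>b<L. \<Sum>a<L. \<psi> (int a - int b)) / (real L)\<^sup>2" for \<psi>
    unfolding mv_def by (subst sum.swap) simp
  then have "\<bar>mv L (\<lambda>m. \<phi> (m + int j)) - mv L \<phi>\<bar> =
     \<bar>(\<Sum>b<L. \<Sum>a<L. \<phi> (int a - int b + int j)) - (\<Sum>b<L. \<Sum>a<L. \<phi> (int a - int b))\<bar> / (real L)\<^sup>2"
    by (simp add: diff_divide_distrib[symmetric] abs_divide)
  also have "\<dots> \<le> L * real j / (real L)\<^sup>2" using * by (intro divide_right_mono) auto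
  also have "\<dots> = real j / L" using assms(2) by (simp add: power2_eq_square)
  finally show ?thesis .
qed

section \<open>Energies of box averages and their transfer between boxes\<close>

text \<open>The longest box is closed up to a cycle of length \<open>N\<close>, so that translations
  leave averages unchanged. The price is wrap-around, which \<open>disjoint_differences\<close>
  removes by discarding positions near the ends.\<close>

locale cyclic_indicator =
  fixes N :: int and f :: "int \<Rightarrow> real"
  assumes N: "N > 0" and per: "\<And>x. f (x + N) = f x" and f01: "\<And>x. f x = 0 \<or> f x = 1"
begin

lemma f_bounds: "0 \<le> f x" "f x \<le> 1" using f01[of x] by auto

definition p :: "int \<Rightarrow> real" where "p n = av N (\<lambda>x. f x * f (x + n))"

lemma p_shift: "av N (\<lambda>x. f (x + a) * f (x + b)) = p (b - a)"
proof -
  have "av N (\<lambda>x. f (x + a) * f ((x + a) + (b - a))) = av N (\<lambda>x. f x * f (x + (b - a)))"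
    by (rule av_shift[OF N]) (metis per add.assoc add.commute)
  then show ?thesis by (simp add: p_def)
qed

lemma p_bounds: "0 \<le> p n" "p n \<le> 1"
proof -
  have "0 \<le> f x * f y" "f x * f y \<le> 1" for x y using f01[of x] f01[of y] by auto
  then show "0 \<le> p n" "p n \<le> 1" unfolding p_def
    using av_mono[OF N, of "\<lambda>_. 0" "\<lambda>x. f x * f (x + n)"] av_mono[OF N, of "\<lambda>x. f x * f (x + n)" "\<lambda>_. 1"]
    by (auto simp: av_const[OF N])
qed

definition av2 :: "(int \<Rightarrow> int \<Rightarrow> real) \<Rightarrow> real" where
  "av2 F = av N (\<lambda>x. av N (\<lambda>y. F x y))"

definition bip :: "(int \<Rightarrow> int \<Rightarrow> real) \<Rightarrow> bool" where
  "bip F \<longleftrightarrow> (\<forall>x y. F (x + N) y = F x y \<and> F x (y + N) = F x y)"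

lemma av2_shift: assumes "bip F" shows "av2 (\<lambda>x y. F (x + a) (y + b)) = av2 F"
proof -
  have "av N (\<lambda>y. F (x + a) (y + b)) = av N (\<lambda>y. F (x + a) y)" for x
    by (rule av_shift[OF N]) (use assms bip_def in auto)
  then have "av2 (\<lambda>x y. F (x + a) (y + b)) = av N (\<lambda>x. av N (\<lambda>y. F (x + a) y))"
    unfolding av2_def by simp
  also have "\<dots> = av2 F" unfolding av2_def
    by (rule av_shift[OF N, of "\<lambda>x. av N (\<lambda>y. F x y)"]) (use assms in \<open>simp add: bip_def\<close>)
  finally show ?thesis .
qed

lemma av2_mono: "(\<And>x y. F x y \<le> F' x y) \<Longrightarrow> av2 F \<le> av2 F'"
  unfolding av2_def by (intro av_mono[OF N])
lemma av2_add: "av2 (\<lambda>x y. F x y + F' x y) = av2 F + av2 F'"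
  unfolding av2_def by (simp add: av_add)
lemma av2_diff: "av2 (\<lambda>x y. F x y - F' x y) = av2 F - av2 F'"
  unfolding av2_def by (simp add: av_diff)
lemma av2_cmult: "av2 (\<lambda>x y. c * F x y) = c * av2 F"
  unfolding av2_def by (simp add: av_cmult)
lemma av2_divide: "av2 (\<lambda>x y. F x y / c) = av2 F / c"
  unfolding av2_def by (simp add: av_divide)
lemma av2_sum: "av2 (\<lambda>x y. \<Sum>i\<in>I. F i x y) = (\<Sum>i\<in>I. av2 (F i))"
  unfolding av2_def by (simp add: av_sum)
lemma av2_const: "av2 (\<lambda>x y. c) = c"
  unfolding av2_def by (simp add: av_const[OF N])
lemma av2_prod: "av2 (\<lambda>x y. F x * F' y) = av N F * av N F'"
  unfolding av2_def by (simp add: av_cmult av_multc)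

lemma av2_approx:
  assumes "\<And>x y. \<bar>F x y - F' x y\<bar> \<le> e" shows "\<bar>av2 F - av2 F'\<bar> \<le> e"
proof -
  have "av2 (\<lambda>x y. F x y - F' x y) \<le> av2 (\<lambda>x y. e)" "av2 (\<lambda>x y. - e) \<le> av2 (\<lambda>x y. F x y - F' x y)"
    by (rule av2_mono, use assms in \<open>simp add: abs_le_iff\<close>)
      (rule av2_mono, use assms in \<open>metis abs_le_D2 minus_le_iff\<close>)
  then show ?thesis by (simp add: av2_diff av2_const)
qed

definition Av :: "int \<Rightarrow> nat \<Rightarrow> (int \<Rightarrow> int \<Rightarrow> real) \<Rightarrow> int \<Rightarrow> int \<Rightarrow> real" where
  "Av g L F x y = (\<Sum>a<L. F (x + g * int a) (y + g * int a)) / L"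

definition G :: "int \<Rightarrow> nat \<Rightarrow> int \<Rightarrow> int \<Rightarrow> real" where
  "G g L = Av g L (\<lambda>x y. f x * f y)"

text \<open>Only the second variable moves, so that the cross term is the correlation of
  \<open>p\<close> with its own translate (\<open>D_eq\<close>). As the squared norm of a function
  of (x, y) it passes to shorter boxes (\<open>energy_transfer\<close>); \<open>p_shift_le_D\<close>
  and \<open>D_le_p_diff\<close> relate it to \<open>p\<close>.\<close>

definition D :: "int \<Rightarrow> nat \<Rightarrow> int \<Rightarrow> real" where
  "D g L t = av2 (\<lambda>x y. (G g L x (y + t) - G g L x y)\<^sup>2)"

definition E :: "int \<Rightarrow> nat \<Rightarrow> real" where
  "E g L = av2 (\<lambda>x y. (G g L x y)\<^sup>2)"

lemma bip_shift: assumes "bip F" shows "bip (\<lambda>x y. F (x + a) (y + b))"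
  unfolding bip_def
proof (intro allI conjI)
  fix x y
  have "x + N + a = (x + a) + N" "y + N + b = (y + b) + N" by simp_all
  then show "F (x + N + a) (y + b) = F (x + a) (y + b)" "F (x + a) (y + N + b) = F (x + a) (y + b)"
    using assms unfolding bip_def by metis+
qed

lemma bip_comp2: "bip F \<Longrightarrow> bip F' \<Longrightarrow> bip (\<lambda>x y. h (F x y) (F' x y))"
  by (simp add: bip_def)

lemma bip_Av: assumes "bip F" shows "bip (Av g L F)"
  using bip_shift[OF assms] unfolding bip_def Av_def by simp

lemma bip_ff: "bip (\<lambda>x y. f x * f y)" by (simp add: bip_def per)

lemma bip_G: "bip (G g L)" unfolding G_def by (rule bip_Av[OF bip_ff])

lemma Av_bounds:
  assumes "L > 0" "\<And>x y. 0 \<le> F x y \<and> F x y \<le> 1"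
  shows "0 \<le> Av g L F x y" "Av g L F x y \<le> 1"
proof -
  show "0 \<le> Av g L F x y" unfolding Av_def using assms by (intro divide_nonneg_nonneg sum_nonneg) auto
  have "(\<Sum>a<L. F (x + g * int a) (y + g * int a)) \<le> (\<Sum>a<L. 1)" using assms by (intro sum_mono) auto
  then show "Av g L F x y \<le> 1" unfolding Av_def using assms(1) by simp
qed

lemma ff_bounds: "0 \<le> f x * f y \<and> f x * f y \<le> 1"
  using f01[of x] f01[of y] by auto

lemma G_bounds: "L > 0 \<Longrightarrow> 0 \<le> G g L x y" "L > 0 \<Longrightarrow> G g L x y \<le> 1"
  unfolding G_def using Av_bounds[of L "\<lambda>x y. f x * f y"] ff_bounds by blast+

text \<open>
  The function \<open>G g L\<close> averages \<open>f x * f y\<close> along the diagonal box of step \<open>g\<close> and length \<open>L\<close>.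
  Exchanging the two averages turns correlations of \<open>G\<close> into second moments of \<open>p\<close> over differences
  of box elements.
\<close>

lemma G_corr:
  "av2 (\<lambda>x y. G g L (x + s) (y + t) * G g L x y) = mv L (\<lambda>m. p (g * m + s) * p (g * m + t))"
proof -
  have "av2 (\<lambda>x y. G g L (x + s) (y + t) * G g L x y) =
    av2 (\<lambda>x y. (\<Sum>a<L. \<Sum>b<L. (f (x + g * int b) * f (x + (s + g * int a))) * (f (y + g * int b) * f (y + (t + g * int a)))) / (real L)\<^sup>2)"
  proof -
    have "G g L (x + s) (y + t) * G g L x y
      = (\<Sum>a<L. \<Sum>b<L. (f (x + g * int b) * f (x + (s + g * int a))) * (f (y + g * int b) * f (y + (t + g * int a)))) / (real L)\<^sup>2" for x y
    proof -
      have "(\<Sum>a<L. f (x + s + g * int a) * f (y + t + g * int a)) * (\<Sum>b<L. f (x + g * int b) * f (y + g * int b))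
         = (\<Sum>a<L. \<Sum>b<L. (f (x + g * int b) * f (x + (s + g * int a))) * (f (y + g * int b) * f (y + (t + g * int a))))"
        unfolding sum_product by (intro sum.cong refl) (simp add: algebra_simps)
      then show ?thesis unfolding G_def Av_def by (simp add: power2_eq_square)
    qed
    then show ?thesis by simp
  qed
  also have "\<dots> = (\<Sum>a<L. \<Sum>b<L. p (s + g * int a - g * int b) * p (t + g * int a - g * int b)) / (real L)\<^sup>2"
    by (simp add: av2_divide av2_sum av2_prod p_shift)
  also have "\<dots> = mv L (\<lambda>m. p (g * m + s) * p (g * m + t))"
    unfolding mv_def by (simp add: algebra_simps)
  finally show ?thesis .
qed

lemma E_eq: "E g L = mv L (\<lambda>m. (p (g * m))\<^sup>2)"
  using G_corr[of g L 0 0] by (simp add: E_def power2_eq_square)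

lemma D_eq: "D g L t = 2 * E g L - 2 * mv L (\<lambda>m. p (g * m) * p (g * m + t))"
proof -
  have "D g L t = av2 (\<lambda>x y. (G g L x (y + t))\<^sup>2 + (G g L x y)\<^sup>2 - 2 * (G g L x (y + t) * G g L x y))"
    unfolding D_def by (simp add: power2_diff algebra_simps)
  also have "\<dots> = av2 (\<lambda>x y. (G g L x (y + t))\<^sup>2) + E g L - 2 * av2 (\<lambda>x y. G g L x (y + t) * G g L x y)"
    by (simp add: av2_diff av2_add av2_cmult E_def)
  also have "av2 (\<lambda>x y. (G g L x (y + t))\<^sup>2) = E g L"
    unfolding E_def using av2_shift[of "\<lambda>x y. (G g L x y)\<^sup>2" 0 t] bip_G by (simp add: bip_def)
  also have "av2 (\<lambda>x y. G g L x (y + t) * G g L x y) = mv L (\<lambda>m. p (g * m) * p (g * m + t))"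
    using G_corr[of g L 0 t] by simp
  finally show ?thesis by simp
qed

text \<open>Expanding both sides leaves the claim that the second moment of p (g * m + t) is at most
  \<open>E g L\<close>. By \<open>G_corr\<close> this moment is the correlation of \<open>G\<close>
  with a diagonal translate of itself, which cannot exceed the squared norm.\<close>

lemma p_shift_le_D: "mv L (\<lambda>m. (p (g * m + t) - p (g * m))\<^sup>2) \<le> D g L t"
proof -
  have "mv L (\<lambda>m. (p (g * m + t))\<^sup>2) = av2 (\<lambda>x y. G g L (x + t) (y + t) * G g L x y)"
    by (simp add: G_corr power2_eq_square)
  also have "\<dots> \<le> av2 (\<lambda>x y. (1/2) * ((G g L (x + t) (y + t))\<^sup>2 + (G g L x y)\<^sup>2))"
  proof (rule av2_mono)
    fix x y
    show "G g L (x + t) (y + t) * G g L x y \<le> (1/2) * ((G g L (x + t) (y + t))\<^sup>2 + (G g L x y)\<^sup>2)"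
      using sum_squares_bound[of "G g L (x + t) (y + t)" "G g L x y"] by simp
  qed
  also have "\<dots> = (1/2) * (av2 (\<lambda>x y. (G g L (x + t) (y + t))\<^sup>2) + E g L)"
    by (simp only: av2_cmult av2_add E_def)
  also have "av2 (\<lambda>x y. (G g L (x + t) (y + t))\<^sup>2) = E g L"
    unfolding E_def using av2_shift[of "\<lambda>x y. (G g L x y)\<^sup>2" t t] bip_G by (simp add: bip_def)
  finally have 1: "mv L (\<lambda>m. (p (g * m + t))\<^sup>2) \<le> E g L" by simp
  have "mv L (\<lambda>m. (p (g * m + t) - p (g * m))\<^sup>2)
    = mv L (\<lambda>m. (p (g * m + t))\<^sup>2 + (p (g * m))\<^sup>2 - 2 * (p (g * m) * p (g * m + t)))"
    by (simp add: power2_diff algebra_simps)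
  also have "\<dots> = mv L (\<lambda>m. (p (g * m + t))\<^sup>2) + E g L - 2 * mv L (\<lambda>m. p (g * m) * p (g * m + t))"
    by (simp add: mv_add mv_diff mv_cmult E_eq)
  finally show ?thesis using 1 D_eq by simp
qed

text \<open>A converse for shifts that are differences of multiples of \<open>g\<close>: moving the
  window of m by i or j steps changes an average by at most i / L or j / L. The two squares cost i +
  j, the doubled cross term 2 * j.\<close>

lemma D_le_p_diff:
  assumes "L > 0"
  shows "D g L (g * int i - g * int j)
    \<le> mv L (\<lambda>m. (p (g * m + g * int i) - p (g * m + g * int j))\<^sup>2) + (real i + 3 * real j) / L"
proof -
  have b2: "0 \<le> (p n)\<^sup>2 \<and> (p n)\<^sup>2 \<le> 1" for n using p_bounds[of n] by (simp add: power_le_one)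
  have bp: "0 \<le> p n * p n' \<and> p n * p n' \<le> 1" for n n' using p_bounds[of n] p_bounds[of n'] by (simp add: mult_le_one)
  have 1: "\<bar>mv L (\<lambda>m. (p (g * m + g * int i))\<^sup>2) - E g L\<bar> \<le> real i / L" for i
    using mv_shift[of "\<lambda>m. (p (g * m))\<^sup>2" L i] b2 assms unfolding E_eq by (simp add: algebra_simps)
  have 2: "\<bar>mv L (\<lambda>m. p (g * m + g * int j) * p (g * m + g * int i))
      - mv L (\<lambda>m. p (g * m) * p (g * m + (g * int i - g * int j)))\<bar> \<le> real j / L"
    using mv_shift[of "\<lambda>m. p (g * m) * p (g * m + (g * int i - g * int j))" L j] bp assms
    by (simp add: algebra_simps)
  have "mv L (\<lambda>m. (p (g * m + g * int i) - p (g * m + g * int j))\<^sup>2)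
    = mv L (\<lambda>m. (p (g * m + g * int i))\<^sup>2 + (p (g * m + g * int j))\<^sup>2 - 2 * (p (g * m + g * int j) * p (g * m + g * int i)))"
    by (simp add: power2_diff algebra_simps)
  also have "\<dots> = mv L (\<lambda>m. (p (g * m + g * int i))\<^sup>2) + mv L (\<lambda>m. (p (g * m + g * int j))\<^sup>2)
      - 2 * mv L (\<lambda>m. p (g * m + g * int j) * p (g * m + g * int i))"
    by (simp add: mv_add mv_diff mv_cmult)
  finally show ?thesis
    using 1[of i] 1[of j] 2 unfolding D_eq add_divide_distrib by (simp add: abs_le_iff)
qed

text \<open>p (g * m + v i) is the mean over x of f (x - v i) * f (x + g * m). On a sample of points
  x the factor depending on i is a 0-1 pattern, the same for all m.\<close>

lemma p_close_pair:
  assumes "finite I" "L > 0" "s > 0" "card I > 2 * 2 ^ s"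
  shows "\<exists>i\<in>I. \<exists>j\<in>I. i \<noteq> j \<and> mv L (\<lambda>m. (p (g * m + v i) - p (g * m + v j))\<^sup>2) \<le> 8 / s"
proof -
  let ?M = "{..<L} \<times> {..<L}"
  have P: "(\<Sum>x\<in>{0..<N}. f (x + - v i) * f (x + g * (int (fst m) - int (snd m)))) / card {0..<N}
      = p (g * (int (fst m) - int (snd m)) + v i)" for i m
    using p_shift[of "- v i" "g * (int (fst m) - int (snd m))"] N by (simp add: av_def)
  have "\<exists>i\<in>I. \<exists>j\<in>I. i \<noteq> j \<and>
    (\<Sum>m\<in>?M. (p (g * (int (fst m) - int (snd m)) + v i) - p (g * (int (fst m) - int (snd m)) + v j))\<^sup>2) / card ?M \<le> 8 / s"
    using two_close_among_many[of I "{0..<N}" ?M "\<lambda>i x. f (x + - v i)" "\<lambda>m x. f (x + g * (int (fst m) - int (snd m)))" s]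
      assms N f01 f_bounds unfolding P by auto
  moreover have "(\<Sum>m\<in>?M. (p (g * (int (fst m) - int (snd m)) + v i) - p (g * (int (fst m) - int (snd m)) + v j))\<^sup>2) / card ?M
     = mv L (\<lambda>m. (p (g * m + v i) - p (g * m + v j))\<^sup>2)" for i j
    by (simp add: mv_def sum.cartesian_product case_prod_unfold power2_eq_square)
  ultimately show ?thesis by simp
qed

text \<open>After exchanging the two averages, \<open>G g L\<close> is averaged over its translates
  by g * q * b, and a translation by q * b steps along the box changes it by at most q * b / L. So
  the average over a long box nearly factors through the average over a short box whose step is a
  multiple.\<close>

lemma Av_G_approx:
  assumes "L > 0" "L' > 0"
  shows "\<bar>Av g L (G (g * int q) L') x y - G g L x y\<bar> \<le> real (q * L') / L"
proof -
  let ?g' = "g * int q"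
  have sw: "Av g L (G ?g' L') x y = (\<Sum>b<L'. G g L (x + ?g' * int b) (y + ?g' * int b)) / L'"
    unfolding G_def Av_def sum_divide_distrib
    by (subst sum.swap) (simp add: algebra_simps)
  have step: "\<bar>G g L (x + g * int j) (y + g * int j) - G g L x y\<bar> \<le> real j / L" for j
  proof -
    have "\<bar>(\<Sum>a<L. f (x + g * (int a + int j)) * f (y + g * (int a + int j))) - (\<Sum>a<L. f (x + g * int a) * f (y + g * int a))\<bar> \<le> real j"
      using sum_shift_le[of "\<lambda>i. f (x + g * i) * f (y + g * i)" j L] ff_bounds by simp
    then have "\<bar>(\<Sum>a<L. f (x + g * int j + g * int a) * f (y + g * int j + g * int a)) - (\<Sum>a<L. f (x + g * int a) * f (y + g * int a))\<bar> \<le> real j"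
      by (simp add: algebra_simps)
    then show ?thesis unfolding G_def Av_def diff_divide_distrib[symmetric] abs_divide
      by (simp add: divide_right_mono)
  qed
  have "\<bar>(\<Sum>b<L'. G g L (x + ?g' * int b) (y + ?g' * int b)) - L' * G g L x y\<bar>
      = \<bar>\<Sum>b<L'. (G g L (x + ?g' * int b) (y + ?g' * int b) - G g L x y)\<bar>"
    by (simp add: sum_subtractf)
  also have "\<dots> \<le> (\<Sum>b<L'. \<bar>G g L (x + ?g' * int b) (y + ?g' * int b) - G g L x y\<bar>)"
    by (rule sum_abs)
  also have "\<dots> \<le> (\<Sum>b<L'. real (q * L') / L)"
  proof (rule sum_mono)
    fix b assume b: "b \<in> {..<L'}"
    have "\<bar>G g L (x + ?g' * int b) (y + ?g' * int b) - G g L x y\<bar> \<le> real (q * b) / L"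
      using step[of "q * b"] by (simp add: mult.assoc)
    also have "\<dots> \<le> real (q * L') / L" using b assms by (intro divide_right_mono) (auto intro: mult_left_mono)
    finally show "\<bar>G g L (x + ?g' * int b) (y + ?g' * int b) - G g L x y\<bar> \<le> real (q * L') / L" .
  qed
  finally have "\<bar>(\<Sum>b<L'. G g L (x + ?g' * int b) (y + ?g' * int b)) - L' * G g L x y\<bar> / L' \<le> real (q * L') / L"
    using assms(2) by (simp add: field_simps)
  moreover have "\<bar>(\<Sum>b<L'. G g L (x + ?g' * int b) (y + ?g' * int b)) - L' * G g L x y\<bar> / L'
      = \<bar>Av g L (G ?g' L') x y - G g L x y\<bar>"
  proof -
    have "Av g L (G ?g' L') x y - G g L x y
      = ((\<Sum>b<L'. G g L (x + ?g' * int b) (y + ?g' * int b)) - L' * G g L x y) / L'"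
      unfolding sw using assms(2) by (simp add: diff_divide_distrib)
    then show ?thesis by (simp add: abs_divide)
  qed
  ultimately show ?thesis by simp
qed

text \<open>The variance along the box as half the mean square of pairwise differences. In this form
  \<open>av2_Av_shift_diff\<close> can compare two functions term by term.\<close>

lemma av2_Av_variance:
  assumes "L > 0" "bip U"
  shows "av2 (\<lambda>x y. (U x y)\<^sup>2) - av2 (\<lambda>x y. (Av g L U x y)\<^sup>2)
    = (\<Sum>a<L. \<Sum>b<L. av2 (\<lambda>x y. (U (x + g * int a) (y + g * int a) - U (x + g * int b) (y + g * int b))\<^sup>2)) / (2 * (real L)\<^sup>2)"
proof -
  define S where "S a x y = U (x + g * int a) (y + g * int a)" for a x y
  have bS: "av2 (\<lambda>x y. (S a x y)\<^sup>2) = av2 (\<lambda>x y. (U x y)\<^sup>2)" for a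
    unfolding S_def using av2_shift[of "\<lambda>x y. (U x y)\<^sup>2" "g * int a" "g * int a"] assms(2) by (simp add: bip_def)
  have "av2 (\<lambda>x y. (S a x y - S b x y)\<^sup>2) = 2 * av2 (\<lambda>x y. (U x y)\<^sup>2) - 2 * av2 (\<lambda>x y. S a x y * S b x y)" for a b
  proof -
    have "av2 (\<lambda>x y. (S a x y - S b x y)\<^sup>2) = av2 (\<lambda>x y. (S a x y)\<^sup>2 + (S b x y)\<^sup>2 - 2 * (S a x y * S b x y))"
      by (simp add: power2_diff algebra_simps)
    also have "\<dots> = 2 * av2 (\<lambda>x y. (U x y)\<^sup>2) - 2 * av2 (\<lambda>x y. S a x y * S b x y)"
      by (simp only: av2_diff av2_add av2_cmult bS)
    finally show ?thesis .
  qed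
  then have "(\<Sum>a<L. \<Sum>b<L. av2 (\<lambda>x y. (S a x y - S b x y)\<^sup>2))
     = 2 * (real L)\<^sup>2 * av2 (\<lambda>x y. (U x y)\<^sup>2) - 2 * (\<Sum>a<L. \<Sum>b<L. av2 (\<lambda>x y. S a x y * S b x y))"
    by (simp add: sum_subtractf sum_distrib_left power2_eq_square)
  moreover have "av2 (\<lambda>x y. (Av g L U x y)\<^sup>2) = (\<Sum>a<L. \<Sum>b<L. av2 (\<lambda>x y. S a x y * S b x y)) / (real L)\<^sup>2"
  proof -
    have "(Av g L U x y)\<^sup>2 = (\<Sum>a<L. \<Sum>b<L. S a x y * S b x y) / (real L)\<^sup>2" for x y
      unfolding Av_def S_def by (simp add: power2_eq_square sum_product)
    then show ?thesis by (simp only: av2_divide av2_sum)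
  qed
  ultimately show ?thesis using assms(1) unfolding S_def
    by (simp add: field_simps)
qed

lemma av2_Av_le:
  assumes "L > 0" "bip U"
  shows "av2 (\<lambda>x y. (Av g L U x y)\<^sup>2) \<le> av2 (\<lambda>x y. (U x y)\<^sup>2)"
proof -
  have "0 \<le> av2 (\<lambda>x y. (V x y)\<^sup>2)" for V using av2_mono[of "\<lambda>_ _. 0" "\<lambda>x y. (V x y)\<^sup>2"] by (simp add: av2_const)
  then have "0 \<le> (\<Sum>a<L. \<Sum>b<L. av2 (\<lambda>x y. (U (x + g * int a) (y + g * int a) - U (x + g * int b) (y + g * int b))\<^sup>2)) / (2 * (real L)\<^sup>2)"
    by (intro divide_nonneg_nonneg sum_nonneg) auto
  then show ?thesis using av2_Av_variance[OF assms, of g] by simp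
qed

text \<open>A pairwise difference of \<open>Z\<close> is a translate of V minus V, where V is the
  corresponding pairwise difference of \<open>U\<close>; its mean square is at most 4 times that of
  V. Summation gives the claim through \<open>av2_Av_variance\<close>.\<close>

lemma av2_Av_shift_diff:
  fixes t :: int
  assumes "L > 0" "bip U"
  defines "Z \<equiv> \<lambda>x y. U x (y + t) - U x y"
  shows "av2 (\<lambda>x y. (Z x y)\<^sup>2) - av2 (\<lambda>x y. (Av g L Z x y)\<^sup>2)
    \<le> 4 * (av2 (\<lambda>x y. (U x y)\<^sup>2) - av2 (\<lambda>x y. (Av g L U x y)\<^sup>2))"
proof -
  have bZ: "bip Z" unfolding Z_def using bip_comp2[OF bip_shift[OF assms(2), of 0 t] assms(2), of "(-)"] by simp
  have le: "av2 (\<lambda>x y. (Z (x + g * int a) (y + g * int a) - Z (x + g * int b) (y + g * int b))\<^sup>2)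
     \<le> 4 * av2 (\<lambda>x y. (U (x + g * int a) (y + g * int a) - U (x + g * int b) (y + g * int b))\<^sup>2)" for a b
  proof -
    define V where "V x y = U (x + g * int a) (y + g * int a) - U (x + g * int b) (y + g * int b)" for x y
    have bV: "bip (\<lambda>x y. (V x y)\<^sup>2)"
      using bip_comp2[OF bip_shift[OF assms(2)] bip_shift[OF assms(2)], of "\<lambda>u v. (u - v)\<^sup>2" "g * int a" "g * int a" "g * int b" "g * int b"]
      by (simp add: V_def)
    have "Z (x + g * int a) (y + g * int a) - Z (x + g * int b) (y + g * int b) = V x (y + t) - V x y" for x y
      unfolding Z_def V_def by (simp add: algebra_simps)
    moreover have "(V x (y + t) - V x y)\<^sup>2 \<le> 2 * (V x (y + t))\<^sup>2 + 2 * (V x y)\<^sup>2" for x y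
      using zero_le_power2[of "V x (y + t) + V x y"] by (simp add: power2_sum power2_diff)
    ultimately have "av2 (\<lambda>x y. (Z (x + g * int a) (y + g * int a) - Z (x + g * int b) (y + g * int b))\<^sup>2)
      \<le> av2 (\<lambda>x y. 2 * (V x (y + t))\<^sup>2 + 2 * (V x y)\<^sup>2)"
      by (intro av2_mono) auto
    also have "\<dots> = 2 * av2 (\<lambda>x y. (V x (y + t))\<^sup>2) + 2 * av2 (\<lambda>x y. (V x y)\<^sup>2)"
      by (simp only: av2_add av2_cmult)
    also have "av2 (\<lambda>x y. (V x (y + t))\<^sup>2) = av2 (\<lambda>x y. (V x y)\<^sup>2)"
      using av2_shift[OF bV, of 0 t] by simp
    finally show ?thesis by (simp add: V_def)
  qed
  have "(\<Sum>a<L. \<Sum>b<L. av2 (\<lambda>x y. (Z (x + g * int a) (y + g * int a) - Z (x + g * int b) (y + g * int b))\<^sup>2)) / (2 * (real L)\<^sup>2)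
    \<le> (\<Sum>a<L. \<Sum>b<L. 4 * av2 (\<lambda>x y. (U (x + g * int a) (y + g * int a) - U (x + g * int b) (y + g * int b))\<^sup>2)) / (2 * (real L)\<^sup>2)"
    by (intro divide_right_mono sum_mono le) auto
  then show ?thesis
    unfolding av2_Av_variance[OF assms(1) bZ] av2_Av_variance[OF assms(1,2)]
    by (simp add: sum_distrib_left[symmetric])
qed

lemma square_approx:
  fixes u v :: real
  assumes "\<bar>u - v\<bar> \<le> e" "\<bar>u\<bar> \<le> 1" "\<bar>v\<bar> \<le> 1"
  shows "\<bar>u\<^sup>2 - v\<^sup>2\<bar> \<le> 2 * e"
proof -
  have "\<bar>u\<^sup>2 - v\<^sup>2\<bar> = \<bar>u - v\<bar> * \<bar>u + v\<bar>" by (simp add: power2_eq_square algebra_simps flip: abs_mult)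
  also have "\<dots> \<le> e * 2" using assms by (intro mult_mono) auto
  finally show ?thesis by simp
qed

text \<open>The squared norm for the short box is that of its average along the long box, close to
  the long-box quantity by \<open>Av_G_approx\<close>, plus a variance. For \<open>D\<close> this
  variance is at most 4 times the one for \<open>E\<close>, which is the gain in energy. The 12 is 4
  from approximating \<open>D\<close> and 4 * 2 from approximating \<open>E\<close>.\<close>

lemma energy_transfer:
  assumes L: "L > 0" "L' > 0" and \<eta>: "real (q * L') / L \<le> \<eta>"
  shows "E g L \<le> E (g * int q) L' + 2 * \<eta>"
    and "D (g * int q) L' t \<le> D g L t + 4 * (E (g * int q) L' - E g L) + 12 * \<eta>"
proof -
  let ?U = "G (g * int q) L'"
  have U: "0 \<le> ?U x y \<and> ?U x y \<le> 1" for x y using G_bounds[OF L(2)] by blast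
  have ap: "\<bar>Av g L ?U x y - G g L x y\<bar> \<le> \<eta>" for x y
    using Av_G_approx[OF L, of g q x y] \<eta> by linarith
  have AvU: "0 \<le> Av g L ?U x y" "Av g L ?U x y \<le> 1" for x y using Av_bounds[OF L(1), of ?U] U by blast+
  have Gb: "0 \<le> G g L x y" "G g L x y \<le> 1" for x y using G_bounds[OF L(1)] by blast+
  have "\<bar>av2 (\<lambda>x y. (Av g L ?U x y)\<^sup>2) - E g L\<bar> \<le> 2 * \<eta>"
    unfolding E_def by (intro av2_approx square_approx ap) (use AvU Gb in \<open>auto simp: abs_le_iff intro: order_trans[of _ 0]\<close>)
  then have 1: "E g L \<le> av2 (\<lambda>x y. (Av g L ?U x y)\<^sup>2) + 2 * \<eta>" by linarith
  show "E g L \<le> E (g * int q) L' + 2 * \<eta>"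
    using 1 av2_Av_le[OF L(1) bip_G, of g "g * int q" L'] by (simp add: E_def)
  let ?Z = "\<lambda>x y. ?U x (y + t) - ?U x y"
  have AvZ: "Av g L ?Z x y = Av g L ?U x (y + t) - Av g L ?U x y" for x y
    unfolding Av_def by (simp add: sum_subtractf diff_divide_distrib algebra_simps)
  have "\<bar>av2 (\<lambda>x y. (Av g L ?Z x y)\<^sup>2) - D g L t\<bar> \<le> 2 * (2 * \<eta>)"
    unfolding D_def
  proof (intro av2_approx square_approx)
    fix x y
    show "\<bar>Av g L ?Z x y - (G g L x (y + t) - G g L x y)\<bar> \<le> 2 * \<eta>"
      unfolding AvZ using ap[of x y] ap[of x "y + t"] by linarith
    show "\<bar>Av g L ?Z x y\<bar> \<le> 1" unfolding AvZ using AvU[of x y] AvU[of x "y + t"] by linarith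
    show "\<bar>G g L x (y + t) - G g L x y\<bar> \<le> 1" using Gb[of x y] Gb[of x "y + t"] by linarith
  qed
  moreover have "D (g * int q) L' t = av2 (\<lambda>x y. (?Z x y)\<^sup>2)" by (simp add: D_def)
  ultimately show "D (g * int q) L' t \<le> D g L t + 4 * (E (g * int q) L' - E g L) + 12 * \<eta>"
    using av2_Av_shift_diff[OF L(1) bip_G, of "g * int q" L' t g] 1 by (simp add: E_def)
qed

lemma E_bounds: "L > 0 \<Longrightarrow> 0 \<le> E g L" "L > 0 \<Longrightarrow> E g L \<le> 1"
proof -
  assume L: "L > 0"
  have "0 \<le> (G g L x y)\<^sup>2 \<and> (G g L x y)\<^sup>2 \<le> 1" for x y
    using G_bounds[OF L, of g x y] by (simp add: power_le_one)
  then show "0 \<le> E g L" "E g L \<le> 1"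
    using av2_mono[of "\<lambda>_ _. 0" "\<lambda>x y. (G g L x y)\<^sup>2"] av2_mono[of "\<lambda>x y. (G g L x y)\<^sup>2" "\<lambda>_ _. 1"]
    by (auto simp: E_def av2_const)
qed

text \<open>
  Energy pigeonholing: along a chain of boxes the energies are almost monotone, so some block of
  \<open>R\<close> consecutive boxes has almost constant energy. Almost periods found with respect to the
  coarsest box of that block are then almost periods with respect to the finer ones.
\<close>

lemma almost_period_exists:
  fixes g y :: "nat \<Rightarrow> nat" and Q K s R H :: nat
  assumes R: "R > 2 * 2 ^ s" and s: "s > 0" and H: "H > 0" and K: "K > 0" and Q: "Q > 0"
    and pos: "\<And>c. c \<le> R * H \<Longrightarrow> g c > 0 \<and> y c > 0"
    and dvd: "\<And>c. c < R * H \<Longrightarrow> g c dvd g (Suc c)"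
    and lac: "\<And>c. c < R * H \<Longrightarrow> Q * (g (Suc c) * y (Suc c)) \<le> g c * y c"
  shows "\<exists>c c'. c < c' \<and> c' \<le> R * H \<and>
    D (int (g c)) (K * y c) (int (g c * y c) - int (g c' * y c')) \<le> 8 / s + 4 / H + 24 / Q"
proof -
  define v where "v c = g c * y c" for c
  have dvd': "g c dvd g d" if "c \<le> d" "d \<le> R * H" for c d
    using that
  proof (induction d rule: dec_induct)
    case (step n)
    have "g n dvd g (Suc n)" by (rule dvd) (use step in simp)
    then show ?case using step by (auto intro: dvd_trans)
  qed simp
  have lac': "Q * v d \<le> v c" if "Suc c \<le> d" "d \<le> R * H" for c d
    using that
  proof (induction d rule: dec_induct)
    case base then show ?case using lac[of c] by (simp add: v_def)
  next
    case (step d)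
    have "Q * v (Suc d) \<le> v d" using lac[of d] step by (simp add: v_def)
    also have "\<dots> \<le> Q * v d" using Q by simp
    also have "\<dots> \<le> v c" using step by simp
    finally show ?case .
  qed
  have ratio: "real (v d) / real (v c) \<le> 1 / Q" if "c < d" "d \<le> R * H" for c d
  proof -
    have "v c > 0" using pos[of c] that by (simp add: v_def)
    moreover have "real Q * real (v d) \<le> real (v c)"
      using lac'[of c d] that by (metis Suc_leI of_nat_le_iff of_nat_mult)
    ultimately show ?thesis using Q by (simp add: field_simps)
  qed
  define En where "En c = E (int (g c)) (K * y c)" for c
  have L0: "K * y c > 0" if "c \<le> R * H" for c using pos[OF that] K by simp
  have En: "0 \<le> En c" "En c \<le> 1" if "c \<le> R * H" for c
    unfolding En_def using E_bounds[OF L0[OF that]] by auto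
  have mono: "En c \<le> En d + 2 / Q"
    and trans: "D (int (g d)) (K * y d) t \<le> D (int (g c)) (K * y c) t + 4 * (En d - En c) + 12 / Q"
    if "c < d" "d \<le> R * H" for c d t
  proof -
    have "g c dvd g d" using dvd'[of c d] that by simp
    then obtain q where q: "g d = g c * q" by (rule dvdE)
    have gi: "int (g d) = int (g c) * int q" using q by simp
    have "real (q * (K * y d)) / real (K * y c) = real (v d) / real (v c)"
      using K pos[of c] that by (simp add: v_def q field_simps)
    then have \<eta>: "real (q * (K * y d)) / real (K * y c) \<le> 1 / Q" using ratio[OF that] by simp
    have Lc: "K * y c > 0" and Ld: "K * y d > 0" using L0 that by auto
    show "En c \<le> En d + 2 / Q" using energy_transfer(1)[OF Lc Ld \<eta>, of "int (g c)"] by (simp add: En_def gi)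
    show "D (int (g d)) (K * y d) t \<le> D (int (g c)) (K * y c) t + 4 * (En d - En c) + 12 / Q"
      using energy_transfer(2)[OF Lc Ld \<eta>, of "int (g c)" t] by (simp add: En_def gi)
  qed
  have "\<exists>h<H. En (R * Suc h) - En (R * h) \<le> 1 / H"
  proof (rule ccontr)
    assume "\<not> ?thesis"
    then have "(\<Sum>h<H. 1 / real H) < (\<Sum>h<H. En (R * Suc h) - En (R * h))"
      using H by (intro sum_strict_mono) (auto simp: not_le)
    also have "\<dots> = En (R * H) - En 0" using sum_lessThan_telescope[of "\<lambda>h. En (R * h)" H] by simp
    finally show False using En[of 0] En[of "R * H"] H by simp
  qed
  then obtain h where h: "h < H" "En (R * Suc h) - En (R * h) \<le> 1 / H" by auto
  define e where "e = R * h"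
  have eR: "e + R \<le> R * H" using h(1) mult_le_mono2[of "Suc h" H R] by (simp add: e_def)
  obtain i0 j0 where ij0: "i0 \<in> {e<..e+R}" "j0 \<in> {e<..e+R}" "i0 \<noteq> j0"
    "mv (K * y e) (\<lambda>m. (p (int (g e) * m + int (v i0)) - p (int (g e) * m + int (v j0)))\<^sup>2) \<le> 8 / s"
    using p_close_pair[of "{e<..e+R}" "K * y e" s "int (g e)" "\<lambda>i. int (v i)"] L0[of e] eR s R by auto
  define i j where "i = min i0 j0" and "j = max i0 j0"
  have ij: "e < i" "i < j" "j \<le> e + R" using ij0 by (auto simp: i_def j_def min_def max_def)
  have sm: "mv (K * y e) (\<lambda>m. (p (int (g e) * m + int (v i)) - p (int (g e) * m + int (v j)))\<^sup>2) \<le> 8 / s"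
    using ij0(4) by (auto simp: i_def j_def min_def max_def power2_commute)
  \<comment> \<open>The length of box c in units of the step g e. Lacunarity makes it a negligible
    shift along box e.\<close>
  define \<nu> where "\<nu> c = (g c div g e) * y c" for c
  have \<nu>: "int (g e) * int (\<nu> c) = int (v c)" "real (\<nu> c) / real (K * y e) \<le> 1 / Q" if "e < c" "c \<le> e + R" for c
  proof -
    have d: "g e dvd g c" using dvd'[of e c] that eR by simp
    have *: "g e * \<nu> c = v c" using d by (simp add: \<nu>_def v_def mult.assoc[symmetric])
    then show "int (g e) * int (\<nu> c) = int (v c)" by (metis of_nat_mult)
    have ge: "real (g e) > 0" "real (y e) > 0" using pos[of e] eR by auto
    have "real (\<nu> c) / real (K * y e) = real (v c) / real (v e) / K"
      using *[symmetric] ge by (simp add: v_def field_simps)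
    also have "\<dots> \<le> real (v c) / real (v e) / 1"
      using K by (intro divide_left_mono) auto
    also have "\<dots> \<le> 1 / Q" using ratio[of e c] that eR by simp
    finally show "real (\<nu> c) / real (K * y e) \<le> 1 / Q" .
  qed
  let ?t = "int (v i) - int (v j)"
  have "D (int (g e)) (K * y e) ?t \<le> 8 / s + (real (\<nu> i) + 3 * real (\<nu> j)) / real (K * y e)"
    using D_le_p_diff[OF L0[of e], of "int (g e)" "\<nu> i" "\<nu> j"] sm \<nu>(1)[of i] \<nu>(1)[of j] ij eR by simp
  also have "\<dots> \<le> 8 / s + 4 / Q"
    using \<nu>(2)[of i] \<nu>(2)[of j] ij by (simp add: add_divide_distrib)
  finally have De: "D (int (g e)) (K * y e) ?t \<le> 8 / s + 4 / Q" .
  \<comment> \<open>Passing from \<open>e\<close> to \<open>i\<close> makes the box length K * y i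
    comparable with the almost period divided by the step g i. The multiples of 1 / Q add up to 4 +
    8 + 12 = 24.\<close>
  have "D (int (g i)) (K * y i) ?t \<le> D (int (g e)) (K * y e) ?t + 4 * (En i - En e) + 12 / Q"
    by (rule trans) (use ij eR in auto)
  moreover have "En i \<le> En (e + R) + 2 / Q" by (rule mono) (use ij eR in auto)
  moreover have "En (e + R) - En e \<le> 1 / H" using h(2) by (simp add: e_def algebra_simps)
  ultimately have "D (int (g i)) (K * y i) ?t \<le> 8 / s + 4 / H + 24 / Q"
    using De by (simp add: field_simps)
  then show ?thesis using ij eR unfolding v_def by (intro exI[of _ i] exI[of _ j]) auto
qed

end

section \<open>Popular differences modulo an almost period\<close>

text \<open>For each b from M to L - M - 1 the differences a - b cover all of [-M, M], so every m
  there has weight at least (L - 2 * M) / L^2.\<close>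

lemma mv_lower:
  assumes "\<And>m. 0 \<le> \<phi> m" "2 * M \<le> L"
  shows "real (L - 2 * M) * (\<Sum>m\<in>{- int M..int M}. \<phi> m) \<le> (real L)\<^sup>2 * mv L \<phi>"
proof -
  have reidx: "(\<Sum>a<L. h (int a)) = (\<Sum>x\<in>{0..<int L}. h x)" for h :: "int \<Rightarrow> real"
    by (rule sum.reindex_bij_witness[of _ nat int]) auto
  have inner: "(\<Sum>m\<in>{- int M..int M}. \<phi> m) \<le> (\<Sum>a<L. \<phi> (int a - int b))" if "b \<in> {M..<L - M}" for b
  proof -
    have "(\<Sum>a<L. \<phi> (int a - int b)) = (\<Sum>x\<in>{- int b..<int L - int b}. \<phi> x)"
      by (rule sum.reindex_bij_witness[of _ "\<lambda>x. nat (x + int b)" "\<lambda>a. int a - int b"]) auto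
    then show ?thesis using that assms(1) by (auto intro!: sum_mono2)
  qed
  have "real (L - 2 * M) * (\<Sum>m\<in>{- int M..int M}. \<phi> m) = (\<Sum>b\<in>{M..<L - M}. \<Sum>m\<in>{- int M..int M}. \<phi> m)"
    by (simp add: mult_2)
  also have "\<dots> \<le> (\<Sum>b\<in>{M..<L - M}. \<Sum>a<L. \<phi> (int a - int b))"
    by (rule sum_mono) (rule inner)
  also have "\<dots> \<le> (\<Sum>b<L. \<Sum>a<L. \<phi> (int a - int b))"
    by (rule sum_mono2) (auto intro!: sum_nonneg assms(1))
  also have "\<dots> = (\<Sum>a<L. \<Sum>b<L. \<phi> (int a - int b))" by (rule sum.swap)
  also have "\<dots> = (real L)\<^sup>2 * mv L \<phi>" by (cases "L = 0") (simp_all add: mv_def)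
  finally show ?thesis .
qed

lemma sum_squared_le_card:
  fixes T :: "'a \<Rightarrow> real"
  shows "(\<Sum>x\<in>A. T x)\<^sup>2 \<le> card A * (\<Sum>x\<in>A. (T x)\<^sup>2)"
proof (cases "card A = 0")
  case True
  then show ?thesis by (metis card_eq_0_iff mult_zero_left of_nat_0 order_refl sum.empty sum.infinite zero_power2)
next
  case False
  define c where "c = (\<Sum>x\<in>A. T x) / card A"
  have cA: "card A * c = (\<Sum>x\<in>A. T x)" using False by (simp add: c_def)
  have "0 \<le> (\<Sum>x\<in>A. (T x - c)\<^sup>2)" by (rule sum_nonneg) simp
  also have "\<dots> = (\<Sum>x\<in>A. (T x)\<^sup>2) - 2 * c * (\<Sum>x\<in>A. T x) + card A * c\<^sup>2"
  proof -
    have "(T x - c)\<^sup>2 = (T x)\<^sup>2 - 2 * c * T x + c\<^sup>2" for x by (simp add: power2_diff)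
    then show ?thesis by (simp only: sum.distrib sum_subtractf sum_distrib_left[symmetric] sum_constant)
  qed
  also have "\<dots> = (\<Sum>x\<in>A. (T x)\<^sup>2) - c * (\<Sum>x\<in>A. T x)"
    using cA by (simp add: power2_eq_square algebra_simps)
  finally have "card A * (c * (\<Sum>x\<in>A. T x)) \<le> card A * (\<Sum>x\<in>A. (T x)\<^sup>2)"
    by (intro mult_left_mono) auto
  then show ?thesis using cA by (simp add: power2_eq_square mult.assoc[symmetric])
qed

lemma exists_ge_av:
  assumes "N > 0" shows "\<exists>s. av N F \<le> F s"
proof (rule ccontr)
  assume "\<not> ?thesis"
  then have "(\<Sum>x\<in>{0..<N}. F x) < (\<Sum>x\<in>{0..<N}. av N F)"
    using assms by (intro sum_strict_mono) (auto simp: not_le)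
  then show False using assms by (simp add: av_def)
qed

lemma sum_shift_window:
  fixes T :: "int \<Rightarrow> real"
  assumes "\<And>m. 0 \<le> T m" "- M \<le> - a + e" "b + e \<le> M"
  shows "(\<Sum>m\<in>{-a..b}. T (m + e)) \<le> (\<Sum>m\<in>{-M..M}. T m)"
proof -
  have "(\<Sum>m\<in>{-a..b}. T (m + e)) = (\<Sum>m\<in>{-a+e..b+e}. T m)"
    by (rule sum.reindex_bij_witness[of _ "\<lambda>x. x - e" "\<lambda>x. x + e"]) auto
  also have "\<dots> \<le> (\<Sum>m\<in>{-M..M}. T m)" by (rule sum_mono2) (use assms in auto)
  finally show ?thesis .
qed

context cyclic_indicator begin

text \<open>Walk from m to m + j * n in steps of n; each step costs a value of \<open>T\<close>
  inside [-M, M]. Cauchy-Schwarz passes from the sum of \<open>T\<close> to its mean square, which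
  \<open>D\<close> bounds, and 4 * M <= L keeps the weight from \<open>mv_lower\<close> at least 1 /
  (2 * L).\<close>

lemma p_shift_sum:
  fixes g n M :: int and k\<^sub>0 K\<^sub>1 :: nat
  assumes n: "n > 0" and M: "(int k\<^sub>0 + int K\<^sub>1) * n \<le> M" and L: "4 * M \<le> int L" and K1: "K\<^sub>1 > 0"
    and j: "\<bar>j\<bar> \<le> int K\<^sub>1"
  shows "(\<Sum>m\<in>{- (int k\<^sub>0 * n)..int k\<^sub>0 * n}. \<bar>p (g * (m + j * n)) - p (g * m)\<bar>)
    \<le> real K\<^sub>1 * sqrt ((2 * real_of_int M + 1) * (2 * real L * D g L (g * n)))"
proof -
  define T where "T m = \<bar>p (g * (m + n)) - p (g * m)\<bar>" for m
  have T0: "T m \<ge> 0" for m by (simp add: T_def)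
  let ?I = "{- (int k\<^sub>0 * n)..int k\<^sub>0 * n}"
  have M0: "M \<ge> 0" using M n by (smt (verit) mult_nonneg_nonneg of_nat_0_le_iff)
  have walk: "\<bar>p (g * (m + int i * n)) - p (g * m)\<bar> \<le> (\<Sum>c<i. T (m + int c * n))" for m i
  proof (induction i)
    case (Suc i)
    have "m + int (Suc i) * n = (m + int i * n) + n" by (simp add: algebra_simps)
    then have "\<bar>p (g * (m + int (Suc i) * n)) - p (g * (m + int i * n))\<bar> = T (m + int i * n)"
      unfolding T_def by (simp only: add.assoc)
    then show ?case using Suc by simp
  qed simp
  define i where "i = nat \<bar>j\<bar>"
  have i: "i \<le> K\<^sub>1" using j by (simp add: i_def)
  have iM: "int k\<^sub>0 * n + int i * n \<le> M"
  proof -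
    have "int i * n \<le> int K\<^sub>1 * n" using i n by (intro mult_right_mono) auto
    then show ?thesis using M by (simp add: algebra_simps)
  qed
  have cbound: "0 \<le> int c * n \<and> int c * n \<le> int i * n" if "c < i" for c
    using that n by (auto intro!: mult_right_mono)
  \<comment> \<open>The walk always runs forward: it starts at m for j >= 0, and at the other end m
    - i * n for negative j.\<close>
  obtain e where e: "\<And>m. \<bar>p (g * (m + j * n)) - p (g * m)\<bar> \<le> (\<Sum>c<i. T (m + e + int c * n))"
    "- (int i * n) \<le> e" "\<And>c. c < i \<Longrightarrow> e + int c * n \<le> int i * n" "\<And>c. c < i \<Longrightarrow> - (int i * n) \<le> e + int c * n"
  proof (cases "j \<ge> 0")
    case True
    then have ji: "j = int i" by (simp add: i_def)
    show ?thesis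
      by (rule that[of 0]) (use walk cbound n in \<open>auto simp: ji\<close>, smt (verit) cbound)
  next
    case False
    then have ji: "j = - int i" by (simp add: i_def)
    show ?thesis
    proof (rule that[of "- (int i * n)"])
      fix m
      show "\<bar>p (g * (m + j * n)) - p (g * m)\<bar> \<le> (\<Sum>c<i. T (m + - (int i * n) + int c * n))"
        using walk[of "m + - (int i * n)" i] by (simp add: ji abs_minus_commute)
    next
      fix c assume "c < i"
      from cbound[OF this] show "- (int i * n) + int c * n \<le> int i * n" "- (int i * n) \<le> - (int i * n) + int c * n"
        by linarith+
    qed simp
  qed
  have "(\<Sum>m\<in>?I. \<bar>p (g * (m + j * n)) - p (g * m)\<bar>) \<le> (\<Sum>m\<in>?I. \<Sum>c<i. T (m + e + int c * n))"
    by (rule sum_mono) (rule e(1))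
  also have "\<dots> = (\<Sum>c<i. \<Sum>m\<in>?I. T (m + (e + int c * n)))"
    by (subst sum.swap) (simp add: add.assoc)
  also have "\<dots> \<le> (\<Sum>c<i. \<Sum>m\<in>{-M..M}. T m)"
  proof (rule sum_mono)
    fix c assume "c \<in> {..<i}"
    then show "(\<Sum>m\<in>?I. T (m + (e + int c * n))) \<le> (\<Sum>m\<in>{-M..M}. T m)"
      using e(3)[of c] e(4)[of c] iM by (intro sum_shift_window T0) auto
  qed
  also have "\<dots> \<le> real K\<^sub>1 * (\<Sum>m\<in>{-M..M}. T m)"
    using i by (simp add: mult_right_mono sum_nonneg T0)
  also have "(\<Sum>m\<in>{-M..M}. T m) \<le> sqrt ((2 * real_of_int M + 1) * (2 * real L * D g L (g * n)))"
  proof (rule real_le_rsqrt)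
    have "real (card {-M..M}) = 2 * real_of_int M + 1" using M0 by simp
    then have 1: "(\<Sum>m\<in>{-M..M}. T m)\<^sup>2 \<le> (\<Sum>m\<in>{-M..M}. (T m)\<^sup>2) * (2 * real_of_int M + 1)"
      using sum_squared_le_card[of T "{-M..M}"] by (simp add: mult.commute)
    have Mn: "int (nat M) = M" using M0 by simp
    have M_le: "2 * nat M \<le> L" using L M0 by linarith
    have mvT: "mv L (\<lambda>m. (T m)\<^sup>2) \<le> D g L (g * n)"
      using p_shift_le_D[of L g "g * n"] by (simp add: T_def algebra_simps)
    have "real (L - 2 * nat M) * (\<Sum>m\<in>{-M..M}. (T m)\<^sup>2) \<le> (real L)\<^sup>2 * mv L (\<lambda>m. (T m)\<^sup>2)"
      using mv_lower[of "\<lambda>m. (T m)\<^sup>2" "nat M" L] M_le unfolding Mn by simp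
    also have "\<dots> \<le> (real L)\<^sup>2 * D g L (g * n)" by (intro mult_left_mono mvT) auto
    finally have "real (L - 2 * nat M) * (\<Sum>m\<in>{-M..M}. (T m)\<^sup>2) \<le> (real L)\<^sup>2 * D g L (g * n)" .
    moreover have "real L / 2 \<le> real (L - 2 * nat M)" using L M_le Mn by (simp add: of_nat_diff) 
    then have "real L / 2 * (\<Sum>m\<in>{-M..M}. (T m)\<^sup>2) \<le> real (L - 2 * nat M) * (\<Sum>m\<in>{-M..M}. (T m)\<^sup>2)"
      by (intro mult_right_mono sum_nonneg) auto
    ultimately have Lle: "real L * (\<Sum>m\<in>{-M..M}. (T m)\<^sup>2) \<le> real L * (2 * real L * D g L (g * n))"
      by (simp add: power2_eq_square)
    then have 2: "(\<Sum>m\<in>{-M..M}. (T m)\<^sup>2) \<le> 2 * real L * D g L (g * n)"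
    proof -
      have "0 < (int k\<^sub>0 + int K\<^sub>1) * n" using n K1 by (intro mult_pos_pos) auto
      then have "L > 0" using M L by linarith
      then show ?thesis using Lle by simp
    qed
    show "(\<Sum>m\<in>{-M..M}. T m)\<^sup>2 \<le> (2 * real_of_int M + 1) * (2 * real L * D g L (g * n))"
    proof -
      have "(2 * real_of_int M + 1) * (\<Sum>m\<in>{-M..M}. (T m)\<^sup>2) \<le> (2 * real_of_int M + 1) * (2 * real L * D g L (g * n))"
        using 2 M0 by (intro mult_left_mono) auto
      then show ?thesis using 1 by (simp only: mult.commute[of "\<Sum>m\<in>{-M..M}. (T m)\<^sup>2"])
    qed
  qed
  finally show ?thesis by (simp add: mult_left_mono)
qed

definition u :: "int \<Rightarrow> nat \<Rightarrow> int \<Rightarrow> real" where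
  "u q K x = (\<Sum>c<K. f (x + q * int c)) / K"

lemma u_bounds: "0 \<le> u q K x" "u q K x \<le> 1"
proof -
  show "0 \<le> u q K x" unfolding u_def by (intro divide_nonneg_nonneg sum_nonneg) (auto simp: f_bounds)
  have "(\<Sum>c<K. f (x + q * int c)) \<le> (\<Sum>c<K. 1)" by (intro sum_mono f_bounds)
  then show "u q K x \<le> 1" unfolding u_def by (cases "K = 0") (auto simp: field_simps)
qed

lemma u_shift: "\<bar>u q K (x + q * j) - u q K x\<bar> \<le> \<bar>real_of_int j\<bar> / K"
proof -
  have nat: "\<bar>u q K (x + q * int i) - u q K x\<bar> \<le> real i / K" for x i
  proof -
    have "\<bar>(\<Sum>c<K. f (x + q * int i + q * int c)) - (\<Sum>c<K. f (x + q * int c))\<bar> \<le> real i"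
      using sum_shift_le[of "\<lambda>c. f (x + q * c)" i K] f_bounds by (simp add: algebra_simps)
    then show ?thesis unfolding u_def diff_divide_distrib[symmetric] abs_divide
      by (simp add: divide_right_mono)
  qed
  show ?thesis
  proof (cases "j \<ge> 0")
    case True then show ?thesis using nat[of x "nat j"] by simp
  next
    case False
    then show ?thesis using nat[of "x + q * j" "nat (- j)"] by (simp add: abs_minus_commute algebra_simps)
  qed
qed

lemma u_per: "u q K (x + N) = u q K x"
proof -
  have "x + N + y = (x + y) + N" for y by simp
  then show ?thesis unfolding u_def using per by metis
qed

lemma av_u: assumes "K > 0" shows "av N (\<lambda>x. u q K (x + a)) = av N f"
proof -
  have "av N (\<lambda>x. f (x + (a + q * int c))) = av N f" for c by (rule av_shift[OF N, of f]) (rule per)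
  then show ?thesis unfolding u_def av_divide av_sum using assms by (simp add: add.assoc)
qed

lemma av_uu: "av N (\<lambda>x. u q K x * u q K (x + e)) = (\<Sum>a<K. \<Sum>b<K. p (e + (int b - int a) * q)) / (real K)\<^sup>2"
proof -
  have "u q K x * u q K (x + e) = (\<Sum>a<K. \<Sum>b<K. f (x + q * int a) * f (x + (e + q * int b))) / (real K)\<^sup>2" for x
    unfolding u_def by (simp add: sum_product power2_eq_square add.assoc)
  then show ?thesis by (simp add: av_divide av_sum p_shift algebra_simps)
qed

text \<open>The autocorrelation of \<open>u\<close> at g * m is the mean of p (g * (m + (b - a) *
  n)) over a, b < \<open>K\<^sub>1\<close>, hence close to p (g * m) on average over m. So it is
  small in total where \<open>p\<close> is small.\<close>

lemma pbar_approx: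
  fixes g n M :: int and k\<^sub>0 K\<^sub>1 :: nat
  assumes n: "n > 0" and M: "(int k\<^sub>0 + int K\<^sub>1) * n \<le> M" and L: "4 * M \<le> int L" and K1: "K\<^sub>1 > 0"
    and Oset: "Oset \<subseteq> {- (int k\<^sub>0 * n)..int k\<^sub>0 * n}" "\<And>m. m \<in> Oset \<Longrightarrow> p (g * m) \<le> \<theta>" and \<theta>: "0 \<le> \<theta>"
  shows "(\<Sum>m\<in>Oset. av N (\<lambda>x. u (g * n) K\<^sub>1 x * u (g * n) K\<^sub>1 (x + g * m)))
    \<le> \<theta> * (2 * real k\<^sub>0 * n + 1) + real K\<^sub>1 * sqrt ((2 * real_of_int M + 1) * (2 * real L * D g L (g * n)))"
    (is "_ \<le> _ + ?err")
proof -
  let ?I = "{- (int k\<^sub>0 * n)..int k\<^sub>0 * n}"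
  have finO: "finite Oset" using Oset(1) by (rule finite_subset) simp
  have eq: "(\<Sum>m\<in>Oset. av N (\<lambda>x. u (g * n) K\<^sub>1 x * u (g * n) K\<^sub>1 (x + g * m)))
    = (\<Sum>m\<in>Oset. \<Sum>a<K\<^sub>1. \<Sum>b<K\<^sub>1. p (g * (m + (int b - int a) * n))) / (real K\<^sub>1)\<^sup>2"
    unfolding av_uu by (simp add: sum_divide_distrib algebra_simps)
  have "(\<Sum>m\<in>Oset. \<Sum>a<K\<^sub>1. \<Sum>b<K\<^sub>1. p (g * (m + (int b - int a) * n)))
     = (\<Sum>a<K\<^sub>1. \<Sum>b<K\<^sub>1. \<Sum>m\<in>Oset. p (g * (m + (int b - int a) * n)))"
    by (subst sum.swap) (simp add: sum.swap[of _ _ Oset])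
  also have "\<dots> \<le> (\<Sum>a<K\<^sub>1. \<Sum>b<K\<^sub>1. \<theta> * (2 * real k\<^sub>0 * n + 1) + ?err)"
  proof (intro sum_mono)
    fix a b assume ab: "a \<in> {..<K\<^sub>1}" "b \<in> {..<K\<^sub>1}"
    have "(\<Sum>m\<in>Oset. p (g * (m + (int b - int a) * n)))
       \<le> (\<Sum>m\<in>Oset. p (g * m) + \<bar>p (g * (m + (int b - int a) * n)) - p (g * m)\<bar>)"
      by (rule sum_mono) linarith
    also have "\<dots> = (\<Sum>m\<in>Oset. p (g * m)) + (\<Sum>m\<in>Oset. \<bar>p (g * (m + (int b - int a) * n)) - p (g * m)\<bar>)"
      by (rule sum.distrib)
    also have "(\<Sum>m\<in>Oset. p (g * m)) \<le> (\<Sum>m\<in>Oset. \<theta>)" by (rule sum_mono) (rule Oset(2))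
    also have "\<dots> = \<theta> * card Oset" by simp
    also have "\<dots> \<le> \<theta> * (2 * real k\<^sub>0 * n + 1)"
    proof (intro mult_left_mono \<theta>)
      have "card Oset \<le> card ?I" by (rule card_mono) (use Oset in auto)
      also have "\<dots> = nat (2 * (int k\<^sub>0 * n) + 1)" by (simp add: mult.commute)
      finally have "real (card Oset) \<le> real (nat (2 * (int k\<^sub>0 * n) + 1))" by (rule of_nat_mono)
      also have "\<dots> = 2 * real k\<^sub>0 * n + 1" using n by simp
      finally show "real (card Oset) \<le> 2 * real k\<^sub>0 * n + 1" .
    qed
    also have "(\<Sum>m\<in>Oset. \<bar>p (g * (m + (int b - int a) * n)) - p (g * m)\<bar>)
       \<le> (\<Sum>m\<in>?I. \<bar>p (g * (m + (int b - int a) * n)) - p (g * m)\<bar>)"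
      by (rule sum_mono2) (use Oset in auto)
    also have "\<dots> \<le> ?err" by (rule p_shift_sum[OF n M L K1]) (use ab in auto)
    finally show "(\<Sum>m\<in>Oset. p (g * (m + (int b - int a) * n))) \<le> \<theta> * (2 * real k\<^sub>0 * n + 1) + ?err" by simp
  qed
  also have "\<dots> = (real K\<^sub>1)\<^sup>2 * (\<theta> * (2 * real k\<^sub>0 * n + 1) + ?err)" by (simp add: power2_eq_square)
  finally have "(\<Sum>m\<in>Oset. \<Sum>a<K\<^sub>1. \<Sum>b<K\<^sub>1. p (g * (m + (int b - int a) * n)))
    \<le> (real K\<^sub>1)\<^sup>2 * (\<theta> * (2 * real k\<^sub>0 * n + 1) + ?err)" .
  then have "(\<Sum>m\<in>Oset. \<Sum>a<K\<^sub>1. \<Sum>b<K\<^sub>1. p (g * (m + (int b - int a) * n))) / (real K\<^sub>1)\<^sup>2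
    \<le> (real K\<^sub>1)\<^sup>2 * (\<theta> * (2 * real k\<^sub>0 * n + 1) + ?err) / (real K\<^sub>1)\<^sup>2"
    by (rule divide_right_mono) simp
  then show ?thesis unfolding eq using K1 by simp
qed

text \<open>
  Averaging \<open>f\<close> over multiples of the almost period \<open>g n\<close> gives \<open>u\<close>, whose autocorrelation approximates
  \<open>p\<close> and which is nearly periodic. So it suffices to look at the residues \<open>\<rho>\<close> modulo \<open>n\<close> for which \<open>u\<close> is
  not small at \<open>x + g * \<rho>\<close>, for one well chosen \<open>x\<close>, and at their popular differences.
\<close>

lemma good_differences:
  fixes g n M :: int and k\<^sub>0 K\<^sub>1 :: nat and \<xi> \<theta> :: real
  assumes n: "n > 0" and M: "(int k\<^sub>0 + int K\<^sub>1) * n \<le> M" and L: "4 * M \<le> int L"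
    and \<xi>: "0 < \<xi>" "\<xi> \<le> 1" "1 \<le> \<xi> * n" and K1: "2 * real k\<^sub>0 \<le> \<xi> * K\<^sub>1" "K\<^sub>1 > 0"
    and rough: "\<And>h. h dvd n \<Longrightarrow> 1 < h \<Longrightarrow> 1 / \<xi> \<le> real_of_int h"
    and \<theta>: "0 \<le> \<theta>"
    and err: "\<theta> * (2 * real k\<^sub>0 * n + 1) + real K\<^sub>1 * sqrt ((2 * real_of_int M + 1) * (2 * real L * D g L (g * n)))
      \<le> \<xi> ^ 6 / 8 * n"
    and dense: "3 * \<xi> \<le> av N f"
  shows "\<exists>\<Gamma>\<subseteq>{0..<n}. min (real_of_int n) (2 * (av N f - 2 * \<xi>) * n) - 4 * \<xi> * n \<le> card \<Gamma> \<and>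
    (\<forall>m. m mod n \<in> \<Gamma> \<longrightarrow> \<bar>m\<bar> \<le> int k\<^sub>0 * n \<longrightarrow> \<theta> < p (g * m))"
proof -
  let ?I = "{- (int k\<^sub>0 * n)..int k\<^sub>0 * n}"
  let ?u = "u (g * n) K\<^sub>1"
  define d where "d = av N f"
  define Oset where "Oset = {m \<in> ?I. p (g * m) \<le> \<theta>}"
  have finO: "finite Oset" by (rule finite_subset[of _ ?I]) (auto simp: Oset_def)
  \<comment> \<open>\<open>U\<close> is the density seen from x along one period of residues;
    \<open>viol\<close> is the weight of the pairs whose difference m is unpopular for
    \<open>p\<close>.\<close>
  define U where "U x = (\<Sum>\<rho>\<in>{0..<n}. ?u (x + g * \<rho>)) / n" for x
  define viol where "viol x = (\<Sum>m\<in>Oset. (\<Sum>\<rho>\<in>{0..<n}. ?u (x + g * \<rho>) * ?u (x + g * \<rho> + g * m)) / n)" for x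
  have avU: "av N U = d"
    unfolding U_def av_divide av_sum av_u[OF K1(2)] d_def using n by simp
  have "av N viol = (\<Sum>m\<in>Oset. av N (\<lambda>x. ?u x * ?u (x + g * m)))"
    unfolding viol_def av_divide av_sum
  proof (rule sum.cong[OF refl])
    fix m
    have "av N (\<lambda>x. ?u (x + g * \<rho>) * ?u (x + g * \<rho> + g * m)) = av N (\<lambda>x. ?u x * ?u (x + g * m))" for \<rho>
    proof (rule av_shift[OF N, of "\<lambda>x. ?u x * ?u (x + g * m)"])
      fix x
      have "x + N + g * m = (x + g * m) + N" by simp
      then show "?u (x + N) * ?u (x + N + g * m) = ?u x * ?u (x + g * m)" by (simp only: u_per)
    qed
    then show "(\<Sum>\<rho>\<in>{0..<n}. av N (\<lambda>x. ?u (x + g * \<rho>) * ?u (x + g * \<rho> + g * m))) / n = av N (\<lambda>x. ?u x * ?u (x + g * m))"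
      using n by simp
  qed
  also have "\<dots> \<le> \<theta> * (2 * real k\<^sub>0 * n + 1) + real K\<^sub>1 * sqrt ((2 * real_of_int M + 1) * (2 * real L * D g L (g * n)))"
    by (rule pbar_approx[OF n M L K1(2)]) (use \<theta> in \<open>auto simp: Oset_def\<close>)
  finally have avv: "av N viol \<le> \<xi> ^ 6 / 8 * n" using err by linarith
  \<comment> \<open>This weight makes the mean penalty at most \<xi>. So some x keeps density d -
    \<xi> after the penalty, and as \<open>U\<close> is at most 1, its violation is at most 2 /
    \<kappa>.\<close>
  define \<kappa> where "\<kappa> = 8 / (\<xi> ^ 5 * n)"
  have \<kappa>: "\<kappa> > 0" using \<xi> n by (simp add: \<kappa>_def)
  obtain x where x: "av N (\<lambda>x. U x - \<kappa> * viol x) \<le> U x - \<kappa> * viol x"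
    using exists_ge_av[OF N, of "\<lambda>x. U x - \<kappa> * viol x"] by auto
  have "\<kappa> * av N viol \<le> \<kappa> * (\<xi> ^ 6 / 8 * n)" using \<kappa> avv by (intro mult_left_mono) auto
  also have "\<dots> = \<xi>" using \<xi> n by (simp add: \<kappa>_def power_numeral_reduce)
  finally have x': "d - \<xi> \<le> U x - \<kappa> * viol x"
    using x unfolding av_diff av_cmult avU by linarith
  have v0: "viol x \<ge> 0" unfolding viol_def
    using n by (intro sum_nonneg divide_nonneg_nonneg) (auto simp: u_bounds)
  have U1: "U x \<le> 1"
  proof -
    have "(\<Sum>\<rho>\<in>{0..<n}. ?u (x + g * \<rho>)) \<le> (\<Sum>\<rho>\<in>{0..<n}. 1)" by (intro sum_mono u_bounds)
    then show ?thesis unfolding U_def using n by simp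
  qed
  have Ux: "d - \<xi> \<le> U x" using x' v0 \<kappa> by (smt (verit) mult_nonneg_nonneg)
  have "\<kappa> * viol x \<le> 2"
    using x' U1 dense \<xi> unfolding d_def by linarith
  then have "\<kappa> * viol x * (\<xi> ^ 5 * n / 8) \<le> 2 * (\<xi> ^ 5 * n / 8)"
    using \<xi> n by (intro mult_right_mono) auto
  moreover have "\<kappa> * (\<xi> ^ 5 * n / 8) = 1" using \<xi> n by (simp add: \<kappa>_def)
  then have "\<kappa> * viol x * (\<xi> ^ 5 * n / 8) = viol x" by (metis mult.commute mult.left_commute mult.right_neutral)
  ultimately have "viol x \<le> 2 * (\<xi> ^ 5 * n / 8)" by metis
  then have viol: "viol x \<le> \<xi> ^ 5 * n / 4" by linarith
  define A where "A = {\<rho>\<in>{0..<n}. \<xi> \<le> ?u (x + g * \<rho>)}"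
  have A: "A \<subseteq> {0..<n}" by (auto simp: A_def)
  have finA: "finite A" by (rule finite_residues[OF A])
  have cA: "(d - 2 * \<xi>) * n \<le> card A"
  proof -
    have "n * U x = (\<Sum>\<rho>\<in>{0..<n}. ?u (x + g * \<rho>))" using n by (simp add: U_def)
    also have "\<dots> \<le> (\<Sum>\<rho>\<in>{0..<n}. (if \<rho> \<in> A then 1 else 0) + \<xi>)"
      by (rule sum_mono) (use u_bounds \<xi> in \<open>auto simp: A_def not_le less_imp_le intro: add_increasing2\<close>)
    also have "\<dots> = card A + n * \<xi>"
      using n A by (simp add: sum.distrib sum.If_cases Int_absorb1)
    finally have "n * U x \<le> card A + n * \<xi>" .
    moreover have "n * (d - \<xi>) \<le> n * U x" using Ux n by (intro mult_left_mono) auto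
    ultimately show ?thesis by (simp add: algebra_simps)
  qed
  define B where "B = (\<lambda>a. (- a) mod n) ` A"
  have injB: "inj_on (\<lambda>a. (- a) mod n) A"
  proof (rule inj_onI)
    fix a b assume ab: "a \<in> A" "b \<in> A" "(- a) mod n = (- b) mod n"
    then have "a mod n = b mod n" by (metis minus_minus mod_minus_cong)
    then show "a = b" using ab A by (auto simp: subset_iff)
  qed
  have B: "B \<subseteq> {0..<n}" unfolding B_def using n by auto
  have cB: "card B = card A" unfolding B_def by (rule card_image[OF injB])
  have repAB: "rep n A B \<gamma> = card {a \<in> A. (\<gamma> + a) mod n \<in> A}" for \<gamma>
  proof -
    have "{b \<in> B. (\<gamma> - b) mod n \<in> A} = (\<lambda>a. (- a) mod n) ` {a \<in> A. (\<gamma> + a) mod n \<in> A}"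
      unfolding B_def by (auto simp: mod_diff_right_eq)
    moreover have "inj_on (\<lambda>a. (- a) mod n) {a \<in> A. (\<gamma> + a) mod n \<in> A}"
      by (rule inj_on_subset[OF injB]) auto
    ultimately show ?thesis unfolding rep_def by (simp add: card_image)
  qed
  have "(d - 2 * \<xi>) * n \<ge> \<xi> * n" using dense n unfolding d_def by (intro mult_right_mono) auto
  then have A\<xi>: "\<xi> * n \<le> card A" using cA by linarith
  define P where "P = {\<gamma>\<in>{0..<n}. \<xi>\<^sup>2 * n / 2 \<le> rep n A B \<gamma>}"
  have cP: "min (real_of_int n) (2 * (d - 2 * \<xi>) * n) - 3 * \<xi> * n \<le> card P"
  proof -
    have "min (real_of_int n) (real (card A) + card B) - 3 * \<xi> * n \<le> card P"
      unfolding P_def by (rule popular_sums[OF n \<xi> rough A A\<xi> B]) (use A\<xi> cB in simp_all)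
    moreover have "min (real_of_int n) (2 * (d - 2 * \<xi>) * n) \<le> min (real_of_int n) (real (card A) + card B)"
    proof (intro min.mono order_refl)
      have "2 * ((d - 2 * \<xi>) * n) \<le> 2 * real (card A)" using cA by linarith
      then show "2 * (d - 2 * \<xi>) * n \<le> real (card A) + real (card B)" using cB by (simp only: mult.assoc)
    qed
    ultimately show ?thesis by linarith
  qed
  \<comment> \<open>Each bad m adds at least \<xi>^4 / 4 to \<open>viol x\<close>: there are \<xi>^2
    * n / 2 residues, each with a product of at least \<xi> * (\<xi> / 2). Hence at most \<xi> * n
    classes must be deleted from \<open>P\<close>.\<close>
  define Bad where "Bad = {m \<in> Oset. m mod n \<in> P}"
  have bad1: "\<xi> ^ 4 / 4 \<le> (\<Sum>\<rho>\<in>{0..<n}. ?u (x + g * \<rho>) * ?u (x + g * \<rho> + g * m)) / n" if m: "m \<in> Bad" for m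
  proof -
    define S where "S = {a \<in> A. (m mod n + a) mod n \<in> A}"
    have cS: "\<xi>\<^sup>2 * n / 2 \<le> card S" using m by (simp add: Bad_def P_def repAB S_def)
    have S: "S \<subseteq> {0..<n}" using A by (auto simp: S_def)
    have each: "\<xi> * (\<xi> / 2) \<le> ?u (x + g * a) * ?u (x + g * a + g * m)" if a: "a \<in> S" for a
    proof -
      have a1: "\<xi> \<le> ?u (x + g * a)" using a by (simp add: S_def A_def)
      have "(m + a) mod n \<in> A" using a by (simp add: S_def mod_add_left_eq)
      then have a2: "\<xi> \<le> ?u (x + g * ((m + a) mod n))" by (simp add: A_def)
      \<comment> \<open>The point differs from its reduced position by (m + a) div n almost periods.
        There are at most \<open>k\<^sub>0\<close> of them, which moves \<open>?u\<close> by at most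
        \<open>k\<^sub>0\<close> / \<open>K\<^sub>1\<close> <= \<xi> / 2.\<close>
      have eq: "x + g * ((m + a) mod n) + (g * n) * ((m + a) div n) = x + g * a + g * m"
      proof -
        have "g * (m + a) = g * ((m + a) mod n + n * ((m + a) div n))" by simp
        then show ?thesis by (simp only: distrib_left)
      qed
      have dv: "\<bar>(m + a) div n\<bar> \<le> int k\<^sub>0"
      proof -
        have mI: "- (int k\<^sub>0 * n) \<le> m" "m \<le> int k\<^sub>0 * n" "0 \<le> a" "a < n"
          using m a S by (auto simp: Bad_def Oset_def subset_iff)
        have "(- int k\<^sub>0 * n) div n \<le> (m + a) div n" using mI n by (intro zdiv_mono1) auto
        moreover have "(m + a) div n \<le> (int k\<^sub>0 * n + (n - 1)) div n" using mI n by (intro zdiv_mono1) auto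
        moreover have "(int k\<^sub>0 * n + (n - 1)) div n = int k\<^sub>0"
          using n by (simp add: div_pos_pos_trivial)
        moreover have "(- int k\<^sub>0 * n) div n = - int k\<^sub>0" using n by (intro nonzero_mult_div_cancel_right) auto
        ultimately show ?thesis by (simp add: abs_le_iff)
      qed
      have "\<bar>?u (x + g * a + g * m) - ?u (x + g * ((m + a) mod n))\<bar> \<le> \<bar>real_of_int ((m + a) div n)\<bar> / K\<^sub>1"
        using u_shift[of "g * n" K\<^sub>1 "x + g * ((m + a) mod n)" "(m + a) div n"] unfolding eq .
      also have "\<dots> \<le> real k\<^sub>0 / K\<^sub>1"
      proof (rule divide_right_mono)
        have "\<bar>real_of_int ((m + a) div n)\<bar> = real_of_int \<bar>(m + a) div n\<bar>" by simp
        also have "\<dots> \<le> real_of_int (int k\<^sub>0)" using dv by (simp only: of_int_le_iff)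
        finally show "\<bar>real_of_int ((m + a) div n)\<bar> \<le> real k\<^sub>0" by simp
      qed simp
      also have "\<dots> \<le> \<xi> / 2" using K1 by (simp add: field_simps)
      finally have "\<xi> / 2 \<le> ?u (x + g * a + g * m)" using a2 by linarith
      then show ?thesis using a1 \<xi> by (intro mult_mono) auto
    qed
    have "\<xi> ^ 4 / 4 * n = \<xi>\<^sup>2 * n / 2 * (\<xi> * (\<xi> / 2))" by (simp add: power_numeral_reduce)
    also have "\<dots> \<le> card S * (\<xi> * (\<xi> / 2))" using cS \<xi> by (intro mult_right_mono) auto
    also have "\<dots> = (\<Sum>a\<in>S. \<xi> * (\<xi> / 2))" by simp
    also have "\<dots> \<le> (\<Sum>a\<in>S. ?u (x + g * a) * ?u (x + g * a + g * m))" by (rule sum_mono) (rule each)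
    also have "\<dots> \<le> (\<Sum>a\<in>{0..<n}. ?u (x + g * a) * ?u (x + g * a + g * m))"
      by (rule sum_mono2) (use S in \<open>auto simp: u_bounds\<close>)
    finally show ?thesis using n by (simp add: pos_le_divide_eq)
  qed
  have "card Bad * (\<xi> ^ 4 / 4) = (\<Sum>m\<in>Bad. \<xi> ^ 4 / 4)" by simp
  also have "\<dots> \<le> (\<Sum>m\<in>Bad. (\<Sum>\<rho>\<in>{0..<n}. ?u (x + g * \<rho>) * ?u (x + g * \<rho> + g * m)) / n)"
    by (rule sum_mono) (rule bad1)
  also have "\<dots> \<le> viol x" unfolding viol_def
    by (rule sum_mono2) (use finO n in \<open>auto simp: Bad_def u_bounds intro!: divide_nonneg_nonneg sum_nonneg\<close>)
  also have "\<dots> \<le> (\<xi> * n) * (\<xi> ^ 4 / 4)" using viol by (simp add: power_numeral_reduce algebra_simps)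
  finally have cBad: "card Bad \<le> \<xi> * n" using \<xi> by simp
  define \<Gamma> where "\<Gamma> = P - (\<lambda>m. m mod n) ` Bad"
  show ?thesis
  proof (intro exI[of _ \<Gamma>] conjI allI impI)
    show "\<Gamma> \<subseteq> {0..<n}" by (auto simp: \<Gamma>_def P_def)
    have finBad: "finite Bad" using finO by (simp add: Bad_def)
    have finP: "finite P" by (rule finite_residues[of P n]) (auto simp: P_def)
    have "card P \<le> card (\<Gamma> \<union> (\<lambda>m. m mod n) ` Bad)"
      by (rule card_mono) (use finBad finP in \<open>auto simp: \<Gamma>_def\<close>)
    also have "\<dots> \<le> card \<Gamma> + card ((\<lambda>m. m mod n) ` Bad)" by (rule card_Un_le)
    also have "\<dots> \<le> card \<Gamma> + card Bad" using card_image_le[OF finBad] by simp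
    finally have "real (card P) \<le> real (card \<Gamma>) + real (card Bad)" by linarith
    then show "min (real_of_int n) (2 * (av N f - 2 * \<xi>) * n) - 4 * \<xi> * n \<le> card \<Gamma>"
      using cP cBad unfolding d_def by linarith
    fix m assume m: "m mod n \<in> \<Gamma>" "\<bar>m\<bar> \<le> int k\<^sub>0 * n"
    show "\<theta> < p (g * m)"
    proof (rule ccontr)
      assume "\<not> ?thesis"
      then have "m \<in> Bad" using m by (auto simp: Oset_def Bad_def \<Gamma>_def)
      then show False using m by (auto simp: \<Gamma>_def)
    qed
  qed
qed

end

section \<open>Iterated popular sums\<close>

text \<open>Index \<open>j\<close> stands for \<open>j + 1\<close> summands, each added in at least \<open>t\<close> ways.\<close>

primrec sum_chain :: "int \<Rightarrow> int set \<Rightarrow> real \<Rightarrow> nat \<Rightarrow> int set" where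
  "sum_chain n B t 0 = B"
| "sum_chain n B t (Suc j) = {x\<in>{0..<n}. t \<le> rep n (sum_chain n B t j) B x}"

lemma sum_chain_subset: "B \<subseteq> {0..<n} \<Longrightarrow> sum_chain n B t j \<subseteq> {0..<n}"
  by (cases j) (auto simp: sum_chain.simps)

text \<open>Each round of \<open>popular_sums\<close> adds the density of \<open>B\<close>,
  saturating at 1, and loses 3 * \<xi> on top of the deficit \<epsilon> of \<open>B\<close>. The
  assumption on J keeps every stage above the size \<xi> * n that \<open>popular_sums\<close>
  requires.\<close>

lemma card_sum_chain:
  fixes n :: int and \<xi> \<beta> \<epsilon> :: real
  assumes n: "n > 0" and \<xi>: "0 < \<xi>" "\<xi> \<le> 1" "1 \<le> \<xi> * n"
    and rough: "\<And>h. h dvd n \<Longrightarrow> 1 < h \<Longrightarrow> 1 / \<xi> \<le> real_of_int h"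
    and B: "B \<subseteq> {0..<n}" "min 1 \<beta> * n - \<epsilon> * n \<le> card B"
    and \<epsilon>: "0 \<le> \<epsilon>" and \<beta>: "(real J + 1) * (\<epsilon> + 3 * \<xi>) + \<xi> \<le> min 1 \<beta>"
  shows "j \<le> J \<Longrightarrow> (min 1 ((real j + 1) * \<beta>) - (real j + 1) * (\<epsilon> + 3 * \<xi>)) * n \<le> card (sum_chain n B (\<xi>\<^sup>2 * n / 2) j)"
proof (induction j)
  case 0
  have "0 \<le> \<xi> * n" using \<xi> n by simp
  then show ?case using B(2) by (simp add: sum_chain.simps algebra_simps)
next
  case (Suc j)
  let ?S = "sum_chain n B (\<xi>\<^sup>2 * n / 2) j"
  have \<epsilon>': "0 \<le> \<epsilon> + 3 * \<xi>" using \<epsilon> \<xi> by simp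
  have b0: "\<beta> \<ge> 0"
  proof -
    have "0 \<le> (real J + 1) * (\<epsilon> + 3 * \<xi>)" using \<epsilon>' by simp
    then show ?thesis using \<beta> \<xi> by simp
  qed
  have j: "(real j + 1) * (\<epsilon> + 3 * \<xi>) \<le> (real J + 1) * (\<epsilon> + 3 * \<xi>)"
    using Suc.prems \<epsilon>' by (intro mult_right_mono) auto
  have mono\<beta>: "min 1 \<beta> \<le> min 1 ((real j + 1) * \<beta>)"
    using b0 mult_nonneg_nonneg[of "real j" \<beta>] by (intro min.mono) (auto simp: algebra_simps)
  have S\<xi>: "\<xi> * n \<le> card ?S"
  proof -
    have "\<xi> \<le> min 1 ((real j + 1) * \<beta>) - (real j + 1) * (\<epsilon> + 3 * \<xi>)" using \<beta> j mono\<beta> by linarith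
    then have "\<xi> * n \<le> (min 1 ((real j + 1) * \<beta>) - (real j + 1) * (\<epsilon> + 3 * \<xi>)) * n"
      using n by (intro mult_right_mono) auto
    then show ?thesis using Suc by simp
  qed
  have B\<xi>: "\<xi> * n \<le> card B"
  proof -
    have "(real J + 1) * (\<epsilon> + 3 * \<xi>) \<ge> 1 * (\<epsilon> + 3 * \<xi>)" using \<epsilon>' by (intro mult_right_mono) auto
    then have "\<epsilon> + 3 * \<xi> + \<xi> \<le> min 1 \<beta>" by (intro order_trans[OF _ \<beta>]) simp
    then have "\<xi> \<le> min 1 \<beta> - \<epsilon>" using \<xi>(1) by linarith
    then have "\<xi> * n \<le> (min 1 \<beta> - \<epsilon>) * n" using n by (intro mult_right_mono) auto
    then show ?thesis using B(2) by (simp add: algebra_simps)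
  qed
  have pop: "min (real_of_int n) (real (card ?S) + card B) - 3 * \<xi> * n \<le> card (sum_chain n B (\<xi>\<^sup>2 * n / 2) (Suc j))"
    unfolding sum_chain.simps
    by (rule popular_sums[OF n \<xi> rough sum_chain_subset[OF B(1)] S\<xi> B(1) B\<xi>])
  have IH: "(min 1 ((real j + 1) * \<beta>) - (real j + 1) * (\<epsilon> + 3 * \<xi>)) * n \<le> card ?S" using Suc by simp
  define a where "a = min 1 ((real j + 1) * \<beta>) - (real j + 1) * (\<epsilon> + 3 * \<xi>)"
  define b where "b = min 1 \<beta> - \<epsilon>"
  have "(min 1 (a + b) - 3 * \<xi>) * n \<le> min (real_of_int n) (real (card ?S) + card B) - 3 * \<xi> * n"
  proof -
    have ab: "a * n \<le> card ?S" "b * n \<le> card B" using IH B(2) by (auto simp: a_def b_def algebra_simps)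
    have "min 1 (a + b) * n \<le> 1 * real_of_int n" by (rule mult_right_mono) (use n in auto)
    moreover have "min 1 (a + b) * n \<le> (a + b) * n" by (rule mult_right_mono) (use n in auto)
    ultimately have "min 1 (a + b) * n \<le> min (real_of_int n) (real (card ?S) + card B)"
      using ab by (simp add: algebra_simps)
    then show ?thesis by (simp add: algebra_simps)
  qed
  moreover have "min 1 ((real (Suc j) + 1) * \<beta>) - (real (Suc j) + 1) * (\<epsilon> + 3 * \<xi>) \<le> min 1 (a + b) - 3 * \<xi>"
  proof -
    have e1: "(real (Suc j) + 1) * (\<epsilon> + 3 * \<xi>) = (real j + 1) * (\<epsilon> + 3 * \<xi>) + \<epsilon> + 3 * \<xi>"
      by (simp add: algebra_simps)
    have e2: "(real (Suc j) + 1) * \<beta> = (real j + 1) * \<beta> + \<beta>" by (simp add: algebra_simps)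
    have "(real j + 1) * (\<epsilon> + 3 * \<xi>) \<ge> 0" using \<epsilon>' by simp
    moreover have "(real j + 1) * \<beta> \<ge> 0" using b0 by simp
    moreover have "min 1 (w + \<beta>) - (q + \<epsilon> + 3 * \<xi>) \<le> min 1 (min 1 w - q + (min 1 \<beta> - \<epsilon>)) - 3 * \<xi>"
      if "q \<ge> 0" "w \<ge> 0" for q w :: real
      using that b0 \<epsilon> unfolding min_def by (auto split: if_splits)
    ultimately show ?thesis unfolding a_def b_def e1 e2 by blast
  qed
  then have "(min 1 ((real (Suc j) + 1) * \<beta>) - (real (Suc j) + 1) * (\<epsilon> + 3 * \<xi>)) * n \<le> (min 1 (a + b) - 3 * \<xi>) * n"
    using n by (intro mult_right_mono) auto
  ultimately show ?case using pop by linarith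
qed

section \<open>From popular sums modulo n to a solution in distinct integers\<close>

lemma restricted_sum_freeD:
  assumes "restricted_sum_free k l S" "A \<subseteq> S" "finite A" "card A = k" "B \<subseteq> S" "finite B" "card B = l"
  shows "\<Sum>A \<noteq> \<Sum>B"
proof -
  obtain a b where a: "bij_betw a {1..k} A" and b: "bij_betw b {1..l} B"
    using ex_bij_betw_nat_finite_1[OF assms(3)] ex_bij_betw_nat_finite_1[OF assms(6)] assms(4,7) by metis
  have "(\<Sum>i=1..k. a i) \<noteq> (\<Sum>j=1..l. b j)"
    using assms(1) a b assms(2,5) unfolding restricted_sum_free_def bij_betw_def by metis
  then show ?thesis
    using sum.reindex_bij_betw[OF a, of "\<lambda>x. x"] sum.reindex_bij_betw[OF b, of "\<lambda>x. x"] by simp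
qed

lemma sum_list_bounds:
  fixes xs :: "int list"
  assumes "\<And>x. x \<in> set xs \<Longrightarrow> 0 \<le> x \<and> x \<le> b"
  shows "0 \<le> sum_list xs \<and> sum_list xs \<le> int (length xs) * b"
  using assms
proof (induction xs)
  case (Cons x xs)
  then have "0 \<le> sum_list xs \<and> sum_list xs \<le> int (length xs) * b" "0 \<le> x \<and> x \<le> b" by auto
  then show ?case by (simp add: algebra_simps)
qed simp

lemma sum_chain_list:
  assumes "B \<subseteq> {0..<n}" "t > 0" "x \<in> sum_chain n B t j"
  shows "\<exists>zs. length zs = Suc j \<and> set zs \<subseteq> B \<and> sum_list zs mod n = x"
  using assms(3)
proof (induction j arbitrary: x)
  case 0
  then show ?case using assms(1) by (intro exI[of _ "[x]"]) (auto simp: sum_chain.simps)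
next
  case (Suc j)
  then have "rep n (sum_chain n B t j) B x > 0" "0 \<le> x" "x < n" using assms(2) by (auto simp: sum_chain.simps)
  then obtain b where b: "b \<in> B" "(x - b) mod n \<in> sum_chain n B t j"
    unfolding rep_def by (auto simp: card_gt_0_iff)
  from Suc.IH[OF b(2)] obtain zs where zs: "length zs = Suc j" "set zs \<subseteq> B" "sum_list zs mod n = (x - b) mod n" by auto
  have "(b + sum_list zs) mod n = x"
    using zs(3) \<open>0 \<le> x\<close> \<open>x < n\<close> mod_add_cong[of b n b "sum_list zs" "x - b"] by simp
  then show ?case using zs b by (intro exI[of _ "b # zs"]) auto
qed

text \<open>Summands are chosen greedily, each from at least t candidates. The last two, b and x -
  b, are chosen together: b must avoid \<open>Av\<close>, x - \<open>Av\<close> and the solution of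
  2 * b = x, at most one since n is odd; that is at most 2 * |Av| + 1 values. Each earlier choice
  raises |Av| by one and lowers \<open>j\<close> by one, which preserves the bound on t.\<close>

lemma sum_chain_distinct:
  fixes n :: int and t :: real
  assumes n: "odd n" "n > 0" and B: "B \<subseteq> {0..<n}" and x: "x \<in> sum_chain n B t (Suc j)"
    and Av: "finite Av" "2 * (card Av + j) + 3 \<le> t"
  shows "\<exists>zs. length zs = Suc (Suc j) \<and> distinct zs \<and> set zs \<subseteq> B - Av \<and> sum_list zs mod n = x"
  using x Av
proof (induction j arbitrary: x Av)
  case 0
  note finB = finite_residues[OF B]
  define S where "S = {b \<in> B. (x - b) mod n \<in> B}"
  have finS: "finite S" using finB by (simp add: S_def)
  have x: "0 \<le> x" "x < n" "t \<le> card S" using 0 by (auto simp: sum_chain.simps rep_def S_def)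
  define E1 E2 where "E1 = (\<lambda>a. (x - a) mod n) ` Av" and "E2 = {b \<in> B. (x - b) mod n = b}"
  have inv: "(x - (x - b) mod n) mod n = b" if "b \<in> B" for b
    using that B by (auto simp: mod_diff_right_eq)
  have E2: "card E2 \<le> 1"
  proof -
    have "b = b'" if "b \<in> E2" "b' \<in> E2" for b b'
    proof -
      have bb: "0 \<le> b" "b < n" "0 \<le> b'" "b' < n" using that B by (auto simp: E2_def)
      have "(x - b) mod n = b mod n" "(x - b') mod n = b' mod n" using that bb by (auto simp: E2_def)
      then have "n dvd (x - b - b)" "n dvd (x - b' - b')" by (simp_all only: mod_eq_dvd_iff)
      then have "n dvd (x - b - b) - (x - b' - b')" by (rule dvd_diff)
      then have "n dvd 2 * (b' - b)" by (simp add: algebra_simps)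
      moreover have "coprime n 2" using n(1) by simp
      ultimately have "n dvd b' - b" by (simp only: coprime_dvd_mult_right_iff)
      then have "b' mod n = b mod n" by (simp only: mod_eq_dvd_iff)
      then show ?thesis using bb by simp
    qed
    then have "E2 \<subseteq> {} \<or> (\<exists>e. E2 \<subseteq> {e})" by blast
    then show ?thesis using card_mono[of "{_}" E2] by fastforce
  qed
  have "card (Av \<union> E1 \<union> E2) \<le> card Av + card E1 + card E2"
    by (meson add_le_mono1 card_Un_le le_trans)
  also have "card E1 \<le> card Av" unfolding E1_def by (rule card_image_le[OF 0(2)])
  finally have "card (Av \<union> E1 \<union> E2) \<le> 2 * card Av + 1" using E2 by linarith
  then have "real (card (Av \<union> E1 \<union> E2)) \<le> real (2 * card Av + 1)" by (simp only: of_nat_le_iff)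
  then have "real (card (Av \<union> E1 \<union> E2)) < t" using 0(3) by simp
  then have "card (Av \<union> E1 \<union> E2) < card S" using x(3) by linarith
  moreover have "finite (Av \<union> E1 \<union> E2)" using 0(2) finB by (simp add: E1_def E2_def)
  ultimately have "\<not> S \<subseteq> Av \<union> E1 \<union> E2" by (meson card_mono not_le)
  then obtain b where b: "b \<in> S" "b \<notin> Av" "b \<notin> E1" "b \<notin> E2" by auto
  let ?c = "(x - b) mod n"
  have "?c \<noteq> b" using b by (auto simp: E2_def S_def)
  moreover have "?c \<notin> Av" using b(3) inv[of b] b(1) by (force simp: E1_def S_def)
  moreover have "(b + ?c) mod n = x" using x by (simp add: mod_add_right_eq)
  ultimately show ?case using b by (intro exI[of _ "[b, ?c]"]) (auto simp: S_def)
next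
  case (Suc j)
  define S where "S = {b \<in> B. (x - b) mod n \<in> sum_chain n B t (Suc j)}"
  have x: "0 \<le> x" "x < n" "t \<le> card S" using Suc.prems(1)
    unfolding sum_chain.simps(2)[of n B t "Suc j"] by (auto simp: rep_def S_def)
  have "real (card Av) < t" using Suc.prems(3) by simp
  then have "card Av < card S" using x(3) by linarith
  then have "\<not> S \<subseteq> Av" using Suc.prems(2) by (meson card_mono not_le)
  then obtain b where b: "b \<in> B" "(x - b) mod n \<in> sum_chain n B t (Suc j)" "b \<notin> Av" by (auto simp: S_def)
  have "\<exists>zs. length zs = Suc (Suc j) \<and> distinct zs \<and> set zs \<subseteq> B - insert b Av \<and> sum_list zs mod n = (x - b) mod n"
    by (rule Suc.IH[OF b(2)]) (use Suc.prems b in \<open>auto simp: card_insert_if\<close>)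
  then obtain zs where zs: "length zs = Suc (Suc j)" "distinct zs" "set zs \<subseteq> B - insert b Av" "sum_list zs mod n = (x - b) mod n" by auto
  have "(b + sum_list zs) mod n = x"
    using zs(4) x mod_add_cong[of b n b "sum_list zs" "x - b"] by simp
  then show ?case using zs b by (intro exI[of _ "b # zs"]) auto
qed

context cyclic_indicator begin

text \<open>More than \<theta> * N positions realise each difference. Excluded are at most 2 * W
  positions that might wrap around, and those that repeat an earlier a or b or hit
  \<open>Bv\<close>. A value may occur in both \<open>as\<close> and \<open>bs\<close>, since they
  end up on opposite sides of the equation.\<close>

lemma disjoint_differences:
  fixes X :: "nat set" and g W :: int and \<theta> :: real
  assumes f: "\<And>x. f x = of_bool (nat (x mod N + 1) \<in> X)"
  shows "(\<And>m. m \<in> set ms \<Longrightarrow> \<theta> < p (g * m) \<and> \<bar>g * m\<bar> \<le> W) \<Longrightarrow> finite Bv \<Longrightarrow>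
    2 * W + card Bv + 2 * length ms \<le> \<theta> * N \<Longrightarrow>
    \<exists>as bs. length as = length ms \<and> length bs = length ms \<and> distinct as \<and> distinct bs \<and> set bs \<inter> Bv = {} \<and>
      (\<forall>a\<in>set as \<union> set bs. 1 \<le> a \<and> nat a \<in> X) \<and> sum_list as - sum_list bs = g * sum_list ms"
proof (induction ms)
  case Nil
  show ?case by (intro exI[of _ "[]"]) auto
next
  case (Cons m ms)
  have "\<exists>as bs. length as = length ms \<and> length bs = length ms \<and> distinct as \<and> distinct bs \<and> set bs \<inter> Bv = {} \<and>
      (\<forall>a\<in>set as \<union> set bs. 1 \<le> a \<and> nat a \<in> X) \<and> sum_list as - sum_list bs = g * sum_list ms"
    by (rule Cons.IH) (use Cons.prems in auto)
  then obtain as bs where ab: "length as = length ms" "length bs = length ms" "distinct as" "distinct bs" "set bs \<inter> Bv = {}"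
      "\<forall>a\<in>set as \<union> set bs. 1 \<le> a \<and> nat a \<in> X" "sum_list as - sum_list bs = g * sum_list ms" by blast
  have m: "\<theta> < p (g * m)" "\<bar>g * m\<bar> \<le> W" using Cons.prems(1)[of m] by auto
  define S where "S = {x\<in>{0..<N}. f x = 1 \<and> f (x + g * m) = 1}"
  have "p (g * m) * N = (\<Sum>x\<in>{0..<N}. f x * f (x + g * m))" using N by (simp add: p_def av_def)
  also have "\<dots> = (\<Sum>x\<in>{0..<N}. if x \<in> S then 1 else 0)"
  proof (rule sum.cong[OF refl])
    fix x assume "x \<in> {0..<N}"
    then show "f x * f (x + g * m) = (if x \<in> S then 1 else 0)"
      using f01[of x] f01[of "x + g * m"] by (auto simp: S_def)
  qed
  also have "\<dots> = card S"
  proof -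
    have "{0..<N} \<inter> S = S" by (auto simp: S_def)
    then show ?thesis by (simp add: sum.If_cases)
  qed
  finally have "\<theta> * N < card S" using m(1) N by (metis mult_strict_right_mono of_int_0_less_iff)
  then have big: "2 * W + card Bv + 2 * length (m # ms) < card S" using Cons.prems(3) by linarith
  define E1 where "E1 = {N - \<bar>g * m\<bar>..<N} \<union> {0..<\<bar>g * m\<bar>}"
  define E2 where "E2 = (\<lambda>b. b - 1) ` (Bv \<union> set bs)"
  define E3 where "E3 = (\<lambda>a. a - 1 - g * m) ` set as"
  have fin: "finite E1" "finite E2" "finite E3" using Cons.prems(2) by (auto simp: E1_def E2_def E3_def)
  have "int (card E1) \<le> 2 * \<bar>g * m\<bar>"
    using card_Un_le[of "{N - \<bar>g * m\<bar>..<N}" "{0..<\<bar>g * m\<bar>}"] by (simp add: E1_def)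
  then have c1: "int (card E1) \<le> 2 * W" using m(2) by linarith
  have "card E2 \<le> card (Bv \<union> set bs)" unfolding E2_def by (rule card_image_le) (use Cons.prems(2) in simp)
  also have "\<dots> \<le> card Bv + card (set bs)" by (rule card_Un_le)
  finally have c2: "card E2 \<le> card Bv + length ms" using card_length[of bs] ab(2) by linarith
  have c3: "card E3 \<le> length ms" using card_image_le[of "set as" "\<lambda>a. a - 1 - g * m"] card_length[of as] ab(1)
    unfolding E3_def by simp
  have "card (E1 \<union> E2 \<union> E3) \<le> card E1 + card E2 + card E3"
    by (meson add_le_mono1 card_Un_le le_trans)
  then have "int (card (E1 \<union> E2 \<union> E3)) \<le> int (card E1) + int (card E2) + int (card E3)" by linarith
  moreover have "int (card E2) \<le> int (card Bv) + int (length ms)" "int (card E3) \<le> int (length ms)"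
    using c2 c3 by linarith+
  moreover have "int (2 * length (m # ms)) = 2 * int (length ms) + 2" by simp
  ultimately have "int (card (E1 \<union> E2 \<union> E3)) < int (card S)" using c1 big by linarith
  then have "card (E1 \<union> E2 \<union> E3) < card S" by simp
  then have "\<not> S \<subseteq> E1 \<union> E2 \<union> E3" using fin by (meson card_mono finite_UnI not_le)
  then obtain x where x: "x \<in> S" "x \<notin> E1" "x \<notin> E2" "x \<notin> E3" by auto
  have xN: "0 \<le> x" "x < N" "f x = 1" "f (x + g * m) = 1" using x(1) by (auto simp: S_def)
  have xg: "0 \<le> x + g * m" "x + g * m < N" using x(2) xN by (auto simp: E1_def)
  \<comment> \<open>Position x of the cycle stands for the element x + 1 of the box.\<close>
  define b a where "b = x + 1" and "a = x + g * m + 1"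
  have "nat b \<in> X" using xN f[of x] by (auto simp: b_def split: if_splits)
  moreover have "nat a \<in> X" using xN(4) xg f[of "x + g * m"] by (auto simp: a_def split: if_splits)
  moreover have "1 \<le> a" "1 \<le> b" using xN xg by (auto simp: a_def b_def)
  moreover have "b \<notin> Bv \<union> set bs"
  proof
    assume "b \<in> Bv \<union> set bs"
    then have "b - 1 \<in> E2" unfolding E2_def by (rule imageI)
    then show False using x(3) by (simp add: b_def)
  qed
  moreover have "a \<notin> set as"
  proof
    assume "a \<in> set as"
    then have "a - 1 - g * m \<in> E3" unfolding E3_def by (rule imageI)
    then show False using x(4) by (simp add: a_def)
  qed
  moreover have "a - b = g * m" by (simp add: a_def b_def)
  ultimately show ?case using ab
    by (intro exI[of _ "a # as"] exI[of _ "b # bs"]) (auto simp: algebra_simps)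
qed

text \<open>The solution has the form: sum of \<open>as\<close> = sum of \<open>bs\<close> + sum of
  \<open>Bv\<close>. The l differences between \<open>as\<close> and \<open>bs\<close> come from the
  long box, the r elements of \<open>Bv\<close> from the box of step \<open>g\<close>. Their
  residues meet because r * c + 2 * l * c exceeds 1 by at least 20 * k * \<xi>, more than all
  losses.\<close>

lemma no_dense_scales:
  fixes X :: "nat set" and g n M :: int and r l K\<^sub>1 L :: nat and \<xi> \<theta> c :: real
  defines "k \<equiv> r + l"
  assumes rsf: "restricted_sum_free k l X" and rl: "r > 0" "l > 0"
    and f: "\<And>x. f x = of_bool (nat (x mod N + 1) \<in> X)"
    and n: "n > 0" and g: "g > 0" and M: "(int k + int K\<^sub>1) * n \<le> M" and L: "4 * M \<le> int L"
    and \<xi>: "0 < \<xi>" "1 \<le> \<xi> * n" "2 * real r + 3 \<le> \<xi>\<^sup>2 * n / 2" and K1: "2 * real k \<le> \<xi> * K\<^sub>1" "K\<^sub>1 > 0"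
    and rough: "\<And>h. h dvd n \<Longrightarrow> 1 < h \<Longrightarrow> 1 / \<xi> \<le> real_of_int h"
    and \<theta>: "0 \<le> \<theta>" "2 * real k * g * n + 2 * real k \<le> \<theta> * N"
    and err: "\<theta> * (2 * real k * n + 1) + real K\<^sub>1 * sqrt ((2 * real_of_int M + 1) * (2 * real L * D g L (g * n)))
      \<le> \<xi> ^ 6 / 8 * n"
    and c: "20 * real k * \<xi> \<le> c" "c \<le> 1" "1 + 20 * real k * \<xi> \<le> (real k + real l) * c"
    and dense: "c \<le> av N f" "c * n - \<xi> * n \<le> card {\<zeta>\<in>{1..n}. nat (g * \<zeta>) \<in> X}"
  shows False
proof -
  have k2: "real k \<ge> 2" "real k = real r + real l" using rl by (auto simp: k_def)
  have \<xi>40: "40 * \<xi> \<le> 1"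
  proof -
    have "20 * 2 * \<xi> \<le> 20 * real k * \<xi>" using k2 \<xi> by (intro mult_right_mono) auto
    then show ?thesis using c by linarith
  qed
  then have \<xi>1: "\<xi> \<le> 1" by simp
  have odd: "odd n"
  proof
    assume "even n"
    then have "1 / \<xi> \<le> 2" using rough[of 2] by simp
    then show False using \<xi>40 \<xi>(1) by (simp add: field_simps)
  qed
  have kr: "real r * \<xi> \<le> real k * \<xi>" "real l * \<xi> \<le> real k * \<xi>" "\<xi> \<le> real k * \<xi>"
  proof -
    show "real r * \<xi> \<le> real k * \<xi>" "real l * \<xi> \<le> real k * \<xi>" using \<xi>(1) by (auto simp: k_def)
    have "1 * \<xi> \<le> real k * \<xi>" using k2 \<xi>(1) by (intro mult_right_mono) auto
    then show "\<xi> \<le> real k * \<xi>" by simp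
  qed
  have c20: "20 * (real k * \<xi>) \<le> c" using c(1) by simp
  have d3: "3 * \<xi> \<le> av N f" using c20 kr dense(1) \<xi>(1) by linarith
  obtain \<Gamma> where \<Gamma>: "\<Gamma> \<subseteq> {0..<n}" "min (real_of_int n) (2 * (av N f - 2 * \<xi>) * n) - 4 * \<xi> * n \<le> card \<Gamma>"
    and \<Gamma>p: "\<And>m. m mod n \<in> \<Gamma> \<Longrightarrow> \<bar>m\<bar> \<le> int k * n \<Longrightarrow> \<theta> < p (g * m)"
    using good_differences[OF n M L \<xi>(1) \<xi>1 \<xi>(2) K1 rough \<theta>(1) err d3] by blast
  \<comment> \<open>Shifted to start at 0. Each of the r summands is thus 1 too small, which the
    translation by - r in \<open>S\<close> compensates.\<close>
  define Z where "Z = {\<zeta>\<in>{0..<n}. nat (g * (\<zeta> + 1)) \<in> X}"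
  have Z: "Z \<subseteq> {0..<n}" by (auto simp: Z_def)
  have "bij_betw (\<lambda>\<zeta>. \<zeta> + 1) Z {\<zeta>\<in>{1..n}. nat (g * \<zeta>) \<in> X}"
    by (rule bij_betw_byWitness[where f' = "\<lambda>\<zeta>. \<zeta> - 1"]) (auto simp: Z_def)
  then have cZ: "c * n - \<xi> * n \<le> card Z" using dense(2) bij_betw_same_card by metis
  let ?t = "\<xi>\<^sup>2 * n / 2"
  define CZ where "CZ = sum_chain n Z ?t (r - 1)"
  define C\<Gamma> where "C\<Gamma> = sum_chain n \<Gamma> ?t (l - 1)"
  have CZ: "(min 1 (real r * c) - real r * (\<xi> + 3 * \<xi>)) * n \<le> card CZ"
  proof -
    have rr: "real (r - 1) + 1 = real r" using rl by simp
    have "(min 1 ((real (r - 1) + 1) * c) - (real (r - 1) + 1) * (\<xi> + 3 * \<xi>)) * n \<le> card CZ"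
      unfolding CZ_def
    proof (rule card_sum_chain[OF n \<xi>(1) \<xi>1 \<xi>(2) rough Z, where J = "r - 1"])
      show "min 1 c * n - \<xi> * n \<le> card Z" using cZ c(2) by (simp add: min_absorb2)
      show "(real (r - 1) + 1) * (\<xi> + 3 * \<xi>) + \<xi> \<le> min 1 c"
      proof -
        have "real r * (\<xi> + 3 * \<xi>) = 4 * (real r * \<xi>)" by simp
        then have "real r * (\<xi> + 3 * \<xi>) + \<xi> \<le> c" using c20 kr \<xi>(1) by linarith
        then show ?thesis unfolding rr using c(2) by simp
      qed
    qed (use \<xi> in auto)
    then show ?thesis unfolding rr .
  qed
  have C\<Gamma>: "(min 1 (real l * (2 * c)) - real l * (8 * \<xi> + 3 * \<xi>)) * n \<le> card C\<Gamma>"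
  proof -
    have ll: "real (l - 1) + 1 = real l" using rl by simp
    have "(min 1 ((real (l - 1) + 1) * (2 * c)) - (real (l - 1) + 1) * (8 * \<xi> + 3 * \<xi>)) * n \<le> card C\<Gamma>"
      unfolding C\<Gamma>_def
    proof (rule card_sum_chain[OF n \<xi>(1) \<xi>1 \<xi>(2) rough \<Gamma>(1), where J = "l - 1"])
      \<comment> \<open>The deficit 8 * \<xi> of \<Gamma> consists of 2 * 2 * \<xi> in the density
        and 4 * \<xi> from the popular differences.\<close>
      have "(min 1 (2 * c) - 4 * \<xi>) * n \<le> min (real_of_int n) (2 * (av N f - 2 * \<xi>) * n)"
      proof (rule min.boundedI)
        have "(min 1 (2 * c) - 4 * \<xi>) * n \<le> 1 * real_of_int n"
          using n \<xi>(1) by (intro mult_right_mono) auto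
        then show "(min 1 (2 * c) - 4 * \<xi>) * n \<le> real_of_int n" by simp
        show "(min 1 (2 * c) - 4 * \<xi>) * n \<le> 2 * (av N f - 2 * \<xi>) * n"
          using n dense(1) by (intro mult_right_mono) auto
      qed
      then show "min 1 (2 * c) * n - 8 * \<xi> * n \<le> card \<Gamma>" using \<Gamma>(2) unfolding left_diff_distrib by linarith
      show "(real (l - 1) + 1) * (8 * \<xi> + 3 * \<xi>) + \<xi> \<le> min 1 (2 * c)"
      proof -
        have "real l * (8 * \<xi> + 3 * \<xi>) = 11 * (real l * \<xi>)" by simp
        then have "real l * (8 * \<xi> + 3 * \<xi>) + \<xi> \<le> c" "real l * (8 * \<xi> + 3 * \<xi>) + \<xi> \<le> 2 * c"
          using c20 kr \<xi>(1) by linarith+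
        then show ?thesis unfolding ll using c(2) by simp
      qed
    qed (use \<xi> in auto)
    then show ?thesis unfolding ll .
  qed
  \<comment> \<open>The losses 4 * r * \<xi> and 11 * l * \<xi> are together at most 15 * k *
    \<xi>.\<close>
  have "1 < (min 1 (real r * c) - real r * (\<xi> + 3 * \<xi>)) + (min 1 (real l * (2 * c)) - real l * (8 * \<xi> + 3 * \<xi>))"
  proof -
    have c0: "c > 0" using c20 kr \<xi>(1) by linarith
    have rc: "c \<le> real r * c" "c \<le> real l * (2 * c)"
      using rl c0 mult_right_mono[of 1 "real r" c] mult_right_mono[of 1 "real l" "2 * c"] by auto
    have tot: "1 + 20 * (real k * \<xi>) \<le> real r * c + real l * (2 * c)"
      using c(3) by (simp add: k2(2) algebra_simps)
    have "min 1 (real r * c) + min 1 (real l * (2 * c)) \<ge> 1 + 20 * (real k * \<xi>)"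
    proof -
      have "1 + e \<le> min 1 P + min 1 Q" if "1 + e \<le> P + Q" "c \<le> P" "c \<le> Q" "e \<le> c" for P Q e
        using that c(2) c0 unfolding min_def by (auto split: if_splits)
      then show ?thesis using tot rc c20 by blast
    qed
    moreover have "real r * (\<xi> + 3 * \<xi>) = 4 * (real r * \<xi>)" "real l * (8 * \<xi> + 3 * \<xi>) = 11 * (real l * \<xi>)"
      by simp_all
    ultimately show ?thesis using kr \<xi>(1) by linarith
  qed
  then have "1 * real_of_int n < ((min 1 (real r * c) - real r * (\<xi> + 3 * \<xi>)) + (min 1 (real l * (2 * c)) - real l * (8 * \<xi> + 3 * \<xi>))) * n"
    using n by (intro mult_strict_right_mono) auto
  then have big: "real_of_int n < real (card CZ) + real (card C\<Gamma>)" using CZ C\<Gamma> by (simp add: algebra_simps)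
  define S where "S = shift n (- int r) C\<Gamma>"
  have CZs: "CZ \<subseteq> {0..<n}" and C\<Gamma>s: "C\<Gamma> \<subseteq> {0..<n}" unfolding CZ_def C\<Gamma>_def by (rule sum_chain_subset, fact)+
  have S: "S \<subseteq> {0..<n}" "card S = card C\<Gamma>" unfolding S_def using shift_subset[OF n] card_shift[OF n C\<Gamma>s] by auto
  have "CZ \<inter> S \<noteq> {}"
  proof
    assume "CZ \<inter> S = {}"
    then have "card CZ + card S = card (CZ \<union> S)"
      using card_Un_disjoint finite_residues[OF CZs] finite_residues[OF S(1)] by metis
    also have "\<dots> \<le> card {0..<n}" by (rule card_mono) (use CZs S in auto)
    finally have "card CZ + card C\<Gamma> \<le> nat n" using S by simp
    then show False using big n by linarith
  qed
  then obtain y where y: "(y - int r) mod n \<in> CZ" "y \<in> C\<Gamma>" by (auto simp: S_def shift_def)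
  obtain \<gamma>s where \<gamma>s: "length \<gamma>s = l" "set \<gamma>s \<subseteq> \<Gamma>" "sum_list \<gamma>s mod n = y"
    using sum_chain_list[OF \<Gamma>(1) _ y(2)[unfolded C\<Gamma>_def]] \<xi>(1) n rl by auto
  obtain \<zeta>s where \<zeta>s: "length \<zeta>s = r" "distinct \<zeta>s" "set \<zeta>s \<subseteq> Z" "sum_list \<zeta>s mod n = (y - int r) mod n"
  proof (cases "r = 1")
    case True
    then show ?thesis using that[of "[(y - int r) mod n]"] y(1) by (simp add: CZ_def sum_chain.simps)
  next
    case False
    then obtain j where j: "r = Suc (Suc j)" using rl by (metis Suc_pred' One_nat_def not_gr_zero)
    then have "(y - int r) mod n \<in> sum_chain n Z ?t (Suc j)" using y(1) by (simp add: CZ_def)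
    from sum_chain_distinct[OF odd n Z this, of "{}"] show ?thesis using that \<xi>(3) j by auto
  qed
  have "n dvd (sum_list \<zeta>s + int r - sum_list \<gamma>s)"
  proof -
    have "sum_list \<zeta>s mod n = (sum_list \<gamma>s - int r) mod n"
      unfolding \<zeta>s(4) \<gamma>s(3)[symmetric] by (simp add: mod_diff_left_eq)
    then have "n dvd (sum_list \<zeta>s - (sum_list \<gamma>s - int r))" by (simp only: mod_eq_dvd_iff)
    then show ?thesis by (simp add: algebra_simps)
  qed
  obtain \<gamma>1 \<gamma>r where \<gamma>1: "\<gamma>s = \<gamma>1 # \<gamma>r" using \<gamma>s(1) rl by (cases \<gamma>s) auto
  \<comment> \<open>The congruence becomes an equation: the first difference is replaced by the
    integer that makes the sum exact. It lies in the same class modulo n and has size at most k * n,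
    so its multiple by \<open>g\<close> is still a popular difference.\<close>
  define m1 where "m1 = sum_list \<zeta>s + int r - sum_list \<gamma>r"
  have m1mod: "m1 mod n = \<gamma>1"
  proof -
    have "n dvd (m1 - \<gamma>1)" using \<open>n dvd _\<close> by (simp add: m1_def \<gamma>1 algebra_simps)
    then have "m1 mod n = \<gamma>1 mod n" by (simp only: mod_eq_dvd_iff)
    then show ?thesis using \<gamma>s(2) \<Gamma>(1) \<gamma>1 by (auto simp: subset_iff)
  qed
  have \<zeta>b: "0 \<le> sum_list \<zeta>s \<and> sum_list \<zeta>s \<le> int r * (n - 1)"
    using sum_list_bounds[of \<zeta>s "n - 1"] \<zeta>s Z by (fastforce simp: subset_iff)
  have \<gamma>b: "0 \<le> sum_list \<gamma>r \<and> sum_list \<gamma>r \<le> int l * n"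
  proof -
    have "0 \<le> sum_list \<gamma>r \<and> sum_list \<gamma>r \<le> int (length \<gamma>r) * n"
      by (rule sum_list_bounds) (use \<gamma>s \<gamma>1 \<Gamma>(1) in \<open>fastforce simp: subset_iff\<close>)
    moreover have "int (length \<gamma>r) * n \<le> int l * n" using \<gamma>s(1) \<gamma>1 n by (intro mult_right_mono) auto
    ultimately show ?thesis by linarith
  qed
  have kn: "int k * n = int r * n + int l * n" by (simp add: k_def algebra_simps)
  have rn: "int r * (n - 1) = int r * n - int r" by (simp add: algebra_simps)
  have "0 \<le> int r * n" "0 \<le> int l * n" using n by auto
  then have m1b: "\<bar>m1\<bar> \<le> int k * n" using \<zeta>b \<gamma>b kn rn unfolding m1_def by linarith
  define ms where "ms = m1 # \<gamma>r"
  have ms: "length ms = l" "sum_list ms = sum_list \<zeta>s + int r" using \<gamma>s(1) by (auto simp: ms_def \<gamma>1 m1_def)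
  have msp: "\<theta> < p (g * m) \<and> \<bar>g * m\<bar> \<le> int k * n * g" if m: "m \<in> set ms" for m
  proof -
    have "m mod n \<in> \<Gamma> \<and> \<bar>m\<bar> \<le> int k * n"
    proof (cases "m = m1")
      case True then show ?thesis using m1mod m1b \<gamma>s(2) \<gamma>1 by auto
    next
      case False
      then have "m \<in> \<Gamma>" using m \<gamma>s(2) \<gamma>1 by (auto simp: ms_def)
      moreover from this have "0 \<le> m" "m < n" using \<Gamma>(1) by auto
      moreover have "1 * n \<le> int k * n" by (rule mult_right_mono) (use rl n in \<open>auto simp: k_def\<close>)
      ultimately have "\<bar>m\<bar> \<le> int k * n" "m mod n \<in> \<Gamma>" by (linarith, simp)
      then show ?thesis by simp
    qed
    moreover have "\<bar>g * m\<bar> = \<bar>m\<bar> * g" using g by (simp add: abs_mult mult.commute)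
    ultimately show ?thesis using \<Gamma>p g by (auto intro: mult_right_mono)
  qed
  define Bv where "Bv = (\<lambda>\<zeta>. g * (\<zeta> + 1)) ` set \<zeta>s"
  have injg: "inj_on (\<lambda>\<zeta>. g * (\<zeta> + 1)) (set \<zeta>s)" using g by (auto simp: inj_on_def)
  have cBv: "card Bv = r" unfolding Bv_def using card_image[OF injg] distinct_card[OF \<zeta>s(2)] \<zeta>s(1) by simp
  have sBv: "\<Sum>Bv = g * (sum_list \<zeta>s + int r)"
  proof -
    have "\<Sum>Bv = (\<Sum>\<zeta>\<in>set \<zeta>s. g * (\<zeta> + 1))" unfolding Bv_def by (subst sum.reindex[OF injg]) simp
    also have "\<dots> = g * (\<Sum>\<zeta>\<in>set \<zeta>s. \<zeta> + 1)" by (simp add: sum_distrib_left)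
    also have "(\<Sum>\<zeta>\<in>set \<zeta>s. \<zeta> + 1) = \<Sum>(set \<zeta>s) + int (card (set \<zeta>s))" by (simp add: sum.distrib)
    also have "\<Sum>(set \<zeta>s) = sum_list \<zeta>s" using sum_list_distinct_conv_sum_set[OF \<zeta>s(2), of "\<lambda>x. x"] by simp
    finally show ?thesis using distinct_card[OF \<zeta>s(2)] \<zeta>s(1) by simp
  qed
  have BvX: "1 \<le> a \<and> nat a \<in> X" if a: "a \<in> Bv" for a
  proof -
    obtain \<zeta> where "\<zeta> \<in> Z" "a = g * (\<zeta> + 1)" using a \<zeta>s(3) by (auto simp: Bv_def)
    moreover from this have "0 < g * (\<zeta> + 1)" using g by (intro mult_pos_pos) (auto simp: Z_def)
    ultimately show ?thesis by (auto simp: Z_def)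
  qed
  have "\<exists>as bs. length as = length ms \<and> length bs = length ms \<and> distinct as \<and> distinct bs \<and> set bs \<inter> Bv = {} \<and>
      (\<forall>a\<in>set as \<union> set bs. 1 \<le> a \<and> nat a \<in> X) \<and> sum_list as - sum_list bs = g * sum_list ms"
  proof (rule disjoint_differences[OF f msp])
    show "finite Bv" by (simp add: Bv_def)
    show "real_of_int (2 * (int k * n * g) + int (card Bv) + int (2 * length ms)) \<le> \<theta> * real_of_int N"
      using \<theta>(2) rl unfolding cBv ms(1) by (simp add: k_def algebra_simps)
  qed
  then obtain as bs where ab: "length as = l" "length bs = l" "distinct as" "distinct bs" "set bs \<inter> Bv = {}"
      "\<forall>a\<in>set as \<union> set bs. 1 \<le> a \<and> nat a \<in> X" "sum_list as - sum_list bs = g * sum_list ms" unfolding ms(1) by blast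
  define B where "B = set bs \<union> Bv"
  have finBv: "finite Bv" by (simp add: Bv_def)
  have "card B = card (set bs) + card Bv" unfolding B_def by (rule card_Un_disjoint) (use ab finBv in auto)
  then have cB: "card B = k" using distinct_card[OF ab(4)] ab(2) cBv by (simp add: k_def)
  have "\<Sum>B = \<Sum>(set bs) + \<Sum>Bv" unfolding B_def by (rule sum.union_disjoint) (use ab finBv in auto)
  moreover have "\<Sum>(set bs) = sum_list bs" "\<Sum>(set as) = sum_list as"
    using sum_list_distinct_conv_sum_set[OF ab(4), of "\<lambda>x. x"] sum_list_distinct_conv_sum_set[OF ab(3), of "\<lambda>x. x"] by simp_all
  ultimately have sum_eq: "\<Sum>B = \<Sum>(set as)" using sBv ab(7) ms(2) by (simp add: algebra_simps)
  have BX: "1 \<le> a \<and> nat a \<in> X" if "a \<in> B \<or> a \<in> set as" for a using that ab(6) BvX by (auto simp: B_def)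
  have inj: "inj_on nat S" if "\<And>a. a \<in> S \<Longrightarrow> 1 \<le> a" for S using that by (force simp: inj_on_def)
  have sum_nat: "int (\<Sum>(nat ` S)) = \<Sum>S" if "\<And>a. a \<in> S \<Longrightarrow> 1 \<le> a" for S
    by (subst sum.reindex[OF inj[OF that]]) (use that in \<open>force intro!: sum.cong\<close>)+
  have "\<Sum>(nat ` B) \<noteq> \<Sum>(nat ` set as)"
  proof (rule restricted_sum_freeD[OF rsf])
    show "card (nat ` B) = k" using card_image[OF inj[of B]] BX cB by simp
    show "card (nat ` set as) = l" using card_image[OF inj[of "set as"]] BX distinct_card[OF ab(3)] ab(1) by simp
  qed (use BX finBv in \<open>auto simp: B_def\<close>)
  moreover have "int (\<Sum>(nat ` B)) = int (\<Sum>(nat ` set as))"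
    using sum_nat[of B] sum_nat[of "set as"] BX sum_eq by simp
  ultimately show False by simp
qed

end

section \<open>Dense boxes along a chain\<close>

lemma restricted_sum_free_dilate:
  assumes "restricted_sum_free k l X" "d > 0"
  shows "restricted_sum_free k l {x. d * x \<in> X}"
  unfolding restricted_sum_free_def
proof (intro allI impI)
  fix a b :: "nat \<Rightarrow> nat"
  assume ab: "inj_on a {1..k} \<and> a ` {1..k} \<subseteq> {x. d * x \<in> X} \<and> inj_on b {1..l} \<and> b ` {1..l} \<subseteq> {x. d * x \<in> X}"
  have "(\<Sum>i=1..k. d * a i) \<noteq> (\<Sum>j=1..l. d * b j)"
  proof (rule assms(1)[unfolded restricted_sum_free_def, rule_format])
    show "inj_on (\<lambda>i. d * a i) {1..k} \<and> (\<lambda>i. d * a i) ` {1..k} \<subseteq> X \<and> inj_on (\<lambda>j. d * b j) {1..l} \<and> (\<lambda>j. d * b j) ` {1..l} \<subseteq> X"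
    proof (intro conjI)
      have inj: "inj ((*) d)" using assms(2) by (auto simp: inj_on_def)
      show "inj_on (\<lambda>i. d * a i) {1..k}" "inj_on (\<lambda>j. d * b j) {1..l}"
        using ab comp_inj_on[of a "{1..k}" "(*) d"] comp_inj_on[of b "{1..l}" "(*) d"] inj_on_subset[OF inj]
        by (simp_all add: comp_def)
    qed (use ab in blast)+
  qed
  then show "(\<Sum>i=1..k. a i) \<noteq> (\<Sum>j=1..l. b j)" unfolding sum_distrib_left[symmetric] by metis
qed

text \<open>\<open>W\<close>, \<open>B\<close> and \<open>Q\<close> depend only on r, l and c. For
  boxes i < j the almost period is g i * n with n = y i - (g j / g i) * y j. Since W divides g j / g
  i and y i = 1 modulo W, also n = 1 modulo W; as W is the factorial of w, n has no divisor from 2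
  to w. Lacunarity makes n close to y i.\<close>

lemma no_dense_chain:
  fixes r l :: nat and c :: real
  assumes rl: "r > 0" "l > 0" and c: "c \<le> 1" "1 < (real r + 2 * real l) * c"
  shows "\<exists>W B Q. W > 1 \<and> Q > 0 \<and> (\<forall>X g y. restricted_sum_free (r + l) l X \<longrightarrow>
      (\<forall>i\<le>B. g i > 0 \<and> y i mod W = 1 \<and> Q \<le> y i) \<longrightarrow>
      (\<forall>i<B. g i * W dvd g (Suc i) \<and> Q * (g (Suc i) * y (Suc i)) \<le> g i * y i) \<longrightarrow>
      (\<exists>i\<le>B. real (card {\<zeta>\<in>{1..y i}. g i * \<zeta> \<in> X}) < c * real (y i)))"
proof -
  define k where "k = r + l"
  have k2: "real k \<ge> 2" "k > 0" using rl by (auto simp: k_def)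
  define e where "e = (real k + real l) * c - 1"
  have e0: "e > 0" using c(2) by (simp add: e_def k_def algebra_simps)
  have c0: "c > 0"
  proof (rule ccontr)
    assume "\<not> c > 0"
    then have "(real r + 2 * real l) * c \<le> 0" by (intro mult_nonneg_nonpos) auto
    then show False using c(2) by simp
  qed
  \<comment> \<open>Chosen so that the allowance 20 * k * \<xi> for all losses fits both into the
    excess \<open>e\<close> and into c.\<close>
  define \<xi> where "\<xi> = min c e / (20 * real k)"
  have \<xi>0: "\<xi> > 0" using e0 c0 k2 by (simp add: \<xi>_def)
  have \<xi>k: "20 * real k * \<xi> = min c e" using k2 by (simp add: \<xi>_def)
  have \<xi>c: "20 * real k * \<xi> \<le> c" "1 + 20 * real k * \<xi> \<le> (real k + real l) * c"
    unfolding \<xi>k by (simp_all add: e_def)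
  have \<xi>40: "40 * \<xi> \<le> 1"
  proof -
    have "20 * 2 * \<xi> \<le> 20 * real k * \<xi>" using k2 \<xi>0 by (intro mult_right_mono) auto
    then show ?thesis using \<xi>c(1) c(1) by linarith
  qed
  define w where "w = nat \<lceil>1 / \<xi>\<rceil>"
  have w: "1 / \<xi> \<le> real w" unfolding w_def by linarith
  have "2 \<le> 1 / \<xi>" using \<xi>40 \<xi>0 by (simp add: field_simps)
  then have w2: "w \<ge> 2" using w by linarith
  define W :: nat where "W = fact w"
  have W1: "W > 1"
  proof -
    have "fact w \<ge> (fact 2 :: nat)" using w2 by (rule fact_mono)
    then show ?thesis by (simp add: W_def fact_numeral)
  qed
  define K\<^sub>1 where "K\<^sub>1 = nat \<lceil>2 * real k / \<xi>\<rceil>"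
  have K1r: "2 * real k / \<xi> \<le> real K\<^sub>1" unfolding K\<^sub>1_def by linarith
  have K1: "2 * real k \<le> \<xi> * K\<^sub>1" using K1r \<xi>0 by (simp add: field_simps)
  have K10: "K\<^sub>1 > 0" using K1r k2 \<xi>0 by (cases "K\<^sub>1 = 0") (auto simp: field_simps)
  define K where "K = k + K\<^sub>1"
  have K0: "K > 0" using K10 by (simp add: K_def)
  \<comment> \<open>\<open>d\<close> will bound \<open>D\<close>, and \<theta> is the popularity
    threshold. Each makes its term in the error condition of \<open>no_dense_scales\<close> at most
    \<xi>^6 / 16 * n, half of what is allowed. Then \<open>s\<close>, \<open>H\<close> and
    \<open>Q\<close> make each of 8 / s, 4 / H and 24 / Q at most d / 3.\<close>
  define d where "d = (\<xi> ^ 6 / (160 * real K\<^sub>1 * real K))\<^sup>2"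
  have d0: "d > 0" using \<xi>0 K10 K0 by (simp add: d_def)
  define \<theta> where "\<theta> = \<xi> ^ 6 / (48 * real k)"
  have \<theta>0: "\<theta> > 0" using \<xi>0 k2 by (simp add: \<theta>_def)
  define s where "s = nat \<lceil>24 / d\<rceil>"
  have sr: "24 / d \<le> real s" unfolding s_def by linarith
  define H where "H = nat \<lceil>12 / d\<rceil>"
  have Hr: "12 / d \<le> real H" unfolding H_def by linarith
  have s0: "s > 0" using sr d0 by (cases "s = 0") (auto simp: field_simps)
  have H0: "H > 0" using Hr d0 by (cases "H = 0") (auto simp: field_simps)
  have "\<exists>Q::nat. 72 / d + 4 * real k / \<theta> + 4 * (2 * real r + 3) / \<xi>\<^sup>2 + 2 / \<xi> + 2 \<le> real Q"
    by (rule real_arch_simple)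
  then obtain Q :: nat where Q: "72 / d + 4 * real k / \<theta> + 4 * (2 * real r + 3) / \<xi>\<^sup>2 + 2 / \<xi> + 2 \<le> real Q" ..
  have pos: "72 / d \<ge> 0" "4 * real k / \<theta> \<ge> 0" "4 * (2 * real r + 3) / \<xi>\<^sup>2 \<ge> 0" "2 / \<xi> \<ge> 0"
    using d0 \<theta>0 \<xi>0 by auto
  have Q1: "72 / d \<le> real Q" "4 * real k / \<theta> \<le> real Q" "4 * (2 * real r + 3) / \<xi>\<^sup>2 \<le> real Q" "2 / \<xi> \<le> real Q" "2 \<le> real Q"
    using Q pos by linarith+
  have Q0: "Q > 0" using Q1(5) by linarith
  have d_bound: "8 / s + 4 / H + 24 / Q \<le> d"
  proof -
    have "8 / s \<le> d / 3" "4 / H \<le> d / 3" "24 / Q \<le> d / 3"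
      using sr Hr Q1(1) s0 H0 Q0 d0 by (simp_all add: field_simps)
    then show ?thesis by linarith
  qed
  define R :: nat where "R = 2 * 2 ^ s + 1"
  \<comment> \<open>Box 0, the longest, becomes the cycle; the R * H + 1 boxes after it form the
    chain searched for an almost period.\<close>
  define B where "B = R * H + 1"
  have main: "\<exists>i\<le>B. real (card {\<zeta>\<in>{1..y i}. g i * \<zeta> \<in> X}) < c * real (y i)"
    if rsf: "restricted_sum_free (r + l) l X"
      and gy: "\<And>i. i \<le> B \<Longrightarrow> g i > 0 \<and> y i mod W = 1 \<and> Q \<le> y i"
      and ch: "\<And>i. i < B \<Longrightarrow> g i * W dvd g (Suc i) \<and> Q * (g (Suc i) * y (Suc i)) \<le> g i * y i" for X g y
  proof (rule ccontr)
    assume "\<not> ?thesis"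
    then have dense: "c * real (y i) \<le> real (card {\<zeta>\<in>{1..y i}. g i * \<zeta> \<in> X})" if "i \<le> B" for i
      using that by (auto simp: not_less)
    \<comment> \<open>Dividing out g 0 turns the longest box into the interval {1..y 0}; all later
      steps are divisible by g 0.\<close>
    define X' where "X' = {x. g 0 * x \<in> X}"
    have g00: "g 0 > 0" using gy[of 0] by simp
    have rsf': "restricted_sum_free (r + l) l X'"
      unfolding X'_def by (rule restricted_sum_free_dilate[OF rsf g00])
    have dvdW: "g i * W dvd g j" if "i < j" "j \<le> B" for i j
      using that(1)[unfolded less_eq_Suc_le] that(2)
    proof (induction j rule: dec_induct)
      case base then show ?case using ch[of i] by simp
    next
      case (step n)
      have "g n dvd g n * W" by simp
      also have "g n * W dvd g (Suc n)" using ch[of n] step by simp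
      finally show ?case using step by (auto intro: dvd_trans)
    qed
    have dvd0: "g 0 dvd g i" if "i \<le> B" for i
    proof (cases "i = 0")
      case False then show ?thesis using dvdW[of 0 i] that by (auto intro: dvd_mult_left)
    qed simp
    define h z where "h i = g (Suc i) div g 0" and "z i = y (Suc i)" for i
    have gh: "g (Suc i) = g 0 * h i" if "i \<le> R * H" for i
      using dvd0[of "Suc i"] that by (simp add: h_def B_def)
    have h0: "h i > 0" if "i \<le> R * H" for i
      using gh[OF that] gy[of "Suc i"] that by (cases "h i = 0") (auto simp: B_def)
    have hW: "h i * W dvd h j" if "i < j" "j \<le> R * H" for i j
    proof -
      have "g 0 * (h i * W) dvd g 0 * h j"
        using dvdW[of "Suc i" "Suc j"] gh[of i] gh[of j] that by (simp add: B_def mult.assoc)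
      then show ?thesis using g00 by simp
    qed
    have z: "z i mod W = 1" "Q \<le> z i" "z i > 0" if "i \<le> R * H" for i
      using gy[of "Suc i"] that Q0 by (auto simp: z_def B_def)
    have lac: "Q * (h (Suc i) * z (Suc i)) \<le> h i * z i" if "i < R * H" for i
    proof -
      have "g 0 * (Q * (h (Suc i) * z (Suc i))) \<le> g 0 * (h i * z i)"
        using ch[of "Suc i"] gh[of i] gh[of "Suc i"] that by (simp add: B_def z_def algebra_simps)
      then show ?thesis using g00 by simp
    qed
    define N where "N = int (y 0)"
    have y0: "Q \<le> y 0" "y 0 > 0" using gy[of 0] Q0 by auto
    have base: "Q * (h 0 * z 0) \<le> y 0"
    proof -
      have "g 0 * (Q * (h 0 * z 0)) \<le> g 0 * y 0"
        using ch[of 0] gh[of 0] by (simp add: B_def z_def algebra_simps)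
      then show ?thesis using g00 by simp
    qed
    have hz_mono: "h i * z i \<le> h 0 * z 0" if "i \<le> R * H" for i
      using that
    proof (induction i)
      case (Suc i)
      have "h (Suc i) * z (Suc i) \<le> Q * (h (Suc i) * z (Suc i))" using Q0 by simp
      also have "\<dots> \<le> h i * z i" using lac[of i] Suc by simp
      finally show ?case using Suc by simp
    qed simp
    define f :: "int \<Rightarrow> real" where "f x = of_bool (nat (x mod N + 1) \<in> X')" for x
    interpret cyclic_indicator N f
      by unfold_locales (use y0 in \<open>auto simp: N_def f_def\<close>)
    have avf: "c \<le> av N f"
    proof -
      have "(\<Sum>x\<in>{0..<N}. f x) = (\<Sum>\<zeta>\<in>{1..y 0}. of_bool (g 0 * \<zeta> \<in> X))"
      proof (rule sum.reindex_bij_witness[of _ "\<lambda>\<zeta>. int \<zeta> - 1" "\<lambda>x. nat (x + 1)"])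
        fix x assume "x \<in> {0..<N}"
        then show "of_bool (g 0 * nat (x + 1) \<in> X) = f x" by (simp add: f_def X'_def)
      qed (auto simp: N_def)
      also have "\<dots> = real (card {\<zeta>\<in>{1..y 0}. g 0 * \<zeta> \<in> X})"
        by (simp add: Int_def)
      finally have "c * real (y 0) \<le> (\<Sum>x\<in>{0..<N}. f x)" using dense[of 0] by simp
      then show ?thesis using y0 by (simp add: av_def N_def pos_le_divide_eq)
    qed
    obtain i j where ij: "i < j" "j \<le> R * H"
      and D: "D (int (h i)) (4 * K * z i) (int (h i * z i) - int (h j * z j)) \<le> 8 / s + 4 / H + 24 / Q"
    proof -
      have "\<exists>i j. i < j \<and> j \<le> R * H \<and>
        D (int (h i)) (4 * K * z i) (int (h i * z i) - int (h j * z j)) \<le> 8 / s + 4 / H + 24 / Q"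
      proof (rule almost_period_exists)
        show "R > 2 * 2 ^ s" by (simp add: R_def)
        show "h i dvd h (Suc i)" if "i < R * H" for i
          using hW[of i "Suc i"] that by (auto intro: dvd_mult_left)
        show "0 < h i \<and> 0 < z i" if "i \<le> R * H" for i using h0[OF that] z(3)[OF that] by simp
        show "Q * (h (Suc i) * z (Suc i)) \<le> h i * z i" if "i < R * H" for i by (rule lac[OF that])
        show "0 < 4 * K" using K0 by simp
        show "s > 0" by (rule s0)
        show "H > 0" by (rule H0)
        show "Q > 0" by (rule Q0)
      qed
      then show ?thesis using that by blast
    qed
    have iRH: "i \<le> R * H" using ij by simp
    obtain q where q: "h j = h i * W * q" using hW[OF ij] by (auto elim: dvdE)
    define n where "n = int (z i) - int (W * q * z j)"
    have gn: "int (h i) * n = int (h i * z i) - int (h j * z j)"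
      by (simp add: n_def q algebra_simps)
    have small: "Q * (W * q * z j) \<le> z i"
    proof -
      have "Q * (h j * z j) \<le> h i * z i"
      proof -
        have "h j * z j \<le> h (Suc i) * z (Suc i)"
        proof -
          have "h m * z m \<le> h (Suc i) * z (Suc i)" if "Suc i \<le> m" "m \<le> R * H" for m
            using that
          proof (induction m rule: dec_induct)
            case (step m)
            have "h (Suc m) * z (Suc m) \<le> Q * (h (Suc m) * z (Suc m))" using Q0 by simp
            also have "\<dots> \<le> h m * z m" using lac[of m] step by simp
            finally show ?case using step by simp
          qed simp
          then show ?thesis using ij by simp
        qed
        then have "Q * (h j * z j) \<le> Q * (h (Suc i) * z (Suc i))" by simp
        also have "\<dots> \<le> h i * z i" using lac[of i] ij by simp
        finally show ?thesis .
      qed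
      then have "h i * (Q * (W * q * z j)) \<le> h i * z i" by (simp add: q algebra_simps)
      then show ?thesis using h0[OF iRH] by simp
    qed
    have zr: "real Q * real_of_int (int (z i) - n) \<le> real (z i)"
    proof -
      have "real_of_int (int (z i) - n) = real (W * q * z j)" by (simp add: n_def)
      moreover have "real Q * real (W * q * z j) \<le> real (z i)"
        using of_nat_mono[OF small, where 'a = real] by (simp only: of_nat_mult)
      ultimately show ?thesis by simp
    qed
    have n_le: "n \<le> int (z i)" by (simp add: n_def)
    have zn: "real (z i) \<le> 2 * real_of_int n"
    proof -
      have "2 * real_of_int (int (z i) - n) \<le> real Q * real_of_int (int (z i) - n)"
        using Q1(5) n_le by (intro mult_right_mono) auto
      then show ?thesis using zr by simp
    qed
    have n0: "n > 0" using zn z(3)[OF iRH] by linarith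
    have nQ: "real Q \<le> 2 * real_of_int n" using zn z(2)[OF iRH] by linarith
    have gap: "real_of_int (int (z i) - n) \<le> \<xi> * n"
    proof -
      have "2 / \<xi> * real_of_int (int (z i) - n) \<le> real Q * real_of_int (int (z i) - n)"
        using Q1(4) n_le by (intro mult_right_mono) auto
      then have "2 / \<xi> * real_of_int (int (z i) - n) \<le> 2 * real_of_int n" using zr zn by linarith
      then show ?thesis using \<xi>0 by (simp add: field_simps)
    qed
    define M where "M = int K * int (z i)"
    have hn: "int (h i) * n \<le> int (h i * z i)" using n_le by (simp add: mult_left_mono)
    show False
    proof (rule no_dense_scales[where X = X' and r = r and l = l and g = "int (h i)" and n = n and M = M
          and K\<^sub>1 = K\<^sub>1 and L = "4 * K * z i" and \<xi> = \<xi> and \<theta> = \<theta> and c = c])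
      show "restricted_sum_free (r + l) l X'" by (rule rsf')
      show "f x = of_bool (nat (x mod N + 1) \<in> X')" for x by (simp add: f_def)
      show "int (h i) > 0" using h0[OF iRH] by simp
      show "(int (r + l) + int K\<^sub>1) * n \<le> M"
        using n_le unfolding M_def K_def k_def by (simp add: mult_left_mono)
      show "4 * M \<le> int (4 * K * z i)" by (simp add: M_def)
      have Q2: "real Q \<le> 2 * real_of_int n" by (rule nQ)
      have "2 / \<xi> \<le> 2 * real_of_int n" using Q1(4) Q2 by linarith
      then show "1 \<le> \<xi> * real_of_int n" using \<xi>0 by (simp add: field_simps)
      have "4 * (2 * real r + 3) / \<xi>\<^sup>2 \<le> 2 * real_of_int n" using Q1(3) Q2 by linarith
      then show "2 * real r + 3 \<le> \<xi>\<^sup>2 * real_of_int n / 2" using \<xi>0 by (simp add: field_simps)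
      show "2 * real (r + l) \<le> \<xi> * real K\<^sub>1" using K1 by (simp add: k_def)
      show "1 / \<xi> \<le> real_of_int a" if "a dvd n" "1 < a" for a
      proof (rule ccontr)
        assume "\<not> ?thesis"
        then have "real_of_int a < real w" using w by linarith
        then have "a \<le> int w" by linarith
        then have "nat a dvd W" unfolding W_def using that(2) by (intro dvd_fact) auto
        then have "int (nat a) dvd int W" by (simp only: int_dvd_int_iff)
        then have aW: "a dvd int W" using that(2) by simp
        have "a dvd int (z i)"
        proof -
          have "a dvd n + int W * (int q * int (z j))" using that(1) aW by (intro dvd_add dvd_mult2) auto
          then show ?thesis by (simp add: n_def algebra_simps)
        qed
        moreover have "int (z i) = int W * int (z i div W) + 1"
        proof -
          have "z i = W * (z i div W) + 1" using mult_div_mod_eq[of W "z i"] z(1)[OF iRH] by simp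
          then have "int (z i) = int (W * (z i div W) + 1)" by (rule arg_cong)
          then show ?thesis by simp
        qed
        ultimately have "a dvd int W * int (z i div W) + 1" by simp
        moreover have "a dvd int W * int (z i div W)" using aW by (rule dvd_mult2)
        ultimately have "a dvd 1" by (simp only: dvd_add_right_iff)
        then show False using that(2) by simp
      qed
      show "2 * real (r + l) * real_of_int (int (h i)) * real_of_int n + 2 * real (r + l) \<le> \<theta> * real_of_int N"
      proof -
        have "real_of_int (int (h i) * n) \<le> real (h i * z i)" 
          using hn of_int_le_iff[where 'a = real, of "int (h i) * n" "int (h i * z i)"] by (simp only: of_int_of_nat_eq)
        also have "\<dots> \<le> real (h 0 * z 0)" using hz_mono[OF iRH] by (rule of_nat_mono)
        finally have 1: "real_of_int (int (h i) * n) \<le> real (h 0 * z 0)" .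
        have 2: "real Q * real (h 0 * z 0) \<le> real (y 0)" 
          using of_nat_mono[OF base, where 'a = real] by (simp only: of_nat_mult)
        have 3: "4 * real k \<le> \<theta> * real Q" using Q1(2) \<theta>0 by (simp add: field_simps)
        have "4 * real k * real (h 0 * z 0) \<le> \<theta> * real Q * real (h 0 * z 0)" using 3 by (rule mult_right_mono) simp
        also have "\<dots> = \<theta> * (real Q * real (h 0 * z 0))" by simp
        also have "\<dots> \<le> \<theta> * real (y 0)" using 2 \<theta>0 by (intro mult_left_mono) auto
        finally have 4: "4 * real k * real (h 0 * z 0) \<le> \<theta> * real (y 0)" .
        have "4 * real k \<le> \<theta> * real (y 0)"
        proof -
          have "\<theta> * real Q \<le> \<theta> * real (y 0)" using y0(1) \<theta>0 by (intro mult_left_mono) auto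
          then show ?thesis using 3 by linarith
        qed
        moreover have "4 * real k * real_of_int (int (h i) * n) \<le> 4 * real k * real (h 0 * z 0)"
          using 1 by (intro mult_left_mono) auto
        moreover have "2 * real k * real_of_int (int (h i)) * real_of_int n = 2 * real k * real_of_int (int (h i) * n)"
          by simp
        ultimately have "2 * real k * real_of_int (int (h i)) * real_of_int n + 2 * real k \<le> \<theta> * real (y 0)"
          using 4 by linarith
        then show ?thesis unfolding k_def[symmetric] N_def by simp
      qed
      show "\<theta> * (2 * real (r + l) * real_of_int n + 1) +
        real K\<^sub>1 * sqrt ((2 * real_of_int M + 1) * (2 * real (4 * K * z i) * D (int (h i)) (4 * K * z i) (int (h i) * n)))
        \<le> \<xi> ^ 6 / 8 * real_of_int n"
      proof -
        have n1: "1 \<le> real_of_int n" using n0 by simp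
        have "2 * real k * real_of_int n + 1 \<le> 3 * real k * real_of_int n"
          using n1 k2 mult_mono[of 1 "real k" 1 "real_of_int n"] by (simp add: algebra_simps)
        then have "\<theta> * (2 * real k * real_of_int n + 1) \<le> \<theta> * (3 * real k * real_of_int n)"
          using \<theta>0 by (intro mult_left_mono) auto
        also have "\<dots> = \<xi> ^ 6 / 16 * real_of_int n" using k2 by (simp add: \<theta>_def)
        finally have 1: "\<theta> * (2 * real k * real_of_int n + 1) \<le> \<xi> ^ 6 / 16 * real_of_int n" .
        let ?D = "D (int (h i)) (4 * K * z i) (int (h i) * n)"
        have Dd: "?D \<le> d" using D d_bound unfolding gn by linarith
        have Kr: "real K \<ge> 1" using K0 by simp
        have M1: "2 * real_of_int M + 1 \<le> 6 * real K * n"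
        proof -
          have "real_of_int M \<ge> 1" using Kr z(3)[OF iRH] by (simp add: M_def mult_ge1_I)
          then have "2 * real_of_int M + 1 \<le> 3 * real_of_int M" by simp
          also have "\<dots> = 3 * (real K * real (z i))" by (simp add: M_def)
          also have "\<dots> \<le> 3 * (real K * (2 * real_of_int n))" using zn by (intro mult_left_mono) auto
          finally show ?thesis by simp
        qed
        have L1: "2 * real (4 * K * z i) * ?D \<le> 16 * real K * n * d"
        proof -
          have "2 * real (4 * K * z i) * ?D \<le> 2 * real (4 * K * z i) * d" using Dd by (intro mult_left_mono) auto
          also have "\<dots> = 8 * real K * d * real (z i)" by simp
          also have "\<dots> \<le> 8 * real K * d * (2 * real_of_int n)" using zn d0 by (intro mult_left_mono) auto
          finally show ?thesis by simp
        qed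
        have M0: "0 \<le> 2 * real_of_int M + 1" by (simp add: M_def)
        have "(2 * real_of_int M + 1) * (2 * real (4 * K * z i) * ?D) \<le> (2 * real_of_int M + 1) * (16 * real K * n * d)"
          using L1 M0 by (rule mult_left_mono)
        also have "\<dots> \<le> (6 * real K * n) * (16 * real K * n * d)"
          using M1 d0 n0 by (intro mult_right_mono) auto
        \<comment> \<open>6 * 16 = 96 is rounded up to 10^2, so that the root can be taken.\<close>
        also have "\<dots> \<le> (10 * real K * n)\<^sup>2 * d"
          using d0 n0 by (simp add: power2_eq_square zero_le_mult_iff)
        finally have "sqrt ((2 * real_of_int M + 1) * (2 * real (4 * K * z i) * ?D)) \<le> sqrt ((10 * real K * n)\<^sup>2 * d)"
          by (rule real_sqrt_le_mono)
        also have "\<dots> = 10 * real K * n * (\<xi> ^ 6 / (160 * real K\<^sub>1 * real K))"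
          using n0 \<xi>0 by (simp add: d_def real_sqrt_mult)
        finally have "real K\<^sub>1 * sqrt ((2 * real_of_int M + 1) * (2 * real (4 * K * z i) * ?D))
           \<le> real K\<^sub>1 * (10 * real K * n * (\<xi> ^ 6 / (160 * real K\<^sub>1 * real K)))"
          by (intro mult_left_mono) auto
        also have "\<dots> = \<xi> ^ 6 / 16 * n" using K10 K0 by (simp add: field_simps)
        finally show ?thesis using 1 by (simp add: k_def)
      qed
      show "20 * real (r + l) * \<xi> \<le> c" "1 + 20 * real (r + l) * \<xi> \<le> (real (r + l) + real l) * c"
        using \<xi>c by (simp_all only: k_def)
      show "c * real_of_int n - \<xi> * real_of_int n \<le> real (card {\<zeta> \<in> {1..n}. nat (int (h i) * \<zeta>) \<in> X'})"
      proof -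
        let ?S = "{\<zeta>\<in>{1..z i}. g (Suc i) * \<zeta> \<in> X}"
        let ?T = "{\<zeta> \<in> {1..n}. nat (int (h i) * \<zeta>) \<in> X'}"
        have eq: "nat (int (h i) * int \<zeta>) \<in> X' \<longleftrightarrow> g (Suc i) * \<zeta> \<in> X" for \<zeta>
          unfolding X'_def gh[OF iRH] by (simp add: nat_mult_distrib mult.assoc)
        have "int ` ?S \<subseteq> ?T \<union> {n<..int (z i)}" using eq by auto
        moreover have finT: "finite ?T" by (rule finite_subset[of _ "{1..n}"]) auto
        ultimately have "card (int ` ?S) \<le> card (?T \<union> {n<..int (z i)})" by (intro card_mono) auto
        also have "\<dots> \<le> card ?T + card {n<..int (z i)}" by (rule card_Un_le)
        finally have "card ?S \<le> card ?T + nat (int (z i) - n)" by (simp add: card_image)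
        then have "real (card ?S) \<le> real (card ?T) + real_of_int (int (z i) - n)" using n_le by linarith
        moreover have "c * real (z i) \<le> real (card ?S)" using dense[of "Suc i"] iRH by (simp add: z_def B_def)
        moreover have "c * n \<le> c * real (z i)" using c0 n_le by (intro mult_left_mono) (auto simp: of_int_le_iff[symmetric] simp del: of_int_le_iff)
        ultimately show ?thesis using gap by linarith
      qed
      show "0 \<le> \<theta>" using \<theta>0 by simp
      show "r > 0" "l > 0" by (rule rl)+
      show "n > 0" by (rule n0)
      show "0 < \<xi>" by (rule \<xi>0)
      show "K\<^sub>1 > 0" by (rule K10)
      show "c \<le> 1" by (rule c(1))
      show "c \<le> av N f" by (rule avf)
    qed
  qed
  have "\<forall>X g y. restricted_sum_free (r + l) l X \<longrightarrow>
      (\<forall>i\<le>B. g i > 0 \<and> y i mod W = 1 \<and> Q \<le> y i) \<longrightarrow>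
      (\<forall>i<B. g i * W dvd g (Suc i) \<and> Q * (g (Suc i) * y (Suc i)) \<le> g i * y i) \<longrightarrow>
      (\<exists>i\<le>B. real (card {\<zeta>\<in>{1..y i}. g i * \<zeta> \<in> X}) < c * real (y i))"
  proof (intro allI impI)
    fix X g y
    assume a: "restricted_sum_free (r + l) l X" "\<forall>i\<le>B. g i > 0 \<and> y i mod W = 1 \<and> Q \<le> y i"
      "\<forall>i<B. g i * W dvd g (Suc i) \<and> Q * (g (Suc i) * y (Suc i)) \<le> g i * y i"
    show "\<exists>i\<le>B. real (card {\<zeta>\<in>{1..y i}. g i * \<zeta> \<in> X}) < c * real (y i)"
    proof (rule main[OF a(1)])
      show "g i > 0 \<and> y i mod W = 1 \<and> Q \<le> y i" if "i \<le> B" for i using a(2) that by simp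
      show "g i * W dvd g (Suc i) \<and> Q * (g (Suc i) * y (Suc i)) \<le> g i * y i" if "i < B" for i using a(3) that by simp
    qed
  qed
  note chain = this
  show ?thesis
    by (rule exI[of _ W], rule exI[of _ B], rule exI[of _ Q], intro conjI) (fact W1 Q0 chain)+
qed

section \<open>Averaging over a long chain\<close>

lemma strict_enumeration:
  fixes S :: "nat set"
  assumes "finite S" "B < card S"
  shows "\<exists>e. (\<forall>i\<le>B. e i \<in> S) \<and> (\<forall>i<B. e i < e (Suc i))"
proof (intro exI[of _ "\<lambda>i. sorted_list_of_set S ! i"] conjI allI impI)
  have len: "length (sorted_list_of_set S) = card S" by simp
  fix i
  show "i \<le> B \<Longrightarrow> sorted_list_of_set S ! i \<in> S"
    using assms len nth_mem[of i "sorted_list_of_set S"] by simp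
  show "i < B \<Longrightarrow> sorted_list_of_set S ! i < sorted_list_of_set S ! Suc i"
    using assms len by (intro sorted_wrt_nth_less[OF strict_sorted_list_of_set]) auto
qed

text \<open>The chain conditions pass to subsequences, so at most \<open>B\<close> boxes have
  density at least c: B + 1 of them would contradict \<open>no_dense_chain\<close>. With J > B /
  \<eta> these exceptions add at most \<eta> * J to the sum.\<close>

lemma few_dense_boxes:
  fixes r l :: nat and c \<eta> :: real
  assumes rl: "r > 0" "l > 0" and c: "c \<le> 1" "1 < (real r + 2 * real l) * c" and \<eta>: "\<eta> > 0"
  shows "\<exists>(J::nat) (G :: nat \<Rightarrow> nat) (Y :: nat \<Rightarrow> nat). J > 0 \<and> (\<forall>i<J. G i > 0 \<and> Y i > 0) \<and> (\<forall>X. restricted_sum_free (r + l) l X \<longrightarrow>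
    (\<Sum>i<J. real (card {\<zeta>\<in>{1..Y i}. G i * \<zeta> \<in> X}) / Y i) \<le> (c + \<eta>) * J)"
proof -
  obtain W B Q where W: "W > (1::nat)" and Q: "Q > (0::nat)" and chain: "\<And>X g y. restricted_sum_free (r + l) l X \<Longrightarrow>
      (\<forall>i\<le>B. g i > 0 \<and> y i mod W = 1 \<and> Q \<le> y i) \<Longrightarrow>
      (\<forall>i<B. g i * W dvd g (Suc i) \<and> Q * (g (Suc i) * y (Suc i)) \<le> g i * y i) \<Longrightarrow>
      (\<exists>i\<le>B. real (card {\<zeta>\<in>{1..y i}. g i * \<zeta> \<in> X}) < c * real (y i))"
    using no_dense_chain[OF rl c] by blast
  obtain J :: nat where J: "real B / \<eta> < real J" using reals_Archimedean2 by blast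
  have J0: "J > 0" using J \<eta> by (cases "J = 0") (auto simp: divide_less_0_iff not_less)
  have JB: "real B \<le> \<eta> * J" using J \<eta> by (simp add: field_simps)
  define G where "G i = W ^ i" for i
  \<comment> \<open>The form 1 + W * ... gives 1 modulo W. In the ratio 2 * Q * W, the factor W
    offsets the growth of \<open>G\<close>, Q is the required lacunarity, and 2 absorbs the added
    1.\<close>
  define Y where "Y i = 1 + W * (2 * Q * W) ^ (J - i)" for i
  have Y1: "Y i mod W = 1" for i
    unfolding Y_def mod_mult_self2 using W by simp
  have YQ: "Q \<le> Y i" if "i < J" for i
  proof -
    have "2 * Q * W \<le> (2 * Q * W) ^ (J - i)" using that Q W by (intro self_le_power) auto
    moreover have "Q \<le> 2 * Q * W" using W by (simp add: mult.assoc)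
    moreover have "(2 * Q * W) ^ (J - i) \<le> W * (2 * Q * W) ^ (J - i)" using W by simp
    ultimately show ?thesis unfolding Y_def by linarith
  qed
  have lac_step: "Q * (G (Suc i) * Y (Suc i)) \<le> G i * Y i" if "Suc i < J" for i
  proof -
    define P where "P = (2 * Q * W) ^ (J - Suc i)"
    have P1: "P \<ge> 1" using Q W by (simp add: P_def)
    have "J - i = Suc (J - Suc i)" using that by simp
    then have Yi: "Y i = 1 + W * (2 * Q * W * P)" by (simp only: Y_def P_def power_Suc)
    have "Q * W * 1 \<le> Q * W * (W * P)" using W P1 by (intro mult_left_mono) (auto simp: Suc_le_eq)
    moreover have "Q * W * (1 + W * P) = Q * W * 1 + Q * W * (W * P)" by (simp only: distrib_left)
    moreover have "W * (2 * Q * W * P) = Q * W * (W * P) + Q * W * (W * P)" by (simp add: algebra_simps)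
    ultimately have "Q * W * (1 + W * P) \<le> 1 + W * (2 * Q * W * P)" by linarith
    then have "W ^ i * (Q * W * (1 + W * P)) \<le> W ^ i * (1 + W * (2 * Q * W * P))" by (rule mult_left_mono) simp
    then show ?thesis unfolding Yi by (simp add: G_def Y_def P_def algebra_simps)
  qed
  have lac: "Q * (G j * Y j) \<le> G i * Y i" if "i < j" "j < J" for i j
    using that(1)[unfolded less_eq_Suc_le] that(2)
  proof (induction j rule: dec_induct)
    case base then show ?case using lac_step[of i] by simp
  next
    case (step n)
    have "Q * (G (Suc n) * Y (Suc n)) \<le> G n * Y n" using lac_step[of n] step by simp
    also have "\<dots> \<le> Q * (G n * Y n)" using Q by simp
    also have "\<dots> \<le> G i * Y i" using step by simp
    finally show ?case .
  qed
  have bound: "(\<Sum>i<J. real (card {\<zeta>\<in>{1..Y i}. G i * \<zeta> \<in> X}) / Y i) \<le> (c + \<eta>) * J"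
    if rsf: "restricted_sum_free (r + l) l X" for X
  proof -
    define de where "de i = real (card {\<zeta>\<in>{1..Y i}. G i * \<zeta> \<in> X}) / Y i" for i
    define S where "S = {i. i < J \<and> c \<le> de i}"
    have finS: "finite S" by (simp add: S_def)
    have "card S \<le> B"
    proof (rule ccontr)
      assume "\<not> ?thesis"
      then obtain e where e: "\<And>i. i \<le> B \<Longrightarrow> e i \<in> S" "\<And>i. i < B \<Longrightarrow> e i < e (Suc i)"
        using strict_enumeration[OF finS, of B] by auto
      have eJ: "e i < J" if "i \<le> B" for i using e(1)[OF that] by (simp add: S_def)
      have "\<exists>i\<le>B. real (card {\<zeta>\<in>{1..Y (e i)}. G (e i) * \<zeta> \<in> X}) < c * real (Y (e i))"
      proof (rule chain[OF rsf])
        show "\<forall>i\<le>B. 0 < G (e i) \<and> Y (e i) mod W = 1 \<and> Q \<le> Y (e i)"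
          using W Y1 YQ eJ by (auto simp: G_def)
        show "\<forall>i<B. G (e i) * W dvd G (e (Suc i)) \<and> Q * (G (e (Suc i)) * Y (e (Suc i))) \<le> G (e i) * Y (e i)"
        proof (intro allI impI conjI)
          fix i assume i: "i < B"
          show "Q * (G (e (Suc i)) * Y (e (Suc i))) \<le> G (e i) * Y (e i)"
            using lac[OF e(2)[OF i] eJ] i by simp
          have "W ^ Suc (e i) dvd W ^ e (Suc i)" using e(2)[OF i] by (intro le_imp_power_dvd) simp
          then show "G (e i) * W dvd G (e (Suc i))" by (simp add: G_def mult.commute)
        qed
      qed
      then obtain i where i: "i \<le> B" "real (card {\<zeta>\<in>{1..Y (e i)}. G (e i) * \<zeta> \<in> X}) < c * real (Y (e i))" by auto
      have "Y (e i) > 0" by (simp add: Y_def)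
      then have "de (e i) < c" using i(2) by (simp add: de_def pos_divide_less_eq)
      then show False using e(1)[OF i(1)] by (simp add: S_def)
    qed
    have de1: "de i \<le> 1" for i
    proof -
      have "card {\<zeta>\<in>{1..Y i}. G i * \<zeta> \<in> X} \<le> card {1..Y i}" by (rule card_mono) auto
      then have "real (card {\<zeta>\<in>{1..Y i}. G i * \<zeta> \<in> X}) \<le> real (Y i)" by simp
      then show ?thesis unfolding de_def by (rule divide_le_eq_1_pos[THEN iffD2, rotated]) (simp add: Y_def add_pos_nonneg)
    qed
    have c0: "c \<ge> 0"
    proof (rule ccontr)
      assume "\<not> c \<ge> 0"
      then have "(real r + 2 * real l) * c \<le> 0" by (intro mult_nonneg_nonpos) auto
      then show False using c(2) by simp
    qed
    have "(\<Sum>i<J. de i) \<le> (\<Sum>i<J. c + of_bool (i \<in> S))"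
    proof (rule sum_mono)
      fix i assume "i \<in> {..<J}"
      then show "de i \<le> c + of_bool (i \<in> S)" using de1[of i] c0 by (auto simp: S_def)
    qed
    also have "\<dots> = c * J + card S"
    proof -
      have "{..<J} \<inter> S = S" by (auto simp: S_def)
      then show ?thesis by (simp add: sum.distrib)
    qed
    also have "\<dots> \<le> c * J + \<eta> * J" using \<open>card S \<le> B\<close> JB by linarith
    finally show ?thesis by (simp add: de_def algebra_simps)
  qed
  show ?thesis
    by (intro exI[of _ J] exI[of _ G] exI[of _ Y] conjI J0 allI impI bound) (use W in \<open>auto simp: G_def Y_def\<close>)
qed

section \<open>Transfer to one finite set by a multiplicative Foelner set\<close>

text \<open>
  The sets of products of the elements \<open>s t\<close> with exponents at most \<open>E\<close> grow polynomially in \<open>E\<close>, so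
  one of them is almost invariant under multiplication by each \<open>s t\<close>.
\<close>

lemma folner_set:
  fixes s :: "'t \<Rightarrow> nat" and \<epsilon> :: real
  assumes fin: "finite T" and s: "\<And>t. t \<in> T \<Longrightarrow> s t > 0" and \<epsilon>: "\<epsilon> > 0"
  shows "\<exists>F F'. finite F' \<and> F \<subseteq> F' \<and> F \<noteq> {} \<and> (\<forall>x\<in>F'. 0 < x) \<and> (\<forall>t\<in>T. \<forall>x\<in>F. s t * x \<in> F') \<and>
    real (card F') \<le> (1 + \<epsilon>) * card F"
proof -
  define F where "F E = (\<lambda>e. \<Prod>t\<in>T. s t ^ e t) ` (T \<rightarrow>\<^sub>E {..E})" for E :: nat
  have finP: "finite (T \<rightarrow>\<^sub>E {..E::nat})" for E using fin by (intro finite_PiE) auto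
  have finF: "finite (F E)" for E using finP by (simp add: F_def)
  have cF: "card (F E) \<le> (E + 1) ^ card T" for E
  proof -
    have "card (F E) \<le> card (T \<rightarrow>\<^sub>E {..E})" unfolding F_def by (rule card_image_le[OF finP])
    also have "\<dots> = (E + 1) ^ card T" using fin by (simp add: card_PiE)
    finally show ?thesis .
  qed
  have one: "1 \<in> F E" for E
    unfolding F_def by (rule image_eqI[of _ _ "\<lambda>t\<in>T. 0"]) auto
  have sub: "F E \<subseteq> F (Suc E)" for E
    unfolding F_def by (intro image_mono PiE_mono) auto
  have mul: "s t * x \<in> F (Suc E)" if t: "t \<in> T" and x: "x \<in> F E" for t x E
  proof -
    obtain e where e: "e \<in> T \<rightarrow>\<^sub>E {..E}" "x = (\<Prod>t\<in>T. s t ^ e t)" using x by (auto simp: F_def)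
    define e' where "e' = e(t := Suc (e t))"
    have "(\<Prod>u\<in>T. s u ^ e' u) = s t ^ Suc (e t) * (\<Prod>u\<in>T - {t}. s u ^ e u)"
      using fin t by (simp add: prod.remove[of T t] e'_def)
    also have "\<dots> = s t * x" unfolding e(2) using fin t by (simp add: prod.remove[of T t])
    finally have "s t * x = (\<Prod>u\<in>T. s u ^ e' u)" by simp
    moreover have "e' \<in> T \<rightarrow>\<^sub>E {..Suc E}"
      using e(1) t by (auto simp: e'_def PiE_iff extensional_def le_Suc_eq)
    ultimately show ?thesis unfolding F_def by (rule image_eqI)
  qed
  have posF: "x > 0" if "x \<in> F E" for x E
    using that s fin by (auto simp: F_def)
  have "\<exists>E. real (card (F (Suc E))) \<le> (1 + \<epsilon>) * card (F E)"
  proof (rule ccontr)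
    assume "\<not> ?thesis"
    then have grow: "(1 + \<epsilon>) * card (F E) < card (F (Suc E))" for E by (auto simp: not_le)
    have low: "(1 + \<epsilon>) ^ E \<le> card (F E)" for E
    proof (induction E)
      case 0
      have "card (F 0) > 0" using one[of 0] finF[of 0] by (auto simp: card_gt_0_iff)
      then show ?case by simp
    next
      case (Suc E)
      have "(1 + \<epsilon>) ^ Suc E \<le> (1 + \<epsilon>) * card (F E)" using Suc \<epsilon> by simp
      then show ?case using grow[of E] by linarith
    qed
    define a where "a = ln (1 + \<epsilon>)"
    have a: "a > 0" using \<epsilon> by (simp add: a_def)
    have "((\<lambda>x::real. x ^ card T / exp x) \<longlongrightarrow> 0) at_top" by (rule tendsto_power_div_exp_0)
    moreover have "filterlim (\<lambda>E. a * real (E + 1)) at_top sequentially"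
      using a by (intro filterlim_tendsto_pos_mult_at_top[OF tendsto_const] filterlim_compose[OF filterlim_real_sequentially] filterlim_add_const_nat_at_top) auto
    ultimately have "((\<lambda>E. (a * real (E + 1)) ^ card T / exp (a * real (E + 1))) \<longlongrightarrow> 0) sequentially"
      by (rule filterlim_compose)
    moreover have "a ^ card T / (1 + \<epsilon>) > 0" using a \<epsilon> by simp
    ultimately have "eventually (\<lambda>E. (a * real (E + 1)) ^ card T / exp (a * real (E + 1)) < a ^ card T / (1 + \<epsilon>)) sequentially"
      by (rule order_tendstoD(2))
    then obtain E where E: "(a * real (E + 1)) ^ card T / exp (a * real (E + 1)) < a ^ card T / (1 + \<epsilon>)"
      by (auto simp: eventually_sequentially)
    have "exp (a * real (E + 1)) = (1 + \<epsilon>) ^ (E + 1)"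
      using \<epsilon> by (simp only: a_def mult.commute[of "ln _"] exp_of_nat_mult) simp
    then have "real (E + 1) ^ card T < (1 + \<epsilon>) ^ E"
    proof -
      have "a ^ card T / (1 + \<epsilon>) * (real (E + 1) ^ card T / (1 + \<epsilon>) ^ E)
         = (a * real (E + 1)) ^ card T / exp (a * real (E + 1))"
        unfolding \<open>exp _ = _\<close> power_mult_distrib by simp
      also have "\<dots> < a ^ card T / (1 + \<epsilon>) * 1" using E by simp
      finally have "real (E + 1) ^ card T / (1 + \<epsilon>) ^ E < 1"
        using \<open>a ^ card T / (1 + \<epsilon>) > 0\<close> by (simp only: mult_less_cancel_left_pos)
      then show ?thesis using \<epsilon> by simp
    qed
    moreover have "real (card (F E)) \<le> real (E + 1) ^ card T" using cF[of E] by (metis of_nat_le_iff of_nat_power)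
    ultimately show False using low[of E] by linarith
  qed
  then obtain E where E: "real (card (F (Suc E))) \<le> (1 + \<epsilon>) * card (F E)" ..
  show ?thesis
  proof (rule exI[of _ "F E"], rule exI[of _ "F (Suc E)"], intro conjI ballI)
    show "F E \<noteq> {}" using one[of E] by auto
  qed (fact finF sub posF mul E)+
qed

text \<open>Apply \<open>bound\<close> to the dilates {n. x * n \<in> S} and sum over x in F. For
  each t the set s t * F lies in F' and misses at most \<epsilon> * |F| of its elements, so the sum
  counts nearly all of S with total weight 1.\<close>

lemma weights_to_set:
  fixes s :: "'t \<Rightarrow> nat" and wt :: "'t \<Rightarrow> real" and c \<epsilon> :: real
  assumes fin: "finite T" and s: "\<And>t. t \<in> T \<Longrightarrow> s t > 0" and wt: "\<And>t. t \<in> T \<Longrightarrow> wt t \<ge> 0" "(\<Sum>t\<in>T. wt t) = 1"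
    and bound: "\<And>X. restricted_sum_free k l X \<Longrightarrow> (\<Sum>t\<in>T. wt t * of_bool (s t \<in> X)) \<le> c" and c: "c \<ge> 0" and \<epsilon>: "\<epsilon> > 0"
  shows "\<exists>A. finite A \<and> A \<noteq> {} \<and> (\<forall>x\<in>A. 0 < x) \<and>
    (\<forall>S\<subseteq>A. restricted_sum_free k l S \<longrightarrow> real (card S) \<le> (c + \<epsilon>) * card A)"
proof -
  obtain F F' where F: "finite F'" "F \<subseteq> F'" "F \<noteq> {}" "\<And>x. x \<in> F' \<Longrightarrow> 0 < x" "\<And>t x. t \<in> T \<Longrightarrow> x \<in> F \<Longrightarrow> s t * x \<in> F'"
    "real (card F') \<le> (1 + \<epsilon>) * card F" using folner_set[where s = s, OF fin s \<epsilon>] by metis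
  have finF: "finite F" using F(1,2) finite_subset by blast
  show ?thesis
  proof (intro exI[of _ F'] conjI allI impI ballI)
    fix S assume S: "S \<subseteq> F'" "restricted_sum_free k l S"
    have each: "real (card S) - \<epsilon> * card F \<le> card {x\<in>F. s t * x \<in> S}" if t: "t \<in> T" for t
    proof -
      have inj: "inj_on (\<lambda>x. s t * x) F" using s[OF t] by (auto simp: inj_on_def)
      have "S \<subseteq> (\<lambda>x. s t * x) ` {x\<in>F. s t * x \<in> S} \<union> (F' - (\<lambda>x. s t * x) ` F)" using S(1) by auto
      then have "card S \<le> card ((\<lambda>x. s t * x) ` {x\<in>F. s t * x \<in> S} \<union> (F' - (\<lambda>x. s t * x) ` F))"
        by (rule card_mono[rotated]) (use F(1) finF in auto)
      also have "\<dots> \<le> card ((\<lambda>x. s t * x) ` {x\<in>F. s t * x \<in> S}) + card (F' - (\<lambda>x. s t * x) ` F)" by (rule card_Un_le)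
      also have "card ((\<lambda>x. s t * x) ` {x\<in>F. s t * x \<in> S}) \<le> card {x\<in>F. s t * x \<in> S}" using finF by (intro card_image_le) auto
      also have "card (F' - (\<lambda>x. s t * x) ` F) = card F' - card F"
        using F(5)[OF t] F(1) finF card_image[OF inj] by (subst card_Diff_subset) auto
      finally have "card S \<le> card {x\<in>F. s t * x \<in> S} + (card F' - card F)" by simp
      then have "real (card S) \<le> real (card {x\<in>F. s t * x \<in> S}) + (real (card F') - real (card F))"
        using card_mono[OF F(1,2)] by linarith
      then show ?thesis using F(6) by (simp add: algebra_simps)
    qed
    have "real (card S) - \<epsilon> * card F = (\<Sum>t\<in>T. wt t * (real (card S) - \<epsilon> * card F))"
      using wt(2) by (simp add: sum_distrib_right[symmetric])
    also have "\<dots> \<le> (\<Sum>t\<in>T. wt t * card {x\<in>F. s t * x \<in> S})"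
      by (intro sum_mono mult_left_mono each wt)
    also have "\<dots> = (\<Sum>t\<in>T. \<Sum>x\<in>F. wt t * of_bool (s t \<in> {n. x * n \<in> S}))"
    proof (rule sum.cong[OF refl])
      fix t
      have "F \<inter> {x. s t * x \<in> S} = {x\<in>F. s t * x \<in> S}" by auto
      then show "wt t * card {x\<in>F. s t * x \<in> S} = (\<Sum>x\<in>F. wt t * of_bool (s t \<in> {n. x * n \<in> S}))"
        using finF by (simp add: sum_distrib_left[symmetric] mult.commute[of "s t"])
    qed
    also have "\<dots> = (\<Sum>x\<in>F. \<Sum>t\<in>T. wt t * of_bool (s t \<in> {n. x * n \<in> S}))" by (rule sum.swap)
    also have "\<dots> \<le> (\<Sum>x\<in>F. c)"
      using F(2,4) by (intro sum_mono bound restricted_sum_free_dilate[OF S(2)]) auto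
    finally have "real (card S) \<le> (c + \<epsilon>) * card F" by (simp add: algebra_simps)
    also have "\<dots> \<le> (c + \<epsilon>) * card F'" using card_mono[OF F(1,2)] c \<epsilon> by (intro mult_left_mono) auto
    finally show "real (card S) \<le> (c + \<epsilon>) * card F'" .
  qed (use F in auto)
qed

lemma restricted_sum_free_subset: "restricted_sum_free k l S \<Longrightarrow> S' \<subseteq> S \<Longrightarrow> restricted_sum_free k l S'"
  unfolding restricted_sum_free_def by (meson subset_trans)

lemma restricted_sum_free_empty: "k > 0 \<Longrightarrow> restricted_sum_free k l {}"
  unfolding restricted_sum_free_def by auto

text \<open>The weights choose a box uniformly and then a point of it uniformly, so the bound of
  \<open>few_dense_boxes\<close> becomes the hypothesis of \<open>weights_to_set\<close>. A third of
  \<epsilon> each goes into the threshold \<open>c\<close>, the average over the chain and the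
  Foelner ratio.\<close>

lemma small_sets_exist:
  fixes k l :: nat and \<epsilon> :: real
  assumes kl: "0 < l" "l < k" and \<epsilon>: "\<epsilon> > 0"
  shows "\<exists>A. finite A \<and> A \<noteq> {} \<and> (\<forall>x\<in>A. 0 < x) \<and>
    (\<forall>S\<subseteq>A. restricted_sum_free k l S \<longrightarrow> real (card S) \<le> (1 / real (k + l) + \<epsilon>) * card A)"
proof -
  define r where "r = k - l"
  have r: "r > 0" "k = r + l" using kl by (auto simp: r_def)
  define c where "c = min 1 (1 / real (k + l) + \<epsilon> / 3)"
  have kl2: "real (k + l) = real r + 2 * real l" "real (k + l) > 1" using r kl by auto
  have c1: "c \<le> 1" "c \<le> 1 / real (k + l) + \<epsilon> / 3" by (simp_all add: c_def)
  have c2: "1 < (real r + 2 * real l) * c"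
  proof -
    have "1 / real (k + l) < c" unfolding c_def using kl2 \<epsilon> by simp
    then show ?thesis using kl2 by (simp add: field_simps)
  qed
  obtain J :: nat and G Y :: "nat \<Rightarrow> nat" where J: "J > 0" and GY: "\<And>i. i < J \<Longrightarrow> G i > 0 \<and> Y i > 0" and bd: "\<And>X. restricted_sum_free (r + l) l X \<Longrightarrow>
    (\<Sum>i<J. real (card {\<zeta>\<in>{1..Y i}. G i * \<zeta> \<in> X}) / Y i) \<le> (c + \<epsilon> / 3) * J"
    using few_dense_boxes[OF r(1) kl(1) c1(1) c2, of "\<epsilon> / 3"] \<epsilon> by auto
  define T where "T = Sigma {..<J} (\<lambda>i. {1..Y i})"
  define s where "s t = G (fst t) * snd t" for t
  define wt where "wt t = 1 / (real J * real (Y (fst t)))" for t :: "nat \<times> nat"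
  have "\<exists>A. finite A \<and> A \<noteq> {} \<and> (\<forall>x\<in>A. 0 < x) \<and>
    (\<forall>S\<subseteq>A. restricted_sum_free k l S \<longrightarrow> real (card S) \<le> (c + \<epsilon> / 3 + \<epsilon> / 3) * card A)"
  proof (rule weights_to_set[where s = s and wt = wt and T = T])
    show "finite T" by (simp add: T_def)
    show "s t > 0" if "t \<in> T" for t using that GY by (auto simp: T_def s_def)
    show "wt t \<ge> 0" for t by (simp add: wt_def)
    have "(\<Sum>t\<in>T. wt t) = (\<Sum>i<J. \<Sum>\<zeta>\<in>{1..Y i}. 1 / (real J * real (Y i)))"
      unfolding T_def wt_def by (subst sum.Sigma) (auto simp: case_prod_unfold)
    also have "\<dots> = (\<Sum>i<J. 1 / real J)" by (rule sum.cong) (use GY in auto)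
    finally show "(\<Sum>t\<in>T. wt t) = 1" using J by simp
    show "(\<Sum>t\<in>T. wt t * of_bool (s t \<in> X)) \<le> c + \<epsilon> / 3" if X: "restricted_sum_free k l X" for X
    proof -
      have "(\<Sum>t\<in>T. wt t * of_bool (s t \<in> X)) = (\<Sum>i<J. \<Sum>\<zeta>\<in>{1..Y i}. 1 / (real J * real (Y i)) * of_bool (G i * \<zeta> \<in> X))"
        unfolding T_def wt_def s_def by (subst sum.Sigma) (auto simp: case_prod_unfold)
      also have "\<dots> = (\<Sum>i<J. real (card {\<zeta>\<in>{1..Y i}. G i * \<zeta> \<in> X}) / Y i) / J"
        unfolding sum_divide_distrib
      proof (rule sum.cong[OF refl])
        fix i
        have "{1..Y i} \<inter> {\<zeta>. G i * \<zeta> \<in> X} = {\<zeta>\<in>{1..Y i}. G i * \<zeta> \<in> X}" by auto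
        then have "(\<Sum>\<zeta>\<in>{1..Y i}. of_bool (G i * \<zeta> \<in> X)) = real (card {\<zeta>\<in>{1..Y i}. G i * \<zeta> \<in> X})"
          by (subst sum_of_bool_eq) auto
        then show "(\<Sum>\<zeta>\<in>{1..Y i}. 1 / (real J * real (Y i)) * of_bool (G i * \<zeta> \<in> X)) = real (card {\<zeta>\<in>{1..Y i}. G i * \<zeta> \<in> X}) / Y i / J"
          by (simp only: sum_distrib_left[symmetric]) (simp add: field_simps)
      qed
      also have "\<dots> \<le> c + \<epsilon> / 3" using bd[of X] X r(2) J by (simp add: pos_divide_le_eq)
      finally show ?thesis .
    qed
    show "0 \<le> c + \<epsilon> / 3" using \<epsilon> by (simp add: c_def)
    show "\<epsilon> / 3 > 0" using \<epsilon> by simp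
  qed
  then obtain A where A: "finite A" "A \<noteq> {}" "\<forall>x\<in>A. 0 < x"
    "\<And>S. S \<subseteq> A \<Longrightarrow> restricted_sum_free k l S \<Longrightarrow> real (card S) \<le> (c + \<epsilon> / 3 + \<epsilon> / 3) * card A" by blast
  have "(c + \<epsilon> / 3 + \<epsilon> / 3) * card A \<le> (1 / real (k + l) + \<epsilon>) * card A"
    using c1(2) by (intro mult_right_mono) auto
  then show ?thesis using A by (intro exI[of _ A]) (auto intro: order_trans)
qed

section \<open>The asymptotics\<close>

lemma max_restricted_sum_free_set:
  assumes "finite A" "k > 0"
  shows "finite {card S | S. S \<subseteq> A \<and> restricted_sum_free k l S}" "{card S | S. S \<subseteq> A \<and> restricted_sum_free k l S} \<noteq> {}"
proof -
  have "{card S | S. S \<subseteq> A \<and> restricted_sum_free k l S} \<subseteq> card ` Pow A" by auto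
  then show "finite {card S | S. S \<subseteq> A \<and> restricted_sum_free k l S}"
    using assms(1) by (meson finite_Pow_iff finite_imageI finite_subset)
  show "{card S | S. S \<subseteq> A \<and> restricted_sum_free k l S} \<noteq> {}"
    using restricted_sum_free_empty[OF assms(2), of l] by auto
qed

lemma M_hat_le:
  assumes A: "finite A" "\<forall>x\<in>A. 0 < x" and k: "k > 0"
    and b: "\<And>S. S \<subseteq> A \<Longrightarrow> restricted_sum_free k l S \<Longrightarrow> real (card S) \<le> b"
  shows "real (M_hat k l (card A)) \<le> b"
proof -
  have "M_hat k l (card A) \<le> max_restricted_sum_free k l A"
    unfolding M_hat_def by (rule cINF_lower) (use A in auto)
  moreover have "max_restricted_sum_free k l A \<in> {card S | S. S \<subseteq> A \<and> restricted_sum_free k l S}"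
    unfolding max_restricted_sum_free_def by (rule Max_in[OF max_restricted_sum_free_set[OF A(1) k]])
  then obtain S where "S \<subseteq> A" "restricted_sum_free k l S" "max_restricted_sum_free k l A = card S" by auto
  then have "real (max_restricted_sum_free k l A) \<le> b" using b by simp
  ultimately show ?thesis by linarith
qed

lemma M_hat_ge:
  assumes k: "k > 0"
    and b: "\<And>A. finite A \<Longrightarrow> card A = N \<Longrightarrow> \<forall>x\<in>A. 0 < x \<Longrightarrow> \<exists>S\<subseteq>A. restricted_sum_free k l S \<and> b \<le> real (card S)"
  shows "b \<le> real (M_hat k l N)"
proof -
  define AA :: "nat set set" where "AA = {A. finite A \<and> card A = N \<and> (\<forall>x\<in>A. 0 < x)}"
  have "{1..N} \<in> AA" unfolding AA_def by simp
  then have ne: "AA \<noteq> {}" by auto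
  have "nat \<lceil>b\<rceil> \<le> (INF A\<in>AA. max_restricted_sum_free k l A)"
  proof (rule cINF_greatest[OF ne])
    fix A assume "A \<in> AA"
    then have A: "finite A" "card A = N" "\<forall>x\<in>A. 0 < x" unfolding AA_def by simp_all
    from b[OF this] obtain S where S: "S \<subseteq> A" "restricted_sum_free k l S" "b \<le> real (card S)" by blast
    have "card S \<in> {card S | S. S \<subseteq> A \<and> restricted_sum_free k l S}" using S(1,2) by blast
    then have "card S \<le> max_restricted_sum_free k l A"
      unfolding max_restricted_sum_free_def by (rule Max_ge[OF max_restricted_sum_free_set(1)[OF A(1) k]])
    moreover have "nat \<lceil>b\<rceil> \<le> card S" using S(3) by (simp add: nat_le_iff ceiling_le_iff)
    ultimately show "nat \<lceil>b\<rceil> \<le> max_restricted_sum_free k l A" by (rule order_trans[rotated])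
  qed
  then have "nat \<lceil>b\<rceil> \<le> M_hat k l N" unfolding M_hat_def AA_def .
  then have "real (nat \<lceil>b\<rceil>) \<le> real (M_hat k l N)" by (rule of_nat_mono)
  then show ?thesis using real_nat_ceiling_ge[of b] by (rule order_trans[rotated])
qed

lemma M_hat_upper:
  fixes k l :: nat and \<epsilon> :: real
  assumes kl: "0 < l" "l < k" and \<epsilon>: "\<epsilon> > 0"
  shows "\<exists>C. \<forall>N. real (M_hat k l N) \<le> (1 / real (k + l) + \<epsilon>) * N + C"
proof -
  define c where "c = 1 / real (k + l) + \<epsilon>"
  have c0: "c \<ge> 0" using \<epsilon> by (simp add: c_def)
  obtain A\<^sub>0 where A0: "finite A\<^sub>0" "A\<^sub>0 \<noteq> {}" "\<And>x. x \<in> A\<^sub>0 \<Longrightarrow> 0 < x"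
    and A0c: "\<And>S. S \<subseteq> A\<^sub>0 \<Longrightarrow> restricted_sum_free k l S \<Longrightarrow> real (card S) \<le> c * card A\<^sub>0"
    using small_sets_exist[OF kl \<epsilon>] unfolding c_def by blast
  \<comment> \<open>With \<Lambda> above every element, an equation \<Lambda>^i * a = \<Lambda>^j *
    b with i < j would force a >= \<Lambda>. So the dilates by powers of \<Lambda> are
    disjoint.\<close>
  define \<Lambda> where "\<Lambda> = Suc (Max A\<^sub>0)"
  have \<Lambda>: "a < \<Lambda>" if "a \<in> A\<^sub>0" for a using Max_ge[OF A0(1) that] by (simp add: \<Lambda>_def)
  have \<Lambda>0: "\<Lambda> > 0" by (simp add: \<Lambda>_def)
  define D where "D i = (\<lambda>a. \<Lambda> ^ i * a) ` A\<^sub>0" for i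
  have injD: "inj_on (\<lambda>a. \<Lambda> ^ i * a) A\<^sub>0" for i using \<Lambda>0 by (auto simp: inj_on_def)
  have cD: "card (D i) = card A\<^sub>0" for i unfolding D_def by (rule card_image[OF injD])
  have finD: "finite (D i)" for i using A0(1) by (simp add: D_def)
  have disj: "D i \<inter> D j = {}" if "i < j" for i j
  proof -
    have False if "a \<in> A\<^sub>0" "b \<in> A\<^sub>0" "\<Lambda> ^ i * a = \<Lambda> ^ j * b" for a b
    proof -
      have "\<Lambda> ^ j = \<Lambda> ^ i * \<Lambda> ^ (j - i)" using \<open>i < j\<close> by (simp flip: power_add)
      then have "a = \<Lambda> ^ (j - i) * b" using that(3) \<Lambda>0 by simp
      moreover have "\<Lambda> ^ 1 \<le> \<Lambda> ^ (j - i)" using \<open>i < j\<close> \<Lambda>0 by (intro power_increasing) auto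
      then have "\<Lambda> * 1 \<le> \<Lambda> ^ (j - i) * b" using A0(3)[OF that(2)] by (intro mult_mono) auto
      ultimately show False using \<Lambda>[OF that(1)] by simp
    qed
    then show ?thesis unfolding D_def by blast
  qed
  have disj': "D i \<inter> D j = {}" if "i \<noteq> j" for i j
    using disj[of i j] disj[of j i] that by (auto simp: Int_commute neq_iff)
  have "real (M_hat k l N) \<le> c * N + c * card A\<^sub>0" for N
  proof -
    \<comment> \<open>One more copy than fits into N elements. Cutting the union down to exactly N
      elements costs at most the constant c * |\<open>A\<^sub>0\<close>|.\<close>
    define m where "m = N div card A\<^sub>0 + 1"
    have cA0: "card A\<^sub>0 > 0" using A0 by (simp add: card_gt_0_iff)
    define U where "U = (\<Union>i<m. D i)"
    have "card U = (\<Sum>i<m. card (D i))"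
      unfolding U_def by (rule card_UN_disjoint) (use finD disj' in auto)
    then have cU: "card U = m * card A\<^sub>0" by (simp add: cD)
    have "N div card A\<^sub>0 * card A\<^sub>0 + N mod card A\<^sub>0 = N" "N mod card A\<^sub>0 < card A\<^sub>0" using cA0 by simp_all
    then have "N \<le> card U" and mN: "m * card A\<^sub>0 \<le> N + card A\<^sub>0" unfolding cU m_def by (simp_all only: add_mult_distrib)
    then obtain A where A: "A \<subseteq> U" "card A = N" using obtain_subset_with_card_n by metis
    have finU: "finite U" unfolding U_def using finD by simp
    have finA: "finite A" using A finU finite_subset by blast
    have Apos: "\<forall>x\<in>A. 0 < x" using A(1) A0(3) \<Lambda>0 by (force simp: U_def D_def)
    have "real (M_hat k l (card A)) \<le> c * N + c * card A\<^sub>0"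
    proof (rule M_hat_le[OF finA Apos])
      show "k > 0" using kl by simp
      fix S assume S: "S \<subseteq> A" "restricted_sum_free k l S"
      have "S \<subseteq> (\<Union>i<m. (\<lambda>a. \<Lambda> ^ i * a) ` {a\<in>A\<^sub>0. \<Lambda> ^ i * a \<in> S})"
        using S(1) A(1) by (fastforce simp: U_def D_def)
      then have "card S \<le> card (\<Union>i<m. (\<lambda>a. \<Lambda> ^ i * a) ` {a\<in>A\<^sub>0. \<Lambda> ^ i * a \<in> S})"
        by (rule card_mono[rotated]) (use A0(1) in auto)
      also have "\<dots> \<le> (\<Sum>i<m. card ((\<lambda>a. \<Lambda> ^ i * a) ` {a\<in>A\<^sub>0. \<Lambda> ^ i * a \<in> S}))"
        by (rule card_UN_le) simp
      also have "\<dots> \<le> (\<Sum>i<m. card {a\<in>A\<^sub>0. \<Lambda> ^ i * a \<in> S})"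
        using A0(1) by (intro sum_mono card_image_le) auto
      finally have "real (card S) \<le> real (\<Sum>i<m. card {a\<in>A\<^sub>0. \<Lambda> ^ i * a \<in> S})" by (rule of_nat_mono)
      also have "\<dots> = (\<Sum>i<m. real (card {a\<in>A\<^sub>0. \<Lambda> ^ i * a \<in> S}))" by simp
      also have "\<dots> \<le> (\<Sum>i<m. c * card A\<^sub>0)"
      proof (intro sum_mono A0c)
        fix i
        show "restricted_sum_free k l {a\<in>A\<^sub>0. \<Lambda> ^ i * a \<in> S}"
          by (rule restricted_sum_free_subset[OF restricted_sum_free_dilate[OF S(2), of "\<Lambda> ^ i"]]) (use \<Lambda>0 in auto)
      qed auto
      also have "\<dots> = c * real (m * card A\<^sub>0)" by simp
      also have "\<dots> \<le> c * real (N + card A\<^sub>0)" using mN c0 by (intro mult_left_mono of_nat_mono) auto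
      finally show "real (card S) \<le> c * N + c * card A\<^sub>0" by (simp add: algebra_simps)
    qed
    then show ?thesis using A(2) by simp
  qed
  then show ?thesis unfolding c_def by blast
qed

section \<open>Lower bound from a middle interval of residues\<close>

text \<open>The open interval from l * m / q to k * m / q has length m / (k + l), because q = k^2 -
  l^2, and it contains at least that many integers minus one. It lies below m since k <= q.\<close>

lemma middle_interval_card:
  fixes k l m :: nat
  assumes kl: "0 < l" "l < k" and m: "m > 0"
  defines "q \<equiv> (k - l) * (k + l)"
  shows "real m / real (k + l) - 1 \<le> card {y\<in>{..<m}. l * m < q * y \<and> q * y < k * m}"
proof -
  have q0: "q > 0" using kl by (simp add: q_def)
  have "1 * (k + l) \<le> (k - l) * (k + l)" by (rule mult_le_mono1) (use kl in simp)
  then have qk: "k \<le> q" unfolding q_def by (rule order_trans[rotated]) simp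
  have eq: "{y\<in>{..<m}. l * m < q * y \<and> q * y < k * m} = {l * m div q<..(k * m - 1) div q}"
  proof (intro set_eqI iffI)
    fix y assume "y \<in> {y\<in>{..<m}. l * m < q * y \<and> q * y < k * m}"
    then have "l * m < q * y" "q * y \<le> k * m - 1" by auto
    then show "y \<in> {l * m div q<..(k * m - 1) div q}"
      using q0 by (simp add: div_less_iff_less_mult less_eq_div_iff_mult_less_eq mult.commute)
  next
    fix y assume "y \<in> {l * m div q<..(k * m - 1) div q}"
    then have "l * m < q * y" "q * y \<le> k * m - 1"
      using q0 by (simp_all add: div_less_iff_less_mult less_eq_div_iff_mult_less_eq mult.commute)
    moreover have "k * m > 0" using kl m by simp
    ultimately have "q * y < k * m" by linarith
    also have "\<dots> \<le> q * m" using qk by simp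
    finally have "y < m" by simp
    with \<open>l * m < q * y\<close> \<open>q * y < k * m\<close> show "y \<in> {y\<in>{..<m}. l * m < q * y \<and> q * y < k * m}" by simp
  qed
  have "real (k * m) \<le> real q * (real ((k * m - 1) div q) + 1)"
  proof -
    have "q * ((k * m - 1) div q) + (k * m - 1) mod q = k * m - 1" "(k * m - 1) mod q < q" "k * m > 0"
      using q0 kl m by simp_all
    then have "k * m \<le> q * ((k * m - 1) div q) + q" by linarith
    then have "k * m \<le> q * ((k * m - 1) div q + 1)" by simp
    then have "real (k * m) \<le> real (q * ((k * m - 1) div q + 1))" by (rule of_nat_mono)
    then show ?thesis by (simp only: of_nat_mult of_nat_add of_nat_1)
  qed
  then have 1: "real (k * m) / q - 1 \<le> real ((k * m - 1) div q)"
    using q0 by (simp add: field_simps)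
  have 2: "real (l * m div q) \<le> real (l * m) / q" by (rule of_nat_div_le_of_nat)
  have 3: "real m / real (k + l) = real (k * m) / q - real (l * m) / q"
  proof -
    have "real q = (real k - real l) * (real k + real l)" using kl by (simp add: q_def of_nat_diff)
    then show ?thesis using kl by (simp add: diff_divide_distrib[symmetric] left_diff_distrib[symmetric])
  qed
  show ?thesis unfolding eq using 1 2 3 by simp
qed

lemma sum_strict_bounds:
  fixes F :: "nat \<Rightarrow> nat"
  assumes "k > 0" "\<And>i. i \<in> {1..k} \<Longrightarrow> lo < F i \<and> F i < hi"
  shows "k * lo < (\<Sum>i=1..k. F i)" "(\<Sum>i=1..k. F i) < k * hi"
proof -
  have ne: "{1..k} \<noteq> {}" using assms(1) by simp
  have "(\<Sum>i=1..k. lo) < (\<Sum>i=1..k. F i)" by (rule sum_strict_mono[OF _ ne]) (use assms(2) in simp_all)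
  then show "k * lo < (\<Sum>i=1..k. F i)" by simp
  have "(\<Sum>i=1..k. F i) < (\<Sum>i=1..k. hi)" by (rule sum_strict_mono[OF _ ne]) (use assms(2) in simp_all)
  then show "(\<Sum>i=1..k. F i) < k * hi" by simp
qed

lemma large_sum_free_subset:
  assumes kl: "0 < l" "l < k" and A: "finite A" "\<forall>x\<in>A. 0 < x"
  shows "\<exists>S\<subseteq>A. restricted_sum_free k l S \<and> real (card A) / real (k + l) - 1 \<le> real (card S)"
proof -
  \<comment> \<open>This modulus is coprime to every element of \<open>A\<close>, so multiplication
    by the element permutes the residues, and it is at least |A|, so the rounding loss |A| / m in
    the final count is at most 1.\<close>
  define m where "m = 1 + card A * \<Prod>A"
  have m: "m > 0" "card A \<le> m"
  proof -
    have "\<Prod>A \<ge> 1" using A by (metis One_nat_def Suc_leI prod_pos)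
    then have "card A * 1 \<le> card A * \<Prod>A" by (rule mult_le_mono2)
    then have "card A \<le> card A * \<Prod>A" by (simp only: mult_1_right)
    then show "m > 0" "card A \<le> m" unfolding m_def by linarith+
  qed
  have cop: "coprime a m" if "a \<in> A" for a
  proof -
    have "a dvd card A * \<Prod>A" using that A(1) by (intro dvd_mult dvd_prodI) auto
    then obtain t where t: "card A * \<Prod>A = a * t" by (rule dvdE)
    have "gcd a (t * a + 1) = gcd a 1" by (rule gcd_add_mult)
    moreover have "m = t * a + 1" by (simp add: m_def t mult.commute)
    ultimately show ?thesis by (simp only: coprime_iff_gcd_eq_1) simp
  qed
  define q where "q = (k - l) * (k + l)"
  have q0: "q > 0" using kl by (simp add: q_def)
  define I where "I = {y\<in>{..<m}. l * m < q * y \<and> q * y < k * m}"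
  have cI: "real m / real (k + l) - 1 \<le> card I"
    unfolding I_def q_def by (rule middle_interval_card[OF kl m(1)])
  have bij: "bij_betw (\<lambda>x. (x * a) mod m) {..<m} {..<m}" if a: "a \<in> A" for a
  proof -
    have *: "x = x'" if "x' \<le> x" "x < m" "(x * a) mod m = (x' * a) mod m" for x x'
    proof -
      have "m dvd x * a - x' * a" using that by (intro mod_eq_dvd_iff_nat[THEN iffD1]) auto
      then have "m dvd (x - x') * a" by (simp add: diff_mult_distrib)
      then have "m dvd x - x'" using cop[OF a] by (simp add: coprime_dvd_mult_left_iff coprime_commute)
      then have "x - x' = 0 \<or> m \<le> x - x'" by (auto dest: dvd_imp_le)
      then show ?thesis using that(1,2) by linarith
    qed
    have "inj_on (\<lambda>x. (x * a) mod m) {..<m}"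
    proof (rule inj_onI)
      fix x x' assume "x \<in> {..<m}" "x' \<in> {..<m}" "(x * a) mod m = (x' * a) mod m"
      then show "x = x'" using *[of x' x] *[of x x'] by (metis lessThan_iff nat_le_linear)
    qed
    moreover have "(\<lambda>x. (x * a) mod m) ` {..<m} \<subseteq> {..<m}" using m(1) by auto
    ultimately show ?thesis by (simp add: bij_betw_def endo_inj_surj)
  qed
  have cnt: "card {x\<in>{..<m}. (x * a) mod m \<in> I} = card I" if a: "a \<in> A" for a
  proof -
    have "bij_betw (\<lambda>x. (x * a) mod m) {x\<in>{..<m}. (x * a) mod m \<in> I} I"
      unfolding bij_betw_def
    proof
      show "inj_on (\<lambda>x. (x * a) mod m) {x\<in>{..<m}. (x * a) mod m \<in> I}"
        by (rule inj_on_subset[OF bij_betw_imp_inj_on[OF bij[OF a]]]) auto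
      have surj: "(\<lambda>x. (x * a) mod m) ` {..<m} = {..<m}" by (rule bij_betw_imp_surj_on[OF bij[OF a]])
      have "I \<subseteq> (\<lambda>x. (x * a) mod m) ` {..<m}" unfolding surj I_def by blast
      then show "(\<lambda>x. (x * a) mod m) ` {x\<in>{..<m}. (x * a) mod m \<in> I} = I" by blast
    qed
    then show ?thesis by (rule bij_betw_same_card)
  qed
  have "(\<Sum>x<m. card {a\<in>A. (x * a) mod m \<in> I}) = (\<Sum>x<m. \<Sum>a\<in>A. of_bool ((x * a) mod m \<in> I))"
    using A(1) by (simp add: Int_def)
  also have "\<dots> = (\<Sum>a\<in>A. \<Sum>x<m. of_bool ((x * a) mod m \<in> I))" by (rule sum.swap)
  also have "\<dots> = (\<Sum>a\<in>A. card {x\<in>{..<m}. (x * a) mod m \<in> I})" by (simp add: Int_def)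
  also have "\<dots> = card A * card I" using cnt by simp
  finally have tot: "(\<Sum>x<m. card {a\<in>A. (x * a) mod m \<in> I}) = card A * card I" .
  have "\<exists>x<m. card A * card I \<le> m * card {a\<in>A. (x * a) mod m \<in> I}"
  proof (rule ccontr)
    assume "\<not> ?thesis"
    then have "(\<Sum>x<m. m * card {a\<in>A. (x * a) mod m \<in> I}) < (\<Sum>x<m. card A * card I)"
      using m(1) by (intro sum_strict_mono) auto
    moreover have "(\<Sum>x<m. m * card {a\<in>A. (x * a) mod m \<in> I}) = m * (card A * card I)"
      by (simp only: sum_distrib_left[symmetric] tot)
    ultimately show False by simp
  qed
  then obtain x where x: "card A * card I \<le> m * card {a\<in>A. (x * a) mod m \<in> I}" by auto
  define S where "S = {a\<in>A. (x * a) mod m \<in> I}"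
  have "real (card A) * (real m / real (k + l) - 1) \<le> real (card A) * card I"
    using cI by (rule mult_left_mono) simp
  also have "\<dots> \<le> real m * card S" using x unfolding S_def by (metis of_nat_le_iff of_nat_mult)
  finally have "real m * (real (card A) / real (k + l)) - real (card A) \<le> real m * card S"
    by (simp add: right_diff_distrib mult.commute)
  moreover have "real (card A) \<le> real m * 1" using m(2) by simp
  ultimately have "real m * (real (card A) / real (k + l) - 1) \<le> real m * card S"
    unfolding right_diff_distrib by linarith
  then have size: "real (card A) / real (k + l) - 1 \<le> real (card S)" using m(1) by simp
  have "restricted_sum_free k l S"
    unfolding restricted_sum_free_def
  proof (intro allI impI notI)
    fix a b :: "nat \<Rightarrow> nat"
    assume ab: "inj_on a {1..k} \<and> a ` {1..k} \<subseteq> S \<and> inj_on b {1..l} \<and> b ` {1..l} \<subseteq> S"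
      and eq: "(\<Sum>i=1..k. a i) = (\<Sum>j=1..l. b j)"
    define P where "P = (\<Sum>i=1..k. (x * a i) mod m)"
    define R where "R = (\<Sum>j=1..l. (x * b j) mod m)"
    have aI: "l * m < q * ((x * a i) mod m) \<and> q * ((x * a i) mod m) < k * m" if "i \<in> {1..k}" for i
      using ab that by (auto simp: S_def I_def image_subset_iff)
    have bI: "l * m < q * ((x * b i) mod m) \<and> q * ((x * b i) mod m) < k * m" if "i \<in> {1..l}" for i
      using ab that by (auto simp: S_def I_def image_subset_iff)
    have k0: "k > 0" using kl by simp
    \<comment> \<open>The bounds are kept multiplied by q. Since k * l * m bounds q * P below and q
      * R above, R < P; since (k^2 - l^2) * m = q * m, also P < R + m. But P - R is a multiple of
      m.\<close>
    have P1: "k * (l * m) < q * P" and P2: "q * P < k * (k * m)"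
      using sum_strict_bounds[of k "l * m" "\<lambda>i. q * ((x * a i) mod m)" "k * m", OF k0 aI]
      unfolding P_def sum_distrib_left by simp_all
    have R1: "l * (l * m) < q * R" and R2: "q * R < l * (k * m)"
      using sum_strict_bounds[of l "l * m" "\<lambda>i. q * ((x * b i) mod m)" "k * m", OF kl(1) bI]
      unfolding R_def sum_distrib_left by simp_all
    have "l * (k * m) = k * (l * m)" by simp
    then have "q * R < q * P" using P1 R2 by linarith
    then have RP: "R < P" using q0 by simp
    have ql: "q * m + l * (l * m) = k * (k * m)"
    proof -
      obtain d where d: "k = l + d" using kl(2) by (metis less_imp_add_positive)
      then show ?thesis by (simp add: q_def algebra_simps)
    qed
    have "q * P < q * (R + m)" using P2 R1 ql unfolding distrib_left by linarith
    then have PR: "P < R + m" using q0 by simp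
    have "P mod m = (\<Sum>i=1..k. x * a i) mod m" unfolding P_def by (rule mod_sum_eq)
    also have "\<dots> = (\<Sum>j=1..l. x * b j) mod m" using eq by (simp only: sum_distrib_left[symmetric])
    also have "\<dots> = R mod m" unfolding R_def by (rule mod_sum_eq[symmetric])
    finally have "m dvd P - R" using RP by (intro mod_eq_dvd_iff_nat[THEN iffD1]) auto
    then show False using RP PR by (auto dest!: dvd_imp_le)
  qed
  then show ?thesis using size by (intro exI[of _ S]) (auto simp: S_def)
qed

theorem theorem1p2:
  fixes k l :: nat
  assumes "0 < l" and "l < k" and "k \<le> 2 * l + 1"
  shows "\<exists>\<epsilon> :: nat \<Rightarrow> real. \<epsilon> \<in> o(\<lambda>_. 1) \<and>
           (\<forall>N. real (M_hat k l N) = (1 / real (k + l) + \<epsilon> N) * real N)"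
proof -
  define c where "c = 1 / real (k + l)"
  define e where "e N = real (M_hat k l N) / N - c" for N :: nat
  have k0: "k > 0" using assms by simp
  have lower: "c * N - 1 \<le> real (M_hat k l N)" for N
  proof (rule M_hat_ge[OF k0])
    fix A :: "nat set" assume A: "finite A" "card A = N" "\<forall>x\<in>A. 0 < x"
    show "\<exists>S\<subseteq>A. restricted_sum_free k l S \<and> c * real N - 1 \<le> real (card S)"
      using large_sum_free_subset[OF assms(1,2) A(1,3)] A(2) by (simp add: c_def)
  qed
  have "e \<longlonglongrightarrow> 0"
  proof (rule LIMSEQ_I)
    fix \<delta> :: real assume \<delta>: "\<delta> > 0"
    obtain C where C: "\<And>N. real (M_hat k l N) \<le> (c + \<delta> / 2) * N + C"
      using M_hat_upper[OF assms(1,2), of "\<delta> / 2"] \<delta> unfolding c_def by auto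
    \<comment> \<open>\<bar>C\<bar> absorbs the constant of the upper bound, and the added 1 the
      loss in \<open>lower\<close>.\<close>
    obtain N\<^sub>0 :: nat where N0: "2 * (\<bar>C\<bar> + 1) / \<delta> < real N\<^sub>0" using reals_Archimedean2 by blast
    show "\<exists>no. \<forall>N\<ge>no. norm (e N - 0) < \<delta>"
    proof (intro exI[of _ "Suc N\<^sub>0"] allI impI)
      fix N assume N: "Suc N\<^sub>0 \<le> N"
      have Np: "real N > 0" using N by simp
      have "2 * (\<bar>C\<bar> + 1) / \<delta> < real N" using N0 N by linarith
      then have big: "\<bar>C\<bar> + 1 < \<delta> / 2 * N" using \<delta> by (simp add: field_simps)
      have eN: "e N * N = real (M_hat k l N) - c * N" using Np by (simp add: e_def field_simps)
      have "e N * N < \<delta> * N"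
        using C[of N] big unfolding eN by (simp add: algebra_simps)
      moreover have "- \<delta> * N < e N * N"
      proof -
        have "\<delta> / 2 * N < \<delta> * N" using \<delta> Np by simp
        then show ?thesis using lower[of N] big unfolding eN by (simp add: algebra_simps)
      qed
      ultimately have "e N < \<delta>" "- \<delta> < e N" using Np by (simp_all only: mult_less_cancel_right_pos)
      then show "norm (e N - 0) < \<delta>" by (simp add: abs_less_iff)
    qed
  qed
  then have "e \<in> o(\<lambda>_. 1)" by (intro smalloI_tendsto) auto
  moreover have "real (M_hat k l N) = (1 / real (k + l) + e N) * real N" for N
  \<comment> \<open>For N = 0 the right side vanishes whatever \<open>e 0\<close> is, so
    \<open>M_hat k l 0\<close> has to be 0; the empty set gives this.\<close>
  proof (cases "N = 0")
    case True
    have "real (M_hat k l (card ({} :: nat set))) \<le> 0" by (rule M_hat_le) (use k0 in auto)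
    then show ?thesis using True by simp
  qed (simp add: e_def c_def)
  ultimately show ?thesis by blast
qed

end
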